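(* Let $\mathcal{C}^{\rm rt}_{>1}$ be the class of rooted trees having more than one element and let $\prod$ be the operation of finite direct product. Then $\mathrm{Perf}_s(\prod,\mathcal{C}^{\rm rt}_{>1})$ holds (see context). Consequently, if $n\geq 1$, $\mathbb{X}_i\in\mathcal{C}^{\rm rt}_{>1}$ for $i<n$, $\mathcal{T}:=\mathrm{Th}(\prod_{i<n}\mathbb{X}_i)$ and $\mathcal{T}_i:=\mathrm{Th}(\mathbb{X}_i)$ for $i<n$, then: (a) $\max\{I(\mathcal{T}_i):i<n\}\leq I(\mathcal{T})\leq\prod_{i<n}I(\mathcal{T}_i)$; thus, $I(\mathcal{T})=1$ if and only if $I(\mathcal{T}_i)=1$ for each $i<n$. (b) If the theories $\mathcal{T}_i$, $i<n$, satisfy Vaught's conjecture, then $\mathcal{T}$ satisfies Vaught's conjecture: defining $\kappa:=\prod_{i<n}I(\mathcal{T}_i)$, we have $I(\mathcal{T})=\kappa$ if $\kappa\in\{1,\omega,\mathfrak{c}\}$, and $I(\mathcal{T})\in[3,\omega)$ otherwise. (c) $\mathcal{T}$ is atomic if and only if the theories $\mathcal{T}_i$, $i<n$, are atomic; in that case $\prod_{i<n}\mathbb{X}_i^{\rm at}$ is a countable atomic model of $\mathcal{T}$, where $\mathbb{X}_i^{\rm at}$ is a countable atomic model of $\mathcal{T}_i$, for $i<n$. (d) $\mathcal{T}$ is small if and only if the theories $\mathcal{T}_i$, $i<n$, are small; in that case $\prod_{i<n}\mathbb{X}_i^{\rm sat}$ is a countably saturated model of $\mathcal{T}$, where $\mathbb{X}_i^{\rm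 sat}$ is a countably saturated model of $\mathcal{T}_i$, for $i<n$.
   Context: $L_b=\langle R\rangle$ is the language with one binary relational symbol; a partial order $\langle X,\leq\rangle$ (reflexive, antisymmetric, transitive) is an $L_b$-structure with $R$ interpreted as $\leq$. A partial order $\mathbb{X}=\langle X,\leq\rangle$ is a tree iff for each $x\in X$ the set $(\cdot,x]=\{y\in X:y\leq x\}$ is linearly ordered; it is a rooted tree iff, in addition, there is $r\in X$ (the root) with $r\leq x$ for all $x\in X$. Perfect pairs. Let $L$ be a countable language and let $\square$ be an operation which, for each $n\geq 1$, assigns to each $n$-tuple $\langle\mathbb{X}_0,\dots,\mathbb{X}_{n-1}\rangle$ of $L$-structures an $L$-structure $\square_{i<n}\mathbb{X}_i$ such that $$\min\Big\{\sum_{i<n}|X_i|,\prod_{i<n}|X_i|\Big\}\leq|\square_{i<n}\mathbb{X}_i|\leq\max\Big\{\sum_{i<n}|X_i|,\prod_{i<n}|X_i|\Big\}.$$ Let $\mathcal{C}$ be a class of $L$-structures closed under elementary equivalence $\equiv$. The pair $(\square,\mathcal{C})$ is a perfect pair, written $\mathrm{Perf}(\square,\mathcal{C})$, iff whenever $\mathbb{X}_i,\mathbb{Y}_i\in\mathcal{C}$ for $i<\omega$, $m,n\geq 1$, and $\mathbb{Y},\mathbb{E}$ are $L$-structures, we have: (i) $\square_{i<n}\mathbb{X}_i\cong\square_{i<m}\mathbb{Y}_i$ iff $m=n$ and there is a permutation $\pi\in\mathrm{Sym}(n)$ such that $\mathbb{X}_i\cong\mathbb{Y}_{\pi(i)}$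 for all $i<n$; (ii) $\mathbb{Y}\equiv\square_{i<n}\mathbb{X}_i$ iff $\mathbb{Y}\cong\square_{i<n}\mathbb{Z}_i$ for some $\mathbb{Z}_i$ with $\mathbb{Z}_i\equiv\mathbb{X}_i$, $i<n$; (iii) $\mathbb{E}\preccurlyeq\square_{i<n}\mathbb{X}_i$ iff $\mathbb{E}=\square_{i<n}\mathbb{E}_i$ for some $\mathbb{E}_i$ with $\mathbb{E}_i\preccurlyeq\mathbb{X}_i$, $i<n$ ($\preccurlyeq$ denotes elementary substructure). We write $\mathrm{Perf}_s(\square,\mathcal{C})$ iff, in addition, whenever $n\geq 1$, $\mathbb{X}_i\in\mathcal{C}$ for $i<n$, and $\kappa$ is a cardinal: if all $\mathbb{X}_i$, $i<n$, are $\kappa$-saturated, then $\square_{i<n}\mathbb{X}_i$ is $\kappa$-saturated. A structure $\mathbb{X}$ is $\kappa$-saturated iff for each $A\subseteq X$ with $|A|<\kappa$ the expansion $\mathbb{X}_A$ of $\mathbb{X}$ by constants for the elements of $A$ realizes each 1-type consistent with $\mathrm{Th}(\mathbb{X}_A)$. "Countable" means of cardinality at most $\omega$. For a complete theory $\mathcal{T}$, $I(\mathcal{T})$ is the number of isomorphism types of models of $\mathcal{T}$ of cardinality $\omega$; if $\mathcal{T}$ has a finite model, $I(\mathcal{T}):=1$. $\mathfrak{c}=2^{\omega}$. $\mathcal{T}$ satisfies Vaught's conjecture iff $I(\mathcal{T})\leq\omega$ or $I(\mathcal{T})=\mathfrak{c}$. A formula $\varphi(\bar v)$ is complete in $\mathcal{T}$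 iff it is consistent with $\mathcal{T}$ and for each formula $\psi(\bar v)$ we have $\mathcal{T}\vdash\varphi\rightarrow\psi$ or $\mathcal{T}\vdash\varphi\rightarrow\neg\psi$; a formula is completable in $\mathcal{T}$ iff it is implied, modulo $\mathcal{T}$, by a complete formula. $\mathcal{T}$ is atomic iff each formula consistent with $\mathcal{T}$ is completable in $\mathcal{T}$. A model is atomic iff each finite tuple of its elements satisfies a complete formula of its theory. $\mathcal{T}$ is small iff $|\bigcup_{n\in\omega}S_n(\mathcal{T})|\leq\omega$. A model is countably saturated iff it is countable and $\omega$-saturated. *)

theory Defs
  imports Main "HOL-Library.Countable_Set" "HOL-Combinatorics.Permutations"
begin

unbundle cardinal_syntax

section \<open>Structures with one binary relation\<close>

record 'a bstr =
  Univ :: "'a set"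
  Rel :: "('a \<times> 'a) set"

text \<open>The relation is confined to the universe, so that equality of structures in HOL is
  equality of structures in the usual sense.\<close>

definition is_bstr :: "'a bstr \<Rightarrow> bool" where
  "is_bstr M \<longleftrightarrow> Univ M \<noteq> {} \<and> Rel M \<subseteq> Univ M \<times> Univ M"

definition bstr_iso :: "'a bstr \<Rightarrow> 'b bstr \<Rightarrow> bool"  (infix \<open>\<simeq>\<close> 50) where
  "M \<simeq> N \<longleftrightarrow> (\<exists>f. bij_betw f (Univ M) (Univ N) \<and>
     (\<forall>x\<in>Univ M. \<forall>y\<in>Univ M. (x, y) \<in> Rel M \<longleftrightarrow> (f x, f y) \<in> Rel N))"

definition direct_prod :: "'a bstr list \<Rightarrow> 'a list bstr" where
  "direct_prod Ms = \<lparr>Univ = listset (map Univ Ms),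
     Rel = {(x, y). x \<in> listset (map Univ Ms) \<and> y \<in> listset (map Univ Ms) \<and>
                    (\<forall>i<length Ms. (x ! i, y ! i) \<in> Rel (Ms ! i))}\<rparr>"

definition tree :: "'a bstr \<Rightarrow> bool" where
  "tree M \<longleftrightarrow> is_bstr M \<and> partial_order_on (Univ M) (Rel M) \<and>
     (\<forall>x\<in>Univ M. total_on {y \<in> Univ M. (y, x) \<in> Rel M} (Rel M))"

definition rooted_tree :: "'a bstr \<Rightarrow> bool" where
  "rooted_tree M \<longleftrightarrow> tree M \<and> (\<exists>r\<in>Univ M. \<forall>x\<in>Univ M. (r, x) \<in> Rel M)"

definition rooted_trees_gt1 :: "'a bstr set" where
  "rooted_trees_gt1 = {M. rooted_tree M \<and> (\<exists>x\<in>Univ M. \<exists>y\<in>Univ M. x \<noteq> y)}"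


section \<open>First-order formulas\<close>

text \<open>
  Formulas over the binary symbol and constant symbols drawn from \<open>'c\<close>; \<open>csts \<phi>\<close> is the set of
  constant symbols occurring in \<open>\<phi>\<close>. With a set \<open>K\<close> of constants, \<open>csts \<phi> \<subseteq> K\<close> says that \<open>\<phi>\<close> is a
  formula of the language expanded by \<open>K\<close>. Formulas of the pure language are those with
  \<open>csts \<phi> = {}\<close>; for them the type \<open>'c\<close> plays no role and is taken to be \<open>unit\<close>.
\<close>

datatype 'c trm = Var nat | Cst 'c

datatype (csts: 'c) fm =
    Fls
  | Rl "'c trm" "'c trm"
  | Eq "'c trm" "'c trm"
  | Imp "'c fm" "'c fm"
  | Forall nat "'c fm"

abbreviation Neg :: "'c fm \<Rightarrow> 'c fm" where
  "Neg \<phi> \<equiv> Imp \<phi> Fls"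

primrec fv_trm :: "'c trm \<Rightarrow> nat set" where
  "fv_trm (Var x) = {x}"
| "fv_trm (Cst c) = {}"

primrec fv :: "'c fm \<Rightarrow> nat set" where
  "fv Fls = {}"
| "fv (Rl s t) = fv_trm s \<union> fv_trm t"
| "fv (Eq s t) = fv_trm s \<union> fv_trm t"
| "fv (Imp \<phi> \<psi>) = fv \<phi> \<union> fv \<psi>"
| "fv (Forall x \<phi>) = fv \<phi> - {x}"

text \<open>Formulas \<open>\<phi>(v\<^sub>0, \<dots>, v\<^sub>n\<^sub>-\<^sub>1)\<close> of the language expanded by \<open>K\<close>.\<close>

definition formulas :: "'c set \<Rightarrow> nat \<Rightarrow> 'c fm set" where
  "formulas K n = {\<phi>. csts \<phi> \<subseteq> K \<and> fv \<phi> \<subseteq> {..<n}}"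

primrec val :: "('c \<Rightarrow> 'a) \<Rightarrow> (nat \<Rightarrow> 'a) \<Rightarrow> 'c trm \<Rightarrow> 'a" where
  "val I e (Var x) = e x"
| "val I e (Cst c) = I c"

primrec sat :: "'a bstr \<Rightarrow> ('c \<Rightarrow> 'a) \<Rightarrow> (nat \<Rightarrow> 'a) \<Rightarrow> 'c fm \<Rightarrow> bool" where
  "sat M I e Fls \<longleftrightarrow> False"
| "sat M I e (Rl s t) \<longleftrightarrow> (val I e s, val I e t) \<in> Rel M"
| "sat M I e (Eq s t) \<longleftrightarrow> val I e s = val I e t"
| "sat M I e (Imp \<phi> \<psi>) \<longleftrightarrow> (sat M I e \<phi> \<longrightarrow> sat M I e \<psi>)"
| "sat M I e (Forall x \<phi>) \<longleftrightarrow> (\<forall>a\<in>Univ M. sat M I (e(x := a)) \<phi>)"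

text \<open>Satisfaction for the pure language; the interpretation of constants is immaterial.\<close>

definition bsat :: "'a bstr \<Rightarrow> (nat \<Rightarrow> 'a) \<Rightarrow> unit fm \<Rightarrow> bool" where
  "bsat M e \<phi> = sat M (\<lambda>_. undefined) e \<phi>"


section \<open>Theories and provability\<close>

definition Th :: "'a bstr \<Rightarrow> unit fm set" where
  "Th M = {\<phi> \<in> formulas {} 0. \<forall>e. range e \<subseteq> Univ M \<longrightarrow> bsat M e \<phi>}"

text \<open>The theory of the expansion of \<open>M\<close> by constants for the elements of \<open>A\<close>, where each
  \<open>a \<in> A\<close> serves as its own name.\<close>

definition Th_exp :: "'a set \<Rightarrow> 'a bstr \<Rightarrow> 'a fm set" where
  "Th_exp A M = {\<phi> \<in> formulas A 0. \<forall>e. range e \<subseteq> Univ M \<longrightarrow> sat M (\<lambda>a. a) e \<phi>}"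

definition elem_equiv :: "'a bstr \<Rightarrow> 'b bstr \<Rightarrow> bool" where
  "elem_equiv M N \<longleftrightarrow> Th M = Th N"

definition elem_sub :: "'a bstr \<Rightarrow> 'a bstr \<Rightarrow> bool" where
  "elem_sub E M \<longleftrightarrow> is_bstr E \<and> Univ E \<subseteq> Univ M \<and> Rel E = Rel M \<inter> (Univ E \<times> Univ E) \<and>
     (\<forall>\<phi> e. csts \<phi> = {} \<and> range e \<subseteq> Univ E \<longrightarrow> (bsat E e \<phi> \<longleftrightarrow> bsat M e \<phi>))"

definition is_model :: "'a bstr \<Rightarrow> unit fm set \<Rightarrow> bool" where
  "is_model M T \<longleftrightarrow> is_bstr M \<and> T \<subseteq> Th M"

text \<open>
  Provability from a set of sentences: the substitution-free Hilbert calculus for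
  first-order logic with equality due to Tarski, Kalish and Montague (with the redundant
  axiom \<open>\<forall>x \<phi> \<rightarrow> \<phi>\<close>). Generalisation is unrestricted because axioms in \<open>T\<close> are sentences.
\<close>

inductive proves :: "'c fm set \<Rightarrow> 'c fm \<Rightarrow> bool"  (infix \<open>\<turnstile>\<close> 50) for T :: "'c fm set" where
  ax: "\<phi> \<in> T \<Longrightarrow> T \<turnstile> \<phi>"
| mp: "T \<turnstile> Imp \<phi> \<psi> \<Longrightarrow> T \<turnstile> \<phi> \<Longrightarrow> T \<turnstile> \<psi>"
| gen: "T \<turnstile> \<phi> \<Longrightarrow> T \<turnstile> Forall x \<phi>"
| K: "T \<turnstile> Imp \<phi> (Imp \<psi> \<phi>)"
| S: "T \<turnstile> Imp (Imp \<phi> (Imp \<psi> \<chi>)) (Imp (Imp \<phi> \<psi>) (Imp \<phi> \<chi>))"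
| dneg: "T \<turnstile> Imp (Neg (Neg \<phi>)) \<phi>"
| all_imp: "T \<turnstile> Imp (Forall x (Imp \<phi> \<psi>)) (Imp (Forall x \<phi>) (Forall x \<psi>))"
| all_vac: "x \<notin> fv \<phi> \<Longrightarrow> T \<turnstile> Imp \<phi> (Forall x \<phi>)"
| all_elim: "T \<turnstile> Imp (Forall x \<phi>) \<phi>"
| ex_eq: "t \<noteq> Var x \<Longrightarrow> T \<turnstile> Neg (Forall x (Neg (Eq (Var x) t)))"
| eq_eq: "T \<turnstile> Imp (Eq s t) (Imp (Eq s u) (Eq t u))"
| eq_Rl1: "T \<turnstile> Imp (Eq s t) (Imp (Rl s u) (Rl t u))"
| eq_Rl2: "T \<turnstile> Imp (Eq s t) (Imp (Rl u s) (Rl u t))"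

text \<open>\<open>p\<close> is consistent with \<open>T\<close>, the free variables of the formulas in \<open>p\<close> being treated as
  new constants: no finite part of \<open>p\<close> is refuted by \<open>T\<close>.\<close>

definition consistent_with :: "'c fm set \<Rightarrow> 'c fm set \<Rightarrow> bool" where
  "consistent_with T p \<longleftrightarrow> \<not> (\<exists>\<psi>s. set \<psi>s \<subseteq> p \<and> T \<turnstile> foldr Imp \<psi>s Fls)"


section \<open>Types, saturation, smallness, atomicity\<close>

text \<open>The \<open>n\<close>-types, i.e. maximal consistent sets of formulas in \<open>v\<^sub>0, \<dots>, v\<^sub>n\<^sub>-\<^sub>1\<close>, of a theory in the
  language expanded by \<open>K\<close>.\<close>

definition types :: "'c set \<Rightarrow> 'c fm set \<Rightarrow> nat \<Rightarrow> 'c fm set set" where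
  "types K T n = {p. p \<subseteq> formulas K n \<and> consistent_with T p \<and>
     (\<forall>\<phi>\<in>formulas K n. \<phi> \<in> p \<or> Neg \<phi> \<in> p)}"

definition saturated :: "'k rel \<Rightarrow> 'a bstr \<Rightarrow> bool" where
  "saturated \<kappa> M \<longleftrightarrow> (\<forall>A\<subseteq>Univ M. |A| <o \<kappa> \<longrightarrow>
     (\<forall>p\<in>types A (Th_exp A M) 1. \<exists>a\<in>Univ M. \<forall>\<phi>\<in>p. sat M (\<lambda>c. c) (\<lambda>_. a) \<phi>))"

definition complete_formula :: "unit fm set \<Rightarrow> nat \<Rightarrow> unit fm \<Rightarrow> bool" where
  "complete_formula T n \<phi> \<longleftrightarrow> \<phi> \<in> formulas {} n \<and> consistent_with T {\<phi>} \<and>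
     (\<forall>\<psi>\<in>formulas {} n. T \<turnstile> Imp \<phi> \<psi> \<or> T \<turnstile> Imp \<phi> (Neg \<psi>))"

definition completable_formula :: "unit fm set \<Rightarrow> nat \<Rightarrow> unit fm \<Rightarrow> bool" where
  "completable_formula T n \<phi> \<longleftrightarrow> (\<exists>\<chi>. complete_formula T n \<chi> \<and> T \<turnstile> Imp \<chi> \<phi>)"

definition atomic_theory :: "unit fm set \<Rightarrow> bool" where
  "atomic_theory T \<longleftrightarrow>
     (\<forall>n. \<forall>\<phi>\<in>formulas {} n. consistent_with T {\<phi>} \<longrightarrow> completable_formula T n \<phi>)"

definition atomic_model :: "'a bstr \<Rightarrow> bool" where
  "atomic_model M \<longleftrightarrow> (\<forall>n e. range e \<subseteq> Univ M \<longrightarrow>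
     (\<exists>\<phi>. complete_formula (Th M) n \<phi> \<and> bsat M e \<phi>))"

definition small_theory :: "unit fm set \<Rightarrow> bool" where
  "small_theory T \<longleftrightarrow> countable (\<Union>n. types {} T n)"

definition countable_atomic_model :: "'a bstr \<Rightarrow> unit fm set \<Rightarrow> bool" where
  "countable_atomic_model M T \<longleftrightarrow> is_model M T \<and> countable (Univ M) \<and> atomic_model M"

definition countably_saturated_model :: "'a bstr \<Rightarrow> unit fm set \<Rightarrow> bool" where
  "countably_saturated_model M T \<longleftrightarrow> is_model M T \<and> countable (Univ M) \<and> saturated natLeq M"


section \<open>The number of countable models\<close>

text \<open>Every structure of cardinality at most \<open>\<omega>\<close> is isomorphic to one whose universe is a set
  of natural numbers, so isomorphism types of countably infinite models are represented by
  isomorphism classes of models on infinite sets of natural numbers.\<close>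

definition omega_models :: "unit fm set \<Rightarrow> nat bstr set" where
  "omega_models T = {M. is_model M T \<and> infinite (Univ M)}"

definition num_models :: "unit fm set \<Rightarrow> nat bstr set rel" where
  "num_models T =
     (if \<exists>M :: nat bstr. is_model M T \<and> finite (Univ M) then |{{}}|
      else |omega_models T // {(M, N). M \<in> omega_models T \<and> N \<in> omega_models T \<and> M \<simeq> N}| )"

abbreviation continuum :: "(nat \<Rightarrow> bool) rel" where
  "continuum \<equiv> ctwo ^c natLeq"

definition vaught :: "unit fm set \<Rightarrow> bool" where
  "vaught T \<longleftrightarrow> num_models T \<le>o natLeq \<or> num_models T =o continuum"

definition card_prod :: "'k rel list \<Rightarrow> 'k list rel" where
  "card_prod \<kappa>s = |listset (map Field \<kappa>s)|"


section \<open>Perfect pairs\<close>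

text \<open>
  A class of structures is a set of structures over an arbitrary type \<open>'a\<close>, and an operation
  takes nonempty lists of such structures to structures over a second type \<open>'b\<close> (for the direct
  product, \<open>'b\<close> is \<open>'a list\<close>). Structures living on several types can always be moved to
  one sufficiently large type.

  In \<open>card_bounds\<close>, the disjunctions express comparison with the minimum and with the
  maximum of the sum and the product of the cardinalities.
\<close>

definition card_bounds :: "('a bstr list \<Rightarrow> 'b bstr) \<Rightarrow> bool" where
  "card_bounds box \<longleftrightarrow> (\<forall>Xs. Xs \<noteq> [] \<and> (\<forall>X\<in>set Xs. is_bstr X) \<longrightarrow>
     is_bstr (box Xs) \<and>
     ( |SIGMA i:{..<length Xs}. Univ (Xs ! i)| \<le>o |Univ (box Xs)| \<or>
       |listset (map Univ Xs)| \<le>o |Univ (box Xs)| ) \<and>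
     ( |Univ (box Xs)| \<le>o |SIGMA i:{..<length Xs}. Univ (Xs ! i)| \<or>
       |Univ (box Xs)| \<le>o |listset (map Univ Xs)| ))"

definition closed_under_equiv :: "'a bstr set \<Rightarrow> bool" where
  "closed_under_equiv C \<longleftrightarrow> (\<forall>X\<in>C. \<forall>Y. is_bstr Y \<and> elem_equiv Y X \<longrightarrow> Y \<in> C)"

definition Perf :: "('a bstr list \<Rightarrow> 'b bstr) \<Rightarrow> 'a bstr set \<Rightarrow> bool" where
  "Perf box C \<longleftrightarrow>
     card_bounds box \<and> (\<forall>X\<in>C. is_bstr X) \<and> closed_under_equiv C \<and>
     (\<forall>Xs Ys. Xs \<noteq> [] \<and> Ys \<noteq> [] \<and> set Xs \<subseteq> C \<and> set Ys \<subseteq> C \<longrightarrow>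
        (box Xs \<simeq> box Ys \<longleftrightarrow>
           length Xs = length Ys \<and>
           (\<exists>\<pi>. \<pi> permutes {..<length Xs} \<and> (\<forall>i<length Xs. Xs ! i \<simeq> Ys ! \<pi> i)))) \<and>
     (\<forall>Xs (Y :: 'b bstr). Xs \<noteq> [] \<and> set Xs \<subseteq> C \<and> is_bstr Y \<longrightarrow>
        (elem_equiv Y (box Xs) \<longleftrightarrow>
           (\<exists>Zs. length Zs = length Xs \<and>
                 (\<forall>i<length Xs. is_bstr (Zs ! i) \<and> elem_equiv (Zs ! i) (Xs ! i)) \<and>
                 Y \<simeq> box Zs))) \<and>
     (\<forall>Xs E. Xs \<noteq> [] \<and> set Xs \<subseteq> C \<and> is_bstr E \<longrightarrow>
        (elem_sub E (box Xs) \<longleftrightarrow>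
           (\<exists>Es. length Es = length Xs \<and>
                 (\<forall>i<length Xs. elem_sub (Es ! i) (Xs ! i)) \<and>
                 E = box Es)))"

text \<open>The type argument is the type on which the cardinals \<open>\<kappa>\<close> live.\<close>

definition Perf_s :: "'k itself \<Rightarrow> ('a bstr list \<Rightarrow> 'b bstr) \<Rightarrow> 'a bstr set \<Rightarrow> bool" where
  "Perf_s TYPE('k) box C \<longleftrightarrow> Perf box C \<and>
     (\<forall>Xs (\<kappa> :: 'k rel). Xs \<noteq> [] \<and> set Xs \<subseteq> C \<and> Card_order \<kappa> \<and>
        (\<forall>X\<in>set Xs. saturated \<kappa> X) \<longrightarrow> saturated \<kappa> (box Xs))"

end

theory Submission
  imports Defs
begin

text \<open>
  The theorem rests on the fact that a product \<open>P\<close> of rooted trees remembers its factors in a first-order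
  way. An element of \<open>P\<close> that is not the least one has a linearly ordered set of predecessors iff
  exactly one of its coordinates differs from the root: it lies on an axis, a copy of one of the
  factors. Two such elements lie on different axes iff they are incomparable and have an upper
  bound, since in a tree an upper bound forces comparability. For \<open>a\<close> on the \<open>i\<close>-th axis, the order
  of the \<open>i\<close>-th coordinates of \<open>x\<close> and \<open>y\<close> is then definable from \<open>a\<close>: everything on the axis of \<open>a\<close>
  that is below \<open>x\<close> is below \<open>y\<close> (\<open>proj_le\<close>). So every factor is interpreted in \<open>P\<close> with one
  parameter (\<open>factor_fm\<close>), and the statement that \<open>P\<close> is the product of its \<open>n\<close> quotients is a formula
  in \<open>n\<close> parameters (\<open>decomp\<close>). The parameters are unique up to their axes and the order of the axes
  (\<open>decomp_unique\<close>).

  All parts of the perfect pair follow. An isomorphism of products carries one decomposition to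
  another, hence permutes the factors. A structure elementarily equivalent to \<open>P\<close> has a decomposition
  as well; that its quotients have the right theories, in some order, is a matter of finitely many
  sentences, one for each of the finitely many wrong orders (\<open>prod_decompose\<close>). An elementary
  submodel contains parameters of a decomposition and is the product of its projections. The
  converse directions, and the preservation of saturation, are consequences of the
  Feferman--Vaught theorem for finite products.

  The remaining claims compare countable models and types. Countable models of \<open>Th P\<close> are products
  of countable models of the theories of the factors, which gives the upper bound in (a); the lower
  bound varies one factor and cancels the others. A type of a factor is definable from a type of
  \<open>P\<close> with one more variable, and a type of \<open>P\<close> is determined by types of the factors; this gives
  (d), and with the corresponding analysis of complete formulas (c). In (b), the cases in which the
  product of the numbers is infinite or 1 are cardinal arithmetic, and the lower bound 3 in the
  remaining case is Vaught's theorem that a complete theory never has exactly two countable models.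

  The model theory behind this is developed below for the given notion of structure. Its source of
  models is the ultrapower over a nonprincipal ultrafilter on the natural numbers, in which every
  countable set of formulas that is finitely satisfiable is satisfiable; countable atomic, saturated
  and other models are found in it as elementary submodels.
\<close>

section \<open>Connectives and satisfaction\<close>

instance trm :: (countable) countable by countable_datatype
instance fm :: (countable) countable by countable_datatype

definition Tru :: "'c fm" where "Tru = Neg Fls"
definition And :: "'c fm \<Rightarrow> 'c fm \<Rightarrow> 'c fm" where "And \<phi> \<psi> = Neg (Imp \<phi> (Neg \<psi>))"
definition Or :: "'c fm \<Rightarrow> 'c fm \<Rightarrow> 'c fm" where "Or \<phi> \<psi> = Imp (Neg \<phi>) \<psi>"
definition Ex :: "nat \<Rightarrow> 'c fm \<Rightarrow> 'c fm" where "Ex x \<phi> = Neg (Forall x (Neg \<phi>))"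
definition Conj :: "'c fm list \<Rightarrow> 'c fm" where "Conj \<phi>s = foldr And \<phi>s Tru"
definition Disj :: "'c fm list \<Rightarrow> 'c fm" where "Disj \<phi>s = foldr Or \<phi>s Fls"
definition Alls :: "nat list \<Rightarrow> 'c fm \<Rightarrow> 'c fm" where "Alls xs \<phi> = foldr Forall xs \<phi>"
definition Exs :: "nat list \<Rightarrow> 'c fm \<Rightarrow> 'c fm" where "Exs xs \<phi> = foldr Ex xs \<phi>"

lemma fv_simps [simp]:
  "fv Tru = {}" "fv (And \<phi> \<psi>) = fv \<phi> \<union> fv \<psi>" "fv (Or \<phi> \<psi>) = fv \<phi> \<union> fv \<psi>"
  "fv (Ex x \<phi>) = fv \<phi> - {x}"
  by (auto simp: Tru_def And_def Or_def Ex_def)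

lemma csts_simps [simp]:
  "csts Tru = {}" "csts (And \<phi> \<psi>) = csts \<phi> \<union> csts \<psi>" "csts (Or \<phi> \<psi>) = csts \<phi> \<union> csts \<psi>"
  "csts (Ex x \<phi>) = csts \<phi>"
  by (auto simp: Tru_def And_def Or_def Ex_def)

lemma fv_lists [simp]:
  "fv (Conj \<phi>s) = (\<Union>\<phi>\<in>set \<phi>s. fv \<phi>)" "fv (Disj \<phi>s) = (\<Union>\<phi>\<in>set \<phi>s. fv \<phi>)"
  "fv (Alls xs \<phi>) = fv \<phi> - set xs" "fv (Exs xs \<phi>) = fv \<phi> - set xs"
  subgoal by (induction \<phi>s) (simp_all add: Conj_def)
  subgoal by (induction \<phi>s) (simp_all add: Disj_def)
  subgoal by (induction xs) (auto simp add: Alls_def)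
  subgoal by (induction xs) (auto simp add: Exs_def)
  done

lemma csts_lists [simp]:
  "csts (Conj \<phi>s) = (\<Union>\<phi>\<in>set \<phi>s. csts \<phi>)" "csts (Disj \<phi>s) = (\<Union>\<phi>\<in>set \<phi>s. csts \<phi>)"
  "csts (Alls xs \<phi>) = csts \<phi>" "csts (Exs xs \<phi>) = csts \<phi>"
  subgoal by (induction \<phi>s) (simp_all add: Conj_def)
  subgoal by (induction \<phi>s) (simp_all add: Disj_def)
  subgoal by (induction xs) (auto simp add: Alls_def)
  subgoal by (induction xs) (auto simp add: Exs_def)
  done

lemma sat_connectives [simp]:
  "sat M I e Tru" "sat M I e (And \<phi> \<psi>) \<longleftrightarrow> sat M I e \<phi> \<and> sat M I e \<psi>"
  "sat M I e (Or \<phi> \<psi>) \<longleftrightarrow> sat M I e \<phi> \<or> sat M I e \<psi>"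
  "sat M I e (Ex x \<phi>) \<longleftrightarrow> (\<exists>a\<in>Univ M. sat M I (e(x := a)) \<phi>)"
  by (auto simp: Tru_def And_def Or_def Ex_def)

lemma sat_Conj [simp]: "sat M I e (Conj \<phi>s) \<longleftrightarrow> (\<forall>\<phi>\<in>set \<phi>s. sat M I e \<phi>)"
  by (induction \<phi>s) (auto simp: Conj_def)

lemma sat_Disj [simp]: "sat M I e (Disj \<phi>s) \<longleftrightarrow> (\<exists>\<phi>\<in>set \<phi>s. sat M I e \<phi>)"
  by (induction \<phi>s) (auto simp: Disj_def)

definition env :: "'a bstr \<Rightarrow> (nat \<Rightarrow> 'a) \<Rightarrow> bool" where
  "env M e \<longleftrightarrow> range e \<subseteq> Univ M"

lemma env_iff: "env M e \<longleftrightarrow> (\<forall>x. e x \<in> Univ M)"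
  by (auto simp: env_def)

lemma env_in: "env M e \<Longrightarrow> e x \<in> Univ M"
  by (auto simp: env_def)

lemma is_bstr_env: "is_bstr M \<Longrightarrow> \<exists>e. env M e"
  by (auto simp: is_bstr_def env_iff)

lemma env_upd [intro]: "env M e \<Longrightarrow> a \<in> Univ M \<Longrightarrow> env M (e(x := a))"
  by (auto simp: env_def)

definition agree :: "nat set \<Rightarrow> (nat \<Rightarrow> 'a) \<Rightarrow> (nat \<Rightarrow> 'a) \<Rightarrow> bool" where
  "agree X e e' \<longleftrightarrow> (\<forall>x. x \<notin> X \<longrightarrow> e' x = e x)"

text \<open>Lets a block of quantifiers be evaluated by induction on the list of its variables.\<close>

lemma agree_step:
  "(\<exists>e'. env M e' \<and> agree (insert x X) e e' \<and> P e') \<longleftrightarrow>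
   (\<exists>a\<in>Univ M. \<exists>e'. env M e' \<and> agree X (e(x := a)) e' \<and> P e')"
  (is "?L \<longleftrightarrow> ?R")
proof
  assume ?L
  then obtain e' where e': "env M e'" "agree (insert x X) e e'" "P e'" by blast
  have "agree X (e(x := e' x)) e'" using e'(2) by (auto simp: agree_def)
  then show ?R using e' env_in by blast
next
  assume ?R
  then obtain a e' where "a \<in> Univ M" "env M e'" "agree X (e(x := a)) e'" "P e'" by blast
  moreover from this have "agree (insert x X) e e'" by (auto simp: agree_def)
  ultimately show ?L by blast
qed

lemma sat_Exs [simp]:
  "env M e \<Longrightarrow> sat M I e (Exs xs \<phi>) \<longleftrightarrow> (\<exists>e'. env M e' \<and> agree (set xs) e e' \<and> sat M I e' \<phi>)"
proof (induction xs arbitrary: e)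
  case Nil
  have "agree {} e e' \<longleftrightarrow> e' = e" for e' by (auto simp: agree_def)
  then show ?case using Nil by (simp add: Exs_def)
next
  case (Cons x xs)
  have "sat M I e (Exs (x # xs) \<phi>) \<longleftrightarrow> (\<exists>a\<in>Univ M. sat M I (e(x := a)) (Exs xs \<phi>))"
    by (simp add: Exs_def)
  also have "\<dots> \<longleftrightarrow> (\<exists>a\<in>Univ M. \<exists>e'. env M e' \<and> agree (set xs) (e(x := a)) e' \<and> sat M I e' \<phi>)"
    using Cons by (meson env_upd)
  finally show ?case by (simp add: agree_step)
qed

lemma sat_Alls [simp]:
  assumes "env M e"
  shows "sat M I e (Alls xs \<phi>) \<longleftrightarrow> (\<forall>e'. env M e' \<and> agree (set xs) e e' \<longrightarrow> sat M I e' \<phi>)"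
proof -
  have "sat M I e (Alls xs \<phi>) \<longleftrightarrow> \<not> sat M I e (Exs xs (Neg \<phi>))" for e
    by (induction xs arbitrary: e) (auto simp: Alls_def Exs_def)
  then show ?thesis using assms by auto
qed

lemma sat_cong:
  assumes "\<And>x. x \<in> fv \<phi> \<Longrightarrow> e x = e' x" "\<And>c. c \<in> csts \<phi> \<Longrightarrow> I c = I' c"
  shows "sat M I e \<phi> \<longleftrightarrow> sat M I' e' \<phi>"
  using assms
proof (induction \<phi> arbitrary: e e')
  case (Rl s t)
  then show ?case by (cases s; cases t) auto
next
  case (Eq s t)
  then show ?case by (cases s; cases t) auto
next
  case (Imp \<phi> \<psi>)
  have "sat M I e \<phi> \<longleftrightarrow> sat M I' e' \<phi>" "sat M I e \<psi> \<longleftrightarrow> sat M I' e' \<psi>"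
    using Imp.prems by (auto intro!: Imp.IH)
  then show ?case by simp
next
  case (Forall x \<phi>)
  have "sat M I (e(x := a)) \<phi> \<longleftrightarrow> sat M I' (e'(x := a)) \<phi>" for a
    using Forall.prems by (auto intro!: Forall.IH)
  then show ?case by simp
qed simp

lemma finite_fv [simp]: "finite (fv \<phi>)"
proof (induction \<phi>)
  case (Rl s t)
  then show ?case by (cases s; cases t) auto
next
  case (Eq s t)
  then show ?case by (cases s; cases t) auto
qed auto

lemma finite_csts [simp]: "finite (csts \<phi>)"
proof -
  have "finite (set_trm t)" for t :: "'c trm" by (cases t) auto
  then show ?thesis by (induction \<phi>) auto
qed

lemma formulas_mono: "n \<le> m \<Longrightarrow> formulas K n \<subseteq> formulas K m"
  by (auto simp: formulas_def)

lemma formulas_Imp [simp]: "Imp \<phi> \<psi> \<in> formulas K n \<longleftrightarrow> \<phi> \<in> formulas K n \<and> \<psi> \<in> formulas K n"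
  by (auto simp: formulas_def)

lemma formulas_And [simp]: "And \<phi> \<psi> \<in> formulas K n \<longleftrightarrow> \<phi> \<in> formulas K n \<and> \<psi> \<in> formulas K n"
  by (auto simp: formulas_def)

lemma formulas_Conj [simp]: "Conj \<phi>s \<in> formulas K n \<longleftrightarrow> set \<phi>s \<subseteq> formulas K n"
  by (auto simp: formulas_def)

lemma formulas_Tru [simp]: "Tru \<in> formulas K n" "Fls \<in> formulas K n"
  by (auto simp: formulas_def)

lemma formulas_Ex: "\<phi> \<in> formulas K (Suc n) \<Longrightarrow> Ex n \<phi> \<in> formulas K n"
  by (auto simp: formulas_def less_Suc_eq)

lemma formulas_exists: "csts \<phi> \<subseteq> K \<Longrightarrow> \<exists>n. \<phi> \<in> formulas K n"
proof -
  assume "csts \<phi> \<subseteq> K"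
  moreover have "fv \<phi> \<subseteq> {..<Suc (Max (fv \<phi>))}"
    by (auto simp: less_Suc_eq_le)
  ultimately show ?thesis by (auto simp: formulas_def)
qed

section \<open>Substitution\<close>

definition fresh :: "nat set \<Rightarrow> nat" where "fresh X = (LEAST y. y \<notin> X)"

lemma fresh: "finite X \<Longrightarrow> fresh X \<notin> X"
  unfolding fresh_def by (rule LeastI_ex) (rule ex_new_if_finite, simp_all)

fun sbst_trm :: "(nat \<Rightarrow> 'd trm) \<Rightarrow> ('c \<Rightarrow> 'd trm) \<Rightarrow> 'c trm \<Rightarrow> 'd trm" where
  "sbst_trm f g (Var x) = f x"
| "sbst_trm f g (Cst c) = g c"

text \<open>Substitution of terms for constants (\<open>g\<close>) and for free variables (\<open>f\<close>) at once. A bound variable is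
  renamed to one that is fresh for all terms that are put in, so that the substitution lemma has no
  side conditions. Replacing constants is what turns formulas with parameters into formulas with
  additional free variables.\<close>

primrec sbst :: "('c \<Rightarrow> 'd trm) \<Rightarrow> 'c fm \<Rightarrow> (nat \<Rightarrow> 'd trm) \<Rightarrow> 'd fm" where
  "sbst g Fls f = Fls"
| "sbst g (Rl s t) f = Rl (sbst_trm f g s) (sbst_trm f g t)"
| "sbst g (Eq s t) f = Eq (sbst_trm f g s) (sbst_trm f g t)"
| "sbst g (Imp \<phi> \<psi>) f = Imp (sbst g \<phi> f) (sbst g \<psi> f)"
| "sbst g (Forall x \<phi>) f =
    (let y = fresh ((\<Union>z\<in>fv \<phi> - {x}. fv_trm (f z)) \<union> (\<Union>c\<in>csts \<phi>. fv_trm (g c)))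
     in Forall y (sbst g \<phi> (f(x := Var y))))"

lemma val_sbst_trm: "val J e (sbst_trm f g t) = val (\<lambda>c. val J e (g c)) (\<lambda>x. val J e (f x)) t"
  by (cases t) auto

lemma finite_fv_trm [simp]: "finite (fv_trm t)" by (cases t) auto

lemma val_cong: "(\<And>x. x \<in> fv_trm t \<Longrightarrow> e x = e' x) \<Longrightarrow> val J e t = val J e' t"
  by (cases t) auto

lemma sat_sbst:
  "sat M J e (sbst g \<phi> f) \<longleftrightarrow> sat M (\<lambda>c. val J e (g c)) (\<lambda>x. val J e (f x)) \<phi>"
proof (induction \<phi> arbitrary: f e)
  case (Forall x \<phi>)
  define X where "X = (\<Union>z\<in>fv \<phi> - {x}. fv_trm (f z)) \<union> (\<Union>c\<in>csts \<phi>. fv_trm (g c))"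
  have y: "fresh X \<notin> X" by (rule fresh) (simp add: X_def)
  have "sat M J (e(fresh X := a)) (sbst g \<phi> (f(x := Var (fresh X)))) \<longleftrightarrow>
        sat M (\<lambda>c. val J e (g c)) ((\<lambda>x. val J e (f x))(x := a)) \<phi>" for a
    unfolding Forall
  proof (rule sat_cong)
    fix z assume "z \<in> fv \<phi>"
    then have "fresh X \<notin> fv_trm (f z)" if "z \<noteq> x" using y that by (auto simp: X_def)
    then show "val J (e(fresh X := a)) ((f(x := Var (fresh X))) z) = ((\<lambda>x. val J e (f x))(x := a)) z"
      by (cases "z = x") (auto intro!: val_cong)
  next
    fix c assume "c \<in> csts \<phi>"
    then have "fresh X \<notin> fv_trm (g c)" using y by (auto simp: X_def)
    then show "val J (e(fresh X := a)) (g c) = val J e (g c)" by (auto intro!: val_cong)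
  qed
  then show ?case by (simp add: X_def[symmetric] Let_def)
qed (auto simp: val_sbst_trm)

lemma fv_sbst: "fv (sbst g \<phi> f) \<subseteq> (\<Union>z\<in>fv \<phi>. fv_trm (f z)) \<union> (\<Union>c\<in>csts \<phi>. fv_trm (g c))"
proof (induction \<phi> arbitrary: f)
  case (Rl s t)
  then show ?case by (cases s; cases t) auto
next
  case (Eq s t)
  then show ?case by (cases s; cases t) auto
next
  case (Imp \<phi> \<psi>)
  then show ?case by fastforce
next
  case (Forall x \<phi>)
  show ?case using Forall[of "f(x := Var _)"] by (fastforce simp: Let_def split: if_splits)
qed simp

lemma csts_sbst: "csts (sbst g \<phi> f) \<subseteq> (\<Union>z. set_trm (f z)) \<union> (\<Union>c\<in>csts \<phi>. set_trm (g c))"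
proof (induction \<phi> arbitrary: f)
  case (Rl s t)
  then show ?case by (cases s; cases t) auto
next
  case (Eq s t)
  then show ?case by (cases s; cases t) auto
next
  case (Imp \<phi> \<psi>)
  then show ?case by fastforce
next
  case (Forall x \<phi>)
  show ?case using Forall[of "f(x := Var _)"] by (fastforce simp: Let_def split: if_splits)
qed simp

definition ren :: "(nat \<Rightarrow> nat) \<Rightarrow> 'c fm \<Rightarrow> 'c fm" where
  "ren f \<phi> = sbst Cst \<phi> (\<lambda>x. Var (f x))"

lemma sat_ren [simp]: "sat M I e (ren f \<phi>) \<longleftrightarrow> sat M I (\<lambda>x. e (f x)) \<phi>"
  by (simp add: ren_def sat_sbst)

lemma csts_ren: "csts (ren f \<phi>) \<subseteq> csts \<phi>"
  using csts_sbst[of Cst \<phi> "\<lambda>x. Var (f x)"] by (auto simp: ren_def)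

lemma fv_ren: "fv (ren f \<phi>) \<subseteq> f ` fv \<phi>"
  using fv_sbst[of Cst \<phi> "\<lambda>x. Var (f x)"] by (auto simp: ren_def)

lemma ren_formulas: "\<phi> \<in> formulas K n \<Longrightarrow> (\<And>x. x < n \<Longrightarrow> f x < m) \<Longrightarrow> ren f \<phi> \<in> formulas K m"
  unfolding formulas_def by (auto dest!: subsetD[OF fv_ren] subsetD[OF csts_ren])

section \<open>Satisfaction without constants\<close>

lemma bsat_simps [simp]:
  "\<not> bsat M e Fls" "bsat M e Tru"
  "bsat M e (Rl (Var x) (Var y)) \<longleftrightarrow> (e x, e y) \<in> Rel M"
  "bsat M e (Eq (Var x) (Var y)) \<longleftrightarrow> e x = e y"
  "bsat M e (Imp \<phi> \<psi>) \<longleftrightarrow> (bsat M e \<phi> \<longrightarrow> bsat M e \<psi>)"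
  "bsat M e (And \<phi> \<psi>) \<longleftrightarrow> bsat M e \<phi> \<and> bsat M e \<psi>"
  "bsat M e (Or \<phi> \<psi>) \<longleftrightarrow> bsat M e \<phi> \<or> bsat M e \<psi>"
  "bsat M e (Forall x \<phi>) \<longleftrightarrow> (\<forall>a\<in>Univ M. bsat M (e(x := a)) \<phi>)"
  "bsat M e (Ex x \<phi>) \<longleftrightarrow> (\<exists>a\<in>Univ M. bsat M (e(x := a)) \<phi>)"
  "bsat M e (Conj \<phi>s) \<longleftrightarrow> (\<forall>\<phi>\<in>set \<phi>s. bsat M e \<phi>)"
  "bsat M e (Disj \<phi>s) \<longleftrightarrow> (\<exists>\<phi>\<in>set \<phi>s. bsat M e \<phi>)"
  "bsat M e (ren f \<phi>) \<longleftrightarrow> bsat M (\<lambda>x. e (f x)) \<phi>"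
  by (simp_all add: bsat_def)

lemma bsat_Exs [simp]:
  "env M e \<Longrightarrow> bsat M e (Exs xs \<phi>) \<longleftrightarrow> (\<exists>e'. env M e' \<and> agree (set xs) e e' \<and> bsat M e' \<phi>)"
  by (simp add: bsat_def)

lemma bsat_Alls [simp]:
  "env M e \<Longrightarrow> bsat M e (Alls xs \<phi>) \<longleftrightarrow> (\<forall>e'. env M e' \<and> agree (set xs) e e' \<longrightarrow> bsat M e' \<phi>)"
  by (simp add: bsat_def)

lemma bsat_cong: "(\<And>x. x \<in> fv \<phi> \<Longrightarrow> e x = e' x) \<Longrightarrow> bsat M e \<phi> \<longleftrightarrow> bsat M e' \<phi>"
  unfolding bsat_def by (rule sat_cong) auto

lemma bsat_formulas_cong:
  "\<phi> \<in> formulas K n \<Longrightarrow> (\<And>x. x < n \<Longrightarrow> e x = e' x) \<Longrightarrow> bsat M e \<phi> \<longleftrightarrow> bsat M e' \<phi>"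
  by (rule bsat_cong) (auto simp: formulas_def)

section \<open>Isomorphisms\<close>

definition iso_map :: "('a \<Rightarrow> 'b) \<Rightarrow> 'a bstr \<Rightarrow> 'b bstr \<Rightarrow> bool" where
  "iso_map f M N \<longleftrightarrow> bij_betw f (Univ M) (Univ N) \<and>
     (\<forall>x\<in>Univ M. \<forall>y\<in>Univ M. (x, y) \<in> Rel M \<longleftrightarrow> (f x, f y) \<in> Rel N)"

lemma iso_iff: "M \<simeq> N \<longleftrightarrow> (\<exists>f. iso_map f M N)"
  by (simp add: bstr_iso_def iso_map_def)

lemma iso_map_in: "iso_map f M N \<Longrightarrow> x \<in> Univ M \<Longrightarrow> f x \<in> Univ N"
  by (auto simp: iso_map_def bij_betw_def)

lemma iso_map_refl: "iso_map id M M" by (simp add: iso_map_def)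

lemma iso_map_comp: "iso_map f M N \<Longrightarrow> iso_map g N K \<Longrightarrow> iso_map (g \<circ> f) M K"
  by (auto simp: iso_map_def bij_betw_trans dest: bij_betwE)

lemma iso_map_inv: 
  assumes "iso_map f M N" shows "iso_map (inv_into (Univ M) f) N M"
  unfolding iso_map_def
proof (intro conjI ballI)
  have f: "bij_betw f (Univ M) (Univ N)" using assms by (simp add: iso_map_def)
  then show "bij_betw (inv_into (Univ M) f) (Univ N) (Univ M)" by (rule bij_betw_inv_into)
  fix x y assume "x \<in> Univ N" "y \<in> Univ N"
  then obtain a b where ab: "a \<in> Univ M" "b \<in> Univ M" "x = f a" "y = f b"
    using f unfolding bij_betw_def by blast
  then show "(x, y) \<in> Rel N \<longleftrightarrow> (inv_into (Univ M) f x, inv_into (Univ M) f y) \<in> Rel M"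
    using assms f by (auto simp: iso_map_def bij_betw_def)
qed

lemma iso_refl: "M \<simeq> M" using iso_iff iso_map_refl by blast
lemma iso_sym: "M \<simeq> N \<Longrightarrow> N \<simeq> M" unfolding iso_iff using iso_map_inv by blast
lemma iso_trans: "M \<simeq> N \<Longrightarrow> N \<simeq> K \<Longrightarrow> M \<simeq> K" using iso_iff iso_map_comp by metis

lemma iso_bsat:
  assumes f: "iso_map f M N"
  shows "csts \<phi> = {} \<Longrightarrow> env M e \<Longrightarrow> bsat M e \<phi> \<longleftrightarrow> bsat N (\<lambda>x. f (e x)) \<phi>"
proof (induction \<phi> arbitrary: e)
  case (Rl s t)
  then show ?case using f
    by (cases s; cases t) (auto simp: bsat_def iso_map_def env_iff)
next
  case (Eq s t)
  then show ?case using f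
    by (cases s; cases t) (auto simp: bsat_def iso_map_def env_iff bij_betw_def inj_on_def)
next
  case (Forall x \<phi>)
  have 1: "Univ N = f ` Univ M" using f by (auto simp: iso_map_def bij_betw_def)
  have 2: "(\<lambda>y. f (e y))(x := f a) = (\<lambda>y. f ((e(x := a)) y))" for a by auto
  have 3: "bsat M (e(x := a)) \<phi> \<longleftrightarrow> bsat N (\<lambda>y. f ((e(x := a)) y)) \<phi>" if "a \<in> Univ M" for a
    using Forall that by (auto simp del: fun_upd_apply)
  show ?case by (simp add: 1 2 3 del: fun_upd_apply)
qed (auto simp: bsat_def)

lemma iso_map_env: "iso_map f M N \<Longrightarrow> env M e \<Longrightarrow> env N (\<lambda>x. f (e x))"
  by (auto simp: env_iff intro: iso_map_in)

definition copy :: "('a \<Rightarrow> 'b) \<Rightarrow> 'a bstr \<Rightarrow> 'b bstr" where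
  "copy f M = \<lparr>Univ = f ` Univ M, Rel = {(f x, f y) | x y. x \<in> Univ M \<and> y \<in> Univ M \<and> (x, y) \<in> Rel M}\<rparr>"

lemma iso_map_copy: "inj_on f (Univ M) \<Longrightarrow> iso_map f M (copy f M)"
  by (auto simp: iso_map_def copy_def bij_betw_def inj_on_def)

lemma is_bstr_copy: "is_bstr M \<Longrightarrow> is_bstr (copy f M)"
  by (auto simp: is_bstr_def copy_def)

lemma countable_copy:
  fixes M :: "'a bstr"
  assumes "is_bstr M" "countable (Univ M)"
  shows "\<exists>N :: nat bstr. is_bstr N \<and> M \<simeq> N"
  using assms is_bstr_copy iso_map_copy iso_iff
  by (metis inj_on_to_nat_on)

section \<open>Theories of structures\<close>

text \<open>Both \<open>Th\<close> and \<open>Th_exp\<close> have this form, so provability is analysed for it once.\<close>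

definition thy :: "'c set \<Rightarrow> ('c \<Rightarrow> 'a) \<Rightarrow> 'a bstr \<Rightarrow> 'c fm set" where
  "thy K I M = {\<phi> \<in> formulas K 0. \<forall>e. env M e \<longrightarrow> sat M I e \<phi>}"

lemma Th_thy: "Th M = thy {} (\<lambda>_. undefined) M"
  by (auto simp: Th_def thy_def env_def bsat_def)

lemma Th_exp_thy: "Th_exp A M = thy A (\<lambda>a. a) M"
  by (auto simp: Th_exp_def thy_def env_def)

text \<open>The interpretation of the constants has to stay inside the universe because \<open>\<exists>x. x = t\<close> is an axiom
  for constant symbols \<open>t\<close>.\<close>

lemma sound:
  assumes "T \<turnstile> \<phi>" "\<And>\<psi> e. \<psi> \<in> T \<Longrightarrow> env M e \<Longrightarrow> sat M I e \<psi>" "range I \<subseteq> Univ M" "env M e"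
  shows "sat M I e \<phi>"
  using assms
proof (induction arbitrary: e rule: proves.induct)
  case (all_vac x \<phi>)
  have "sat M I (e(x := a)) \<phi> \<longleftrightarrow> sat M I e \<phi>" for a
    by (rule sat_cong) (use all_vac in auto)
  then show ?case by simp
next
  case (all_elim x \<phi>)
  have "sat M I (e(x := e x)) \<phi>" if "sat M I e (Forall x \<phi>)"
    using that all_elim by (simp add: env_iff del: fun_upd_triv)
  then show ?case by simp
next
  case (ex_eq t x)
  have t: "val I e t \<in> Univ M" using ex_eq by (cases t) (auto simp: env_iff)
  have "val I (e(x := a)) t = val I e t" for a using ex_eq by (cases t) auto
  then show ?case using t by auto
next
  case (gen \<phi> x)
  then show ?case by auto
qed auto

lemma Alls_elim: "T \<turnstile> Alls xs \<phi> \<Longrightarrow> T \<turnstile> \<phi>"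
  by (induction xs) (auto simp: Alls_def intro: proves.mp proves.all_elim)

text \<open>For the theory of a structure, provability is truth. One direction is soundness; since a
  derivation may mention constants outside \<open>K\<close>, these are first sent to an arbitrary element. In the
  other direction, the universal closure of a true formula is an axiom.\<close>

lemma thy_proves:
  assumes "Univ M \<noteq> {}" "I ` K \<subseteq> Univ M" "\<phi> \<in> formulas K n"
  shows "thy K I M \<turnstile> \<phi> \<longleftrightarrow> (\<forall>e. env M e \<longrightarrow> sat M I e \<phi>)"
proof
  assume *: "thy K I M \<turnstile> \<phi>"
  obtain d where d: "d \<in> Univ M" using assms by auto
  define I' where "I' c = (if c \<in> K then I c else d)" for c
  have I': "sat M I e \<psi> \<longleftrightarrow> sat M I' e \<psi>" if "csts \<psi> \<subseteq> K" for e \<psi>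
    by (rule sat_cong) (use that in \<open>auto simp: I'_def\<close>)
  show "\<forall>e. env M e \<longrightarrow> sat M I e \<phi>"
  proof (intro allI impI)
    fix e assume e: "env M e"
    have "sat M I' e \<phi>"
    proof (rule sound[OF * _ _ e])
      show "range I' \<subseteq> Univ M" using assms d by (auto simp: I'_def)
      fix \<psi> e assume "\<psi> \<in> thy K I M" "env M e"
      then show "sat M I' e \<psi>" using I' by (auto simp: thy_def formulas_def)
    qed
    then show "sat M I e \<phi>" using I' assms(3) by (auto simp: formulas_def)
  qed
next
  assume *: "\<forall>e. env M e \<longrightarrow> sat M I e \<phi>"
  have "Alls [0..<n] \<phi> \<in> thy K I M"
    using * assms(3) by (auto simp: thy_def formulas_def)
  then show "thy K I M \<turnstile> \<phi>" using Alls_elim proves.ax by blast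
qed

lemma sat_foldr_Imp: "sat M I e (foldr Imp \<psi>s Fls) \<longleftrightarrow> \<not> (\<forall>\<psi>\<in>set \<psi>s. sat M I e \<psi>)"
  by (induction \<psi>s) auto

lemma foldr_Imp_formulas: "set \<psi>s \<subseteq> formulas K n \<Longrightarrow> foldr Imp \<psi>s Fls \<in> formulas K n"
  by (induction \<psi>s) (auto simp: formulas_def)

lemma consistent_thy:
  assumes "Univ M \<noteq> {}" "I ` K \<subseteq> Univ M" "p \<subseteq> formulas K n"
  shows "consistent_with (thy K I M) p \<longleftrightarrow>
    (\<forall>\<Psi>. finite \<Psi> \<and> \<Psi> \<subseteq> p \<longrightarrow> (\<exists>e. env M e \<and> (\<forall>\<psi>\<in>\<Psi>. sat M I e \<psi>)))"
proof -
  have "thy K I M \<turnstile> foldr Imp \<psi>s Fls \<longleftrightarrow> \<not> (\<exists>e. env M e \<and> (\<forall>\<psi>\<in>set \<psi>s. sat M I e \<psi>))"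
    if "set \<psi>s \<subseteq> p" for \<psi>s
    using thy_proves[OF assms(1,2) foldr_Imp_formulas, of \<psi>s n] that assms(3)
    by (auto simp: sat_foldr_Imp)
  then have "consistent_with (thy K I M) p \<longleftrightarrow>
     (\<forall>\<psi>s. set \<psi>s \<subseteq> p \<longrightarrow> (\<exists>e. env M e \<and> (\<forall>\<psi>\<in>set \<psi>s. sat M I e \<psi>)))"
    unfolding consistent_with_def by blast
  also have "\<dots> \<longleftrightarrow> (\<forall>\<Psi>. finite \<Psi> \<and> \<Psi> \<subseteq> p \<longrightarrow> (\<exists>e. env M e \<and> (\<forall>\<psi>\<in>\<Psi>. sat M I e \<psi>)))"
    by (metis List.finite_set finite_list)
  finally show ?thesis .
qed

lemma Th_proves:
  "is_bstr M \<Longrightarrow> \<phi> \<in> formulas {} n \<Longrightarrow> Th M \<turnstile> \<phi> \<longleftrightarrow> (\<forall>e. env M e \<longrightarrow> bsat M e \<phi>)"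
  unfolding Th_thy bsat_def by (rule thy_proves) (auto simp: is_bstr_def)

lemma Th_consistent:
  "is_bstr M \<Longrightarrow> p \<subseteq> formulas {} n \<Longrightarrow> consistent_with (Th M) p \<longleftrightarrow>
    (\<forall>\<Psi>. finite \<Psi> \<and> \<Psi> \<subseteq> p \<longrightarrow> (\<exists>e. env M e \<and> (\<forall>\<psi>\<in>\<Psi>. bsat M e \<psi>)))"
  unfolding Th_thy bsat_def by (rule consistent_thy) (auto simp: is_bstr_def)

lemma Th_consistent1:
  "is_bstr M \<Longrightarrow> \<phi> \<in> formulas {} n \<Longrightarrow> consistent_with (Th M) {\<phi>} \<longleftrightarrow> (\<exists>e. env M e \<and> bsat M e \<phi>)"
proof -
  assume M: "is_bstr M" and \<phi>: "\<phi> \<in> formulas {} n"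
  have "consistent_with (Th M) {\<phi>} \<longleftrightarrow>
      (\<forall>\<Psi>. finite \<Psi> \<and> \<Psi> \<subseteq> {\<phi>} \<longrightarrow> (\<exists>e. env M e \<and> (\<forall>\<psi>\<in>\<Psi>. bsat M e \<psi>)))"
    using Th_consistent[OF M, of "{\<phi>}" n] \<phi> by simp
  also have "\<dots> \<longleftrightarrow> (\<exists>e. env M e \<and> bsat M e \<phi>)"
  proof
    assume "\<forall>\<Psi>. finite \<Psi> \<and> \<Psi> \<subseteq> {\<phi>} \<longrightarrow> (\<exists>e. env M e \<and> (\<forall>\<psi>\<in>\<Psi>. bsat M e \<psi>))"
    from this[rule_format, of "{\<phi>}"] show "\<exists>e. env M e \<and> bsat M e \<phi>" by simp
  qed (metis singletonD subsetD)
  finally show ?thesis .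
qed

lemma Th_iff: "is_bstr M \<Longrightarrow> \<phi> \<in> formulas {} 0 \<Longrightarrow> env M e \<Longrightarrow> \<phi> \<in> Th M \<longleftrightarrow> bsat M e \<phi>"
  unfolding Th_def using bsat_formulas_cong[of \<phi> "{}" 0] by (auto simp: env_def)

lemma Th_Neg: "is_bstr M \<Longrightarrow> \<phi> \<in> formulas {} 0 \<Longrightarrow> Neg \<phi> \<in> Th M \<longleftrightarrow> \<phi> \<notin> Th M"
  using is_bstr_env[of M] Th_iff[of M "Neg \<phi>"] Th_iff[of M \<phi>] by auto

lemma is_model_Th: "is_bstr N \<Longrightarrow> is_model M (Th N) \<longleftrightarrow> is_bstr M \<and> Th M = Th N"
proof (intro iffI)
  assume N: "is_bstr N" and *: "is_model M (Th N)"
  then have M: "is_bstr M" and sub: "Th N \<subseteq> Th M" by (auto simp: is_model_def)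
  have "\<phi> \<in> Th N" if "\<phi> \<in> Th M" for \<phi>
  proof -
    have \<phi>: "\<phi> \<in> formulas {} 0" using that by (auto simp: Th_def)
    then show ?thesis using Th_Neg[OF N \<phi>] Th_Neg[OF M \<phi>] sub that by blast
  qed
  then show "is_bstr M \<and> Th M = Th N" using M sub by blast
qed (auto simp: is_model_def)

lemma Th_Exs:
  assumes "is_bstr M" "\<phi> \<in> formulas {} n"
  shows "Exs [0..<n] \<phi> \<in> Th M \<longleftrightarrow> (\<exists>e. env M e \<and> bsat M e \<phi>)"
proof -
  have 1: "Exs [0..<n] \<phi> \<in> formulas {} 0" using assms(2) by (auto simp: formulas_def)
  obtain d where d: "env M d" using is_bstr_env[OF assms(1)] by blast
  have "bsat M d (Exs [0..<n] \<phi>) \<longleftrightarrow> (\<exists>e. env M e \<and> bsat M e \<phi>)"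
  proof
    assume "\<exists>e. env M e \<and> bsat M e \<phi>"
    then obtain e where e: "env M e" "bsat M e \<phi>" by blast
    let ?e = "\<lambda>x. if x < n then e x else d x"
    have "env M ?e" using d e by (simp add: env_iff)
    moreover have "agree (set [0..<n]) d ?e" by (auto simp: agree_def)
    moreover have "bsat M ?e \<phi>"
      using e(2) bsat_formulas_cong[OF assms(2), of ?e e] by simp
    ultimately show "bsat M d (Exs [0..<n] \<phi>)" using d by auto
  qed (use d in auto)
  then show ?thesis using Th_iff[OF assms(1) 1 d] by simp
qed

text \<open>The existential closure of a formula is a sentence. This is the way in which finite configurations
  are carried from a structure to an elementarily equivalent one, possibly on another type.\<close>

lemma Th_eq_ex:
  assumes "is_bstr M" "is_bstr N" "Th M = Th N" "\<phi> \<in> formulas {} n"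
  shows "(\<exists>e. env M e \<and> bsat M e \<phi>) \<longleftrightarrow> (\<exists>e. env N e \<and> bsat N e \<phi>)"
  using Th_Exs[OF assms(1,4)] Th_Exs[OF assms(2,4)] assms(3) by simp

lemma iso_Th:
  assumes "M \<simeq> N" "is_bstr M" "is_bstr N" shows "Th M = Th N"
proof -
  obtain f where f: "iso_map f M N" using assms iso_iff by blast
  obtain e where e: "env M e" using is_bstr_env assms by blast
  have "\<phi> \<in> Th M \<longleftrightarrow> \<phi> \<in> Th N" if "\<phi> \<in> formulas {} 0" for \<phi>
    using Th_iff[OF assms(2) that e] Th_iff[OF assms(3) that iso_map_env[OF f e]]
      iso_bsat[OF f _ e, of \<phi>] that by (auto simp: formulas_def)
  then show ?thesis by (auto simp: Th_def)
qed

lemma elem_equiv_iff: "elem_equiv M N \<longleftrightarrow> Th M = Th N" by (simp add: elem_equiv_def)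

section \<open>Types and complete formulas\<close>

text \<open>Equations between types of tuples in different structures express that the tuples correspond
  under a partial elementary map.\<close>

definition tp :: "nat \<Rightarrow> 'a bstr \<Rightarrow> (nat \<Rightarrow> 'a) \<Rightarrow> unit fm set" where
  "tp n M e = {\<phi> \<in> formulas {} n. bsat M e \<phi>}"

lemma tp_eqD: "tp n M e = tp n N d \<Longrightarrow> \<phi> \<in> formulas {} n \<Longrightarrow> bsat M e \<phi> \<longleftrightarrow> bsat N d \<phi>"
  by (auto simp: tp_def)

lemma tp_eqI: "(\<And>\<phi>. \<phi> \<in> formulas {} n \<Longrightarrow> bsat M e \<phi> \<Longrightarrow> bsat N d \<phi>) \<Longrightarrow> tp n M e = tp n N d"
proof -
  assume *: "\<And>\<phi>. \<phi> \<in> formulas {} n \<Longrightarrow> bsat M e \<phi> \<Longrightarrow> bsat N d \<phi>"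
  have "bsat M e \<phi>" if "\<phi> \<in> formulas {} n" "bsat N d \<phi>" for \<phi>
    using *[of "Neg \<phi>"] that by auto
  with * show ?thesis by (auto simp: tp_def)
qed

lemma tp_cong: "(\<And>x. x < n \<Longrightarrow> e x = e' x) \<Longrightarrow> tp n M e = tp n M e'"
  using bsat_formulas_cong[of _ "{}" n e e' M] by (auto simp: tp_def)

lemma tp_ren:
  assumes "tp n M e = tp n N d" "\<And>x. x < m \<Longrightarrow> f x < n"
  shows "tp m M (\<lambda>x. e (f x)) = tp m N (\<lambda>x. d (f x))"
proof (rule tp_eqI)
  fix \<phi> :: "unit fm" assume \<phi>: "\<phi> \<in> formulas {} m" "bsat M (\<lambda>x. e (f x)) \<phi>"
  then have "ren f \<phi> \<in> formulas {} n" using assms ren_formulas by blast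
  then show "bsat N (\<lambda>x. d (f x)) \<phi>" using \<phi> tp_eqD[OF assms(1)] by fastforce
qed

lemma tp_iso: "iso_map f M N \<Longrightarrow> env M e \<Longrightarrow> tp n M e = tp n N (\<lambda>x. f (e x))"
  using iso_bsat[of f M N _ e] by (auto simp: tp_def formulas_def)

lemma tp_in_types:
  assumes "is_bstr M" "is_bstr N" "Th M = Th N" "env N e"
  shows "tp n N e \<in> types {} (Th M) n"
proof -
  have "consistent_with (Th N) (tp n N e)"
    using assms by (subst Th_consistent[of _ _ n]) (auto simp: tp_def)
  then show ?thesis using assms by (auto simp: types_def tp_def)
qed

lemma types_iff:
  assumes "is_bstr M"
  shows "p \<in> types {} (Th M) n \<longleftrightarrow> p \<subseteq> formulas {} n \<and>
    (\<forall>\<Psi>. finite \<Psi> \<and> \<Psi> \<subseteq> p \<longrightarrow> (\<exists>e. env M e \<and> (\<forall>\<psi>\<in>\<Psi>. bsat M e \<psi>))) \<and>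
    (\<forall>\<phi>\<in>formulas {} n. \<phi> \<in> p \<or> Neg \<phi> \<in> p)"
  unfolding types_def using Th_consistent[OF assms, of p n] by auto

text \<open>Relative to the theory of a structure, a formula is complete iff it is satisfied and all tuples
  that satisfy it have the same type.\<close>

lemma complete_formula_Th:
  assumes "is_bstr M"
  shows "complete_formula (Th M) n \<chi> \<longleftrightarrow> \<chi> \<in> formulas {} n \<and> (\<exists>e. env M e \<and> bsat M e \<chi>) \<and>
    (\<forall>e d. env M e \<and> env M d \<and> bsat M e \<chi> \<and> bsat M d \<chi> \<longrightarrow> tp n M e = tp n M d)"
    (is "_ \<longleftrightarrow> ?R")
proof
  assume c: "complete_formula (Th M) n \<chi>"
  then have \<chi>: "\<chi> \<in> formulas {} n" by (simp add: complete_formula_def)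
  have "tp n M e = tp n M d" if "env M e" "env M d" "bsat M e \<chi>" "bsat M d \<chi>" for e d
  proof (rule tp_eqI)
    fix \<psi> :: "unit fm" assume \<psi>: "\<psi> \<in> formulas {} n" "bsat M e \<psi>"
    then have "Th M \<turnstile> Imp \<chi> \<psi> \<or> Th M \<turnstile> Imp \<chi> (Neg \<psi>)"
      using c by (auto simp: complete_formula_def)
    then show "bsat M d \<psi>"
      using Th_proves[OF assms, of "Imp \<chi> \<psi>" n] Th_proves[OF assms, of "Imp \<chi> (Neg \<psi>)" n] \<psi> \<chi> that
      by auto
  qed
  then show ?R using c \<chi> Th_consistent1[OF assms \<chi>] by (auto simp: complete_formula_def)
next
  assume R: ?R
  then have \<chi>: "\<chi> \<in> formulas {} n" by simp
  have "Th M \<turnstile> Imp \<chi> \<psi> \<or> Th M \<turnstile> Imp \<chi> (Neg \<psi>)" if \<psi>: "\<psi> \<in> formulas {} n" for \<psi>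
    using Th_proves[OF assms, of "Imp \<chi> \<psi>" n] Th_proves[OF assms, of "Imp \<chi> (Neg \<psi>)" n] \<psi> R
    by (auto dest: tp_eqD)
  then show "complete_formula (Th M) n \<chi>"
    using R Th_consistent1[OF assms \<chi>] by (auto simp: complete_formula_def)
qed

lemma completable_Th:
  assumes "is_bstr M" "\<phi> \<in> formulas {} n"
  shows "completable_formula (Th M) n \<phi> \<longleftrightarrow>
    (\<exists>\<chi> e. complete_formula (Th M) n \<chi> \<and> env M e \<and> bsat M e \<chi> \<and> bsat M e \<phi>)" (is "?L \<longleftrightarrow> ?R")
proof
  assume ?L
  then obtain \<chi> where \<chi>: "complete_formula (Th M) n \<chi>" "Th M \<turnstile> Imp \<chi> \<phi>"
    by (auto simp: completable_formula_def)
  then obtain e where "env M e" "bsat M e \<chi>" using complete_formula_Th[OF assms(1)] by blast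
  moreover have "\<chi> \<in> formulas {} n" using \<chi>(1) by (simp add: complete_formula_def)
  ultimately show ?R using \<chi> Th_proves[OF assms(1), of "Imp \<chi> \<phi>" n] assms(2) by auto
next
  assume ?R
  then obtain \<chi> e where *: "complete_formula (Th M) n \<chi>" "env M e" "bsat M e \<chi>" "bsat M e \<phi>"
    by blast
  have "\<chi> \<in> formulas {} n" using *(1) by (simp add: complete_formula_def)
  moreover have "bsat M d \<phi>" if "env M d" "bsat M d \<chi>" for d
  proof -
    have "tp n M e = tp n M d" using * that complete_formula_Th[OF assms(1)] by blast
    then show ?thesis using tp_eqD assms(2) *(4) by blast
  qed
  ultimately have "Th M \<turnstile> Imp \<chi> \<phi>" using Th_proves[OF assms(1), of "Imp \<chi> \<phi>" n] assms(2) by auto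
  then show ?L using * by (auto simp: completable_formula_def)
qed

lemma atomic_theory_Th:
  assumes "is_bstr M"
  shows "atomic_theory (Th M) \<longleftrightarrow> (\<forall>n \<phi> e. \<phi> \<in> formulas {} n \<and> env M e \<and> bsat M e \<phi> \<longrightarrow>
    (\<exists>\<chi> e. complete_formula (Th M) n \<chi> \<and> env M e \<and> bsat M e \<chi> \<and> bsat M e \<phi>))"
  unfolding atomic_theory_def using Th_consistent1[OF assms] completable_Th[OF assms] by blast

lemma atomic_model_env:
  "atomic_model M \<longleftrightarrow> (\<forall>n e. env M e \<longrightarrow> (\<exists>\<phi>. complete_formula (Th M) n \<phi> \<and> bsat M e \<phi>))"
  by (simp add: atomic_model_def env_def)

lemma atomic_model_imp_theory: "is_bstr M \<Longrightarrow> atomic_model M \<Longrightarrow> atomic_theory (Th M)"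
  unfolding atomic_theory_Th atomic_model_env by blast

lemma atomic_model_iso:
  assumes "M \<simeq> N" "is_bstr M" "is_bstr N" "atomic_model M" shows "atomic_model N"
proof -
  obtain f where f: "iso_map f N M" using assms iso_iff iso_sym by blast
  show ?thesis unfolding atomic_model_env
  proof (intro allI impI)
    fix n e assume e: "env N e"
    then obtain \<phi> where \<phi>: "complete_formula (Th M) n \<phi>" "bsat M (\<lambda>x. f (e x)) \<phi>"
      using assms(4) iso_map_env[OF f e] atomic_model_env by blast
    then have "csts \<phi> = {}" by (auto simp: complete_formula_def formulas_def)
    then show "\<exists>\<phi>. complete_formula (Th N) n \<phi> \<and> bsat N e \<phi>"
      using \<phi> iso_bsat[OF f _ e] iso_Th[OF assms(1-3)] by auto
  qed
qed

section \<open>Direct products\<close>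

lemma listset_iff: "xs \<in> listset As \<longleftrightarrow> length xs = length As \<and> (\<forall>i<length As. xs ! i \<in> As ! i)"
proof (induction As arbitrary: xs)
  case (Cons A As)
  have "xs \<in> listset (A # As) \<longleftrightarrow> (\<exists>y ys. xs = y # ys \<and> y \<in> A \<and> ys \<in> listset As)"
    by (auto simp: set_Cons_def)
  also have "\<dots> \<longleftrightarrow> length xs = length (A # As) \<and> (\<forall>i<length (A # As). xs ! i \<in> (A # As) ! i)"
    unfolding Cons by (cases xs) (auto simp: less_Suc_eq_0_disj)
  finally show ?case .
qed auto

lemma in_prod: "x \<in> Univ (direct_prod Ms) \<longleftrightarrow>
    length x = length Ms \<and> (\<forall>i<length Ms. x ! i \<in> Univ (Ms ! i))"
  by (auto simp: direct_prod_def listset_iff)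

lemma rel_prod: "(x, y) \<in> Rel (direct_prod Ms) \<longleftrightarrow>
    x \<in> Univ (direct_prod Ms) \<and> y \<in> Univ (direct_prod Ms) \<and> (\<forall>i<length Ms. (x ! i, y ! i) \<in> Rel (Ms ! i))"
  by (auto simp: direct_prod_def)

lemma map_in_prod:
  "(\<And>i. i < length Ms \<Longrightarrow> f i \<in> Univ (Ms ! i)) \<Longrightarrow> map f [0..<length Ms] \<in> Univ (direct_prod Ms)"
  by (auto simp: in_prod)

lemma prod_ext: "x \<in> Univ (direct_prod Ms) \<Longrightarrow> y \<in> Univ (direct_prod Ms) \<Longrightarrow>
    (\<And>i. i < length Ms \<Longrightarrow> x ! i = y ! i) \<Longrightarrow> x = y"
  by (auto simp: in_prod intro: nth_equalityI)

lemma is_bstr_prod: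
  assumes "\<And>i. i < length Ms \<Longrightarrow> is_bstr (Ms ! i)"
  shows "is_bstr (direct_prod Ms)"
proof -
  have "\<forall>i. \<exists>x. i < length Ms \<longrightarrow> x \<in> Univ (Ms ! i)"
    using assms by (auto simp: is_bstr_def)
  then obtain f where "\<And>i. i < length Ms \<Longrightarrow> f i \<in> Univ (Ms ! i)" by metis
  then have "map f [0..<length Ms] \<in> Univ (direct_prod Ms)" by (rule map_in_prod)
  then show ?thesis by (auto simp: is_bstr_def rel_prod)
qed

lemma countable_prod:
  assumes "\<And>i. i < length Ms \<Longrightarrow> countable (Univ (Ms ! i))"
  shows "countable (Univ (direct_prod Ms))"
proof -
  have "Univ (direct_prod Ms) \<subseteq> lists (\<Union>i<length Ms. Univ (Ms ! i))"
    by (fastforce simp: in_prod in_set_conv_nth)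
  moreover have "countable (lists (\<Union>i<length Ms. Univ (Ms ! i)))"
    using assms by (intro countable_lists countable_UN) auto
  ultimately show ?thesis by (rule countable_subset)
qed

lemma env_prod: "env (direct_prod Ms) e \<Longrightarrow> i < length Ms \<Longrightarrow> env (Ms ! i) (\<lambda>x. e x ! i)"
  by (auto simp: env_iff in_prod)

text \<open>The isomorphism is written out so that tuples can be followed through it.\<close>

lemma iso_map_prod_perm:
  assumes \<pi>: "\<pi> permutes {..<n}" and len: "length Ms = n" "length Ns = n"
    and f: "\<And>i. i < n \<Longrightarrow> iso_map (f i) (Ms ! \<pi> i) (Ns ! i)"
  shows "iso_map (\<lambda>x. map (\<lambda>i. f i (x ! \<pi> i)) [0..<n]) (direct_prod Ms) (direct_prod Ns)"
    (is "iso_map ?h ?P ?Q")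
proof -
  have \<pi>n: "\<pi> i < n" if "i < n" for i using permutes_in_image[OF \<pi>] that by auto
  have \<pi>i: "\<exists>i<n. j = \<pi> i" if "j < n" for j
    using permutes_image[OF \<pi>] that by (metis imageE lessThan_iff)
  have h: "?h x \<in> Univ ?Q" if "x \<in> Univ ?P" for x
    using that \<pi>n iso_map_in[OF f] len by (auto simp: in_prod)
  have "inj_on ?h (Univ ?P)"
  proof (rule inj_onI, rule prod_ext[where Ms = Ms])
    fix x y j assume xy: "x \<in> Univ ?P" "y \<in> Univ ?P" "?h x = ?h y" "j < length Ms"
    then obtain i where i: "i < n" "j = \<pi> i" using \<pi>i len by auto
    then have "f i (x ! \<pi> i) = f i (y ! \<pi> i)" using xy(3) by (auto dest: map_eq_conv[THEN iffD1])
    then show "x ! j = y ! j" using f[OF i(1)] i xy len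
      by (auto simp: iso_map_def bij_betw_def inj_on_def in_prod)
  qed
  moreover have "y \<in> ?h ` Univ ?P" if y: "y \<in> Univ ?Q" for y
  proof
    have *: "\<exists>a\<in>Univ (Ms ! \<pi> i). f i a = y ! i" if "i < n" for i
    proof -
      have "y ! i \<in> f i ` Univ (Ms ! \<pi> i)"
        using f[OF that] y len that by (auto simp: iso_map_def bij_betw_def in_prod)
      then show ?thesis by auto
    qed
    define g where "g i = (SOME a. a \<in> Univ (Ms ! \<pi> i) \<and> f i a = y ! i)" for i
    have g: "g i \<in> Univ (Ms ! \<pi> i)" "f i (g i) = y ! i" if "i < n" for i
      using someI_ex[of "\<lambda>a. a \<in> Univ (Ms ! \<pi> i) \<and> f i a = y ! i"] * that by (auto simp: g_def)
    let ?x = "map (\<lambda>j. g (inv \<pi> j)) [0..<n]"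
    have inv: "inv \<pi> (\<pi> i) = i" "\<pi> (inv \<pi> i) = i" for i
      using permutes_inverses[OF \<pi>] by auto
    have "inv \<pi> j < n" if "j < n" for j
      using permutes_in_image[OF permutes_inv[OF \<pi>]] that by auto
    then show "?x \<in> Univ ?P" using g inv len by (auto simp: in_prod) (metis inv(2))
    show "y = ?h ?x"
      using y len g inv \<pi>n by (auto simp: in_prod intro!: nth_equalityI)
  qed
  ultimately have "bij_betw ?h (Univ ?P) (Univ ?Q)" using h by (auto simp: bij_betw_def)
  moreover have "(x, y) \<in> Rel ?P \<longleftrightarrow> (?h x, ?h y) \<in> Rel ?Q" if "x \<in> Univ ?P" "y \<in> Univ ?P" for x y
  proof -
    have "(\<forall>j<n. (x ! j, y ! j) \<in> Rel (Ms ! j)) \<longleftrightarrow> (\<forall>i<n. (x ! \<pi> i, y ! \<pi> i) \<in> Rel (Ms ! \<pi> i))"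
      using \<pi>i \<pi>n by metis
    also have "\<dots> \<longleftrightarrow> (\<forall>i<n. (f i (x ! \<pi> i), f i (y ! \<pi> i)) \<in> Rel (Ns ! i))"
      using f \<pi>n that len by (auto simp: iso_map_def in_prod)
    finally show ?thesis using that h len by (auto simp: rel_prod)
  qed
  ultimately show ?thesis by (simp add: iso_map_def)
qed

lemma iso_prod_perm:
  assumes "\<pi> permutes {..<n}" "length Ms = n" "length Ns = n" "\<And>i. i < n \<Longrightarrow> Ms ! \<pi> i \<simeq> Ns ! i"
  shows "direct_prod Ms \<simeq> direct_prod Ns"
proof -
  have "\<forall>i. \<exists>f. i < n \<longrightarrow> iso_map f (Ms ! \<pi> i) (Ns ! i)" using assms(4) iso_iff by blast
  then obtain f where "\<And>i. i < n \<Longrightarrow> iso_map (f i) (Ms ! \<pi> i) (Ns ! i)" by metis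
  from iso_map_prod_perm[OF assms(1-3) this] show ?thesis by (auto simp: iso_iff)
qed

lemma iso_prod:
  assumes "length Ms = length Ns" "\<And>i. i < length Ns \<Longrightarrow> Ms ! i \<simeq> Ns ! i"
  shows "direct_prod Ms \<simeq> direct_prod Ns"
  using iso_prod_perm[of id "length Ns" Ms Ns] assms permutes_id by auto

section \<open>The Feferman--Vaught theorem for finite products\<close>

text \<open>A list of \<open>n\<close> formulas, one for each factor, is a rectangle; a list of rectangles stands for the
  union of the products of the sets that they define. The complement of such a union is again
  of this form: to lie outside the first rectangle is to fail its condition in some coordinate \<open>i\<close>.\<close>

fun rects_neg :: "nat \<Rightarrow> 'c fm list list \<Rightarrow> 'c fm list list" where
  "rects_neg n [] = [replicate n Tru]"
| "rects_neg n (r # R) = concat (map (\<lambda>s. map (\<lambda>i. s[i := And (Neg (r ! i)) (s ! i)]) [0..<n]) (rects_neg n R))"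

text \<open>Existential quantification commutes with unions and acts coordinatewise on rectangles, so
  \<open>\<forall>\<close>, read as \<open>\<not>\<exists>\<not>\<close>, needs two complements.\<close>

primrec rects :: "nat \<Rightarrow> 'c fm \<Rightarrow> 'c fm list list" where
  "rects n Fls = []"
| "rects n (Rl s t) = [replicate n (Rl s t)]"
| "rects n (Eq s t) = [replicate n (Eq s t)]"
| "rects n (Imp \<phi> \<psi>) = rects_neg n (rects n \<phi>) @ rects n \<psi>"
| "rects n (Forall x \<phi>) = rects_neg n (map (map (Ex x)) (rects_neg n (rects n \<phi>)))"

definition rects_wf :: "nat \<Rightarrow> nat set \<Rightarrow> 'c set \<Rightarrow> 'c fm list list \<Rightarrow> bool" where
  "rects_wf n V K R \<longleftrightarrow> (\<forall>r\<in>set R. length r = n \<and> (\<forall>\<psi>\<in>set r. fv \<psi> \<subseteq> V \<and> csts \<psi> \<subseteq> K))"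

lemma rects_wf_simps:
  "rects_wf n V K []"
  "rects_wf n V K (r # R) \<longleftrightarrow> length r = n \<and> (\<forall>\<psi>\<in>set r. fv \<psi> \<subseteq> V \<and> csts \<psi> \<subseteq> K) \<and> rects_wf n V K R"
  "rects_wf n V K (R @ S) \<longleftrightarrow> rects_wf n V K R \<and> rects_wf n V K S"
  unfolding rects_wf_def by (simp_all add: ball_Un)

lemma rects_wf_D: "rects_wf n V K R \<Longrightarrow> r \<in> set R \<Longrightarrow> length r = n"
  "rects_wf n V K R \<Longrightarrow> r \<in> set R \<Longrightarrow> \<psi> \<in> set r \<Longrightarrow> fv \<psi> \<subseteq> V \<and> csts \<psi> \<subseteq> K"
  unfolding rects_wf_def by auto

definition rects_sat :: "'a bstr list \<Rightarrow> ('c \<Rightarrow> 'a list) \<Rightarrow> (nat \<Rightarrow> 'a list) \<Rightarrow> 'c fm list list \<Rightarrow> bool" where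
  "rects_sat Ms I e R \<longleftrightarrow> (\<exists>r\<in>set R. \<forall>i<length Ms. sat (Ms ! i) (\<lambda>c. I c ! i) (\<lambda>x. e x ! i) (r ! i))"

lemma rects_wf_neg: "rects_wf n V K R \<Longrightarrow> rects_wf n V K (rects_neg n R)"
proof (induction R)
  case (Cons r R)
  then have IH: "rects_wf n V K (rects_neg n R)" and r: "length r = n" "\<And>\<psi>. \<psi> \<in> set r \<Longrightarrow> fv \<psi> \<subseteq> V \<and> csts \<psi> \<subseteq> K"
    by (simp_all add: rects_wf_simps)
  show ?case unfolding rects_wf_def
  proof
    fix q assume "q \<in> set (rects_neg n (r # R))"
    then obtain s i where q: "s \<in> set (rects_neg n R)" "i < n" "q = s[i := And (Neg (r ! i)) (s ! i)]"
      by auto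
    have s: "length s = n" "\<And>\<psi>. \<psi> \<in> set s \<Longrightarrow> fv \<psi> \<subseteq> V \<and> csts \<psi> \<subseteq> K"
      using rects_wf_D[OF IH q(1)] by auto
    have "fv \<psi> \<subseteq> V \<and> csts \<psi> \<subseteq> K" if "\<psi> \<in> set q" for \<psi>
    proof -
      have "\<psi> \<in> insert (And (Neg (r ! i)) (s ! i)) (set s)"
        using that set_update_subset_insert[of s i] unfolding q(3) by (rule set_mp[rotated])
      then show ?thesis using s(2)[of \<psi>] s(2)[of "s ! i"] r(2)[of "r ! i"] r(1) s(1) q(2) by auto
    qed
    then show "length q = n \<and> (\<forall>\<psi>\<in>set q. fv \<psi> \<subseteq> V \<and> csts \<psi> \<subseteq> K)" using s q by auto
  qed
qed (auto simp: rects_wf_def)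

lemma rects_wf_mono: "rects_wf n V K R \<Longrightarrow> V \<subseteq> V' \<Longrightarrow> K \<subseteq> K' \<Longrightarrow> rects_wf n V' K' R"
  unfolding rects_wf_def by blast

lemma rects_wf_rects: "rects_wf n (fv \<phi>) (csts \<phi>) (rects n \<phi>)"
proof (induction \<phi>)
  case (Imp \<phi> \<psi>)
  have "rects_wf n (fv (Imp \<phi> \<psi>)) (csts (Imp \<phi> \<psi>)) (rects_neg n (rects n \<phi>))"
    by (rule rects_wf_mono[OF rects_wf_neg[OF Imp(1)]]) auto
  moreover have "rects_wf n (fv (Imp \<phi> \<psi>)) (csts (Imp \<phi> \<psi>)) (rects n \<psi>)"
    by (rule rects_wf_mono[OF Imp(2)]) auto
  ultimately show ?case by (simp add: rects_wf_simps)
next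
  case (Forall x \<phi>)
  have "rects_wf n (fv \<phi> - {x}) (csts \<phi>) (map (map (Ex x)) (rects_neg n (rects n \<phi>)))"
    using rects_wf_neg[OF Forall] by (fastforce simp: rects_wf_def)
  then show ?case by (simp add: rects_wf_neg)
qed (auto simp: rects_wf_def)

lemma rects_sat_neg:
  assumes "rects_wf (length Ms) V K R"
  shows "rects_sat Ms I e (rects_neg (length Ms) R) \<longleftrightarrow> \<not> rects_sat Ms I e R"
  using assms
proof (induction R)
  case (Cons r R)
  let ?n = "length Ms"
  let ?S = "\<lambda>s i. sat (Ms ! i) (\<lambda>c. I c ! i) (\<lambda>x. e x ! i) (s ! i)"
  have IH: "rects_sat Ms I e (rects_neg ?n R) \<longleftrightarrow> \<not> rects_sat Ms I e R" and R: "rects_wf ?n V K (rects_neg ?n R)"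
    using Cons rects_wf_neg[of ?n V K R] by (simp_all add: rects_wf_simps)
  have "rects_sat Ms I e (rects_neg ?n (r # R)) \<longleftrightarrow>
      (\<exists>s\<in>set (rects_neg ?n R). \<exists>j<?n. \<forall>i<?n. ?S (s[j := And (Neg (r ! j)) (s ! j)]) i)"
    by (auto simp: rects_sat_def) (metis atLeastLessThan_iff le0 imageI)+
  also have "\<dots> \<longleftrightarrow> (\<exists>s\<in>set (rects_neg ?n R). \<exists>j<?n. \<not> ?S r j \<and> (\<forall>i<?n. ?S s i))"
  proof (intro bex_cong refl ex_cong1 conj_cong)
    fix s j assume s: "s \<in> set (rects_neg ?n R)" and j: "j < ?n"
    have "length s = ?n" using rects_wf_D(1)[OF R s] .
    then have "?S (s[j := And (Neg (r ! j)) (s ! j)]) i \<longleftrightarrow> (i = j \<longrightarrow> \<not> ?S r j) \<and> ?S s i" if "i < ?n" for i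
      using that by (cases "i = j") auto
    then show "(\<forall>i<?n. ?S (s[j := And (Neg (r ! j)) (s ! j)]) i) \<longleftrightarrow> \<not> ?S r j \<and> (\<forall>i<?n. ?S s i)"
      using j by auto
  qed
  also have "\<dots> \<longleftrightarrow> (\<exists>j<?n. \<not> ?S r j) \<and> rects_sat Ms I e (rects_neg ?n R)" by (auto simp: rects_sat_def)
  also have "\<dots> \<longleftrightarrow> \<not> rects_sat Ms I e (r # R)" unfolding IH by (auto simp: rects_sat_def)
  finally show ?case .
qed (auto simp: rects_sat_def)

text \<open>A witness in the product is an independent choice of witnesses in the factors.\<close>

lemma rects_sat_Ex:
  assumes "rects_wf (length Ms) V K R"
  shows "rects_sat Ms I e (map (map (Ex x)) R) \<longleftrightarrow> (\<exists>a\<in>Univ (direct_prod Ms). rects_sat Ms I (e(x := a)) R)"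
proof -
  let ?n = "length Ms"
  let ?S = "\<lambda>r i b. sat (Ms ! i) (\<lambda>c. I c ! i) ((\<lambda>x. e x ! i)(x := b)) (r ! i)"
  have upd: "(\<lambda>y. (e(x := a)) y ! i) = (\<lambda>x. e x ! i)(x := a ! i)" for a i by auto
  have "(\<forall>i<?n. \<exists>b\<in>Univ (Ms ! i). ?S r i b) \<longleftrightarrow>
      (\<exists>a\<in>Univ (direct_prod Ms). \<forall>i<?n. ?S r i (a ! i))" for r
  proof
    assume "\<forall>i<?n. \<exists>b\<in>Univ (Ms ! i). ?S r i b"
    then obtain b where b: "\<And>i. i < ?n \<Longrightarrow> b i \<in> Univ (Ms ! i) \<and> ?S r i (b i)" by metis
    then show "\<exists>a\<in>Univ (direct_prod Ms). \<forall>i<?n. ?S r i (a ! i)"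
      by (intro bexI[of _ "map b [0..<?n]"] map_in_prod) auto
  qed (auto simp: in_prod)
  then have "(\<exists>r\<in>set R. \<forall>i<?n. \<exists>b\<in>Univ (Ms ! i). ?S r i b) \<longleftrightarrow>
      (\<exists>a\<in>Univ (direct_prod Ms). \<exists>r\<in>set R. \<forall>i<?n. ?S r i (a ! i))" by meson
  then show ?thesis using rects_wf_D(1)[OF assms] by (simp add: rects_sat_def upd del: fun_upd_apply cong: bex_cong)
qed

lemma val_in: "env M e \<Longrightarrow> (\<And>c. c \<in> set_trm t \<Longrightarrow> I c \<in> Univ M) \<Longrightarrow> val I e t \<in> Univ M"
  by (cases t) (auto simp: env_iff)

lemma val_nth: "val I e t ! i = val (\<lambda>c. I c ! i) (\<lambda>x. e x ! i) t"
  by (cases t) auto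

text \<open>The rectangles depend only on the formula and the number of factors; hence products of
  elementarily equivalent structures, on whatever types, satisfy the same sentences.\<close>

theorem feferman_vaught:
  assumes "env (direct_prod Ms) e" "\<And>c. c \<in> csts \<phi> \<Longrightarrow> I c \<in> Univ (direct_prod Ms)"
  shows "sat (direct_prod Ms) I e \<phi> \<longleftrightarrow> rects_sat Ms I e (rects (length Ms) \<phi>)"
  using assms
proof (induction \<phi> arbitrary: e)
  case (Rl s t)
  then have "val I e s \<in> Univ (direct_prod Ms)" "val I e t \<in> Univ (direct_prod Ms)"
    by (auto intro!: val_in)
  then show ?case by (simp add: rel_prod rects_sat_def val_nth)
next
  case (Eq s t)
  then have "val I e s \<in> Univ (direct_prod Ms)" "val I e t \<in> Univ (direct_prod Ms)"
    by (auto intro!: val_in)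
  then have "val I e s = val I e t \<longleftrightarrow> (\<forall>i<length Ms. val I e s ! i = val I e t ! i)"
    using prod_ext by metis
  then show ?case by (simp add: rects_sat_def val_nth)
next
  case (Imp \<phi> \<psi>)
  have app: "rects_sat Ms I e (R @ S) \<longleftrightarrow> rects_sat Ms I e R \<or> rects_sat Ms I e S" for R S
    by (auto simp: rects_sat_def)
  show ?case using Imp by (auto simp: app rects_sat_neg[OF rects_wf_rects])
next
  case (Forall x \<phi>)
  let ?n = "length Ms"
  have 1: "rects_wf ?n (fv \<phi>) (csts \<phi>) (rects_neg ?n (rects ?n \<phi>))" by (rule rects_wf_neg[OF rects_wf_rects])
  have 2: "rects_wf ?n (fv \<phi>) (csts \<phi>) (map (map (Ex x)) (rects_neg ?n (rects ?n \<phi>)))"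
    using 1 by (fastforce simp: rects_wf_def)
  have "sat (direct_prod Ms) I (e(x := a)) \<phi> \<longleftrightarrow> rects_sat Ms I (e(x := a)) (rects ?n \<phi>)"
    if "a \<in> Univ (direct_prod Ms)" for a
    using Forall that by auto
  then show ?case by (simp add: rects_sat_neg[OF 2] rects_sat_Ex[OF 1] rects_sat_neg[OF rects_wf_rects])
qed (simp add: rects_sat_def)

lemma rects_formulas:
  assumes "\<phi> \<in> formulas K m" "r \<in> set (rects n \<phi>)" "i < n"
  shows "r ! i \<in> formulas K m"
  using rects_wf_rects[of n \<phi>] assms by (fastforce simp: rects_wf_def formulas_def)

lemma feferman_vaught_bsat:
  assumes "env (direct_prod Ms) e" "csts \<phi> = {}"
  shows "bsat (direct_prod Ms) e \<phi> \<longleftrightarrow>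
    (\<exists>r\<in>set (rects (length Ms) \<phi>). \<forall>i<length Ms. bsat (Ms ! i) (\<lambda>x. e x ! i) (r ! i))"
proof -
  have "sat (Ms ! i) I d (r ! i) \<longleftrightarrow> bsat (Ms ! i) d (r ! i)"
    if "r \<in> set (rects (length Ms) \<phi>)" "i < length Ms" for r i I d
    unfolding bsat_def
    by (rule sat_cong) (use rects_wf_rects[of "length Ms" \<phi>] that assms in \<open>fastforce simp: rects_wf_def\<close>)+
  moreover have "bsat (direct_prod Ms) e \<phi> \<longleftrightarrow> rects_sat Ms (\<lambda>_. undefined) e (rects (length Ms) \<phi>)"
    unfolding bsat_def by (rule feferman_vaught) (use assms in auto)
  ultimately show ?thesis by (simp add: rects_sat_def)
qed

lemma prod_tp:
  assumes "length Ms = n" "length Ns = n" "env (direct_prod Ms) e" "env (direct_prod Ns) d"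
    "\<And>i. i < n \<Longrightarrow> tp m (Ms ! i) (\<lambda>x. e x ! i) = tp m (Ns ! i) (\<lambda>x. d x ! i)"
  shows "tp m (direct_prod Ms) e = tp m (direct_prod Ns) d"
proof (rule tp_eqI)
  fix \<phi> :: "unit fm" assume \<phi>: "\<phi> \<in> formulas {} m" "bsat (direct_prod Ms) e \<phi>"
  then have c: "csts \<phi> = {}" by (auto simp: formulas_def)
  obtain r where r: "r \<in> set (rects n \<phi>)" "\<And>i. i < n \<Longrightarrow> bsat (Ms ! i) (\<lambda>x. e x ! i) (r ! i)"
    using feferman_vaught_bsat[OF assms(3) c] \<phi> assms by auto
  have "bsat (Ns ! i) (\<lambda>x. d x ! i) (r ! i)" if "i < n" for i
    using tp_eqD[OF assms(5)[OF that]] rects_formulas[OF \<phi>(1) r(1) that] r(2)[OF that] by auto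
  then show "bsat (direct_prod Ns) d \<phi>"
    using feferman_vaught_bsat[OF assms(4) c] r assms by auto
qed

lemma tp_0: "is_bstr M \<Longrightarrow> env M e \<Longrightarrow> tp 0 M e = Th M"
  using Th_iff[of M _ e] by (auto simp: tp_def Th_def)

lemma prod_Th:
  assumes "length Ms = n" "length Ns = n" "\<And>i. i < n \<Longrightarrow> is_bstr (Ms ! i)" "\<And>i. i < n \<Longrightarrow> is_bstr (Ns ! i)"
    "\<And>i. i < n \<Longrightarrow> Th (Ms ! i) = Th (Ns ! i)"
  shows "Th (direct_prod Ms) = Th (direct_prod Ns)"
proof -
  have b: "is_bstr (direct_prod Ms)" "is_bstr (direct_prod Ns)"
    using assms by (auto intro: is_bstr_prod)
  obtain e d where e: "env (direct_prod Ms) e" "env (direct_prod Ns) d"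
    using is_bstr_env[OF b(1)] is_bstr_env[OF b(2)] by blast
  have "tp 0 (Ms ! i) (\<lambda>x. e x ! i) = tp 0 (Ns ! i) (\<lambda>x. d x ! i)" if "i < n" for i
    using tp_0 env_prod[OF e(1)] env_prod[OF e(2)] that assms by metis
  from prod_tp[OF assms(1,2) e this] show ?thesis using tp_0[OF b(1) e(1)] tp_0[OF b(2) e(2)] by simp
qed

lemma elem_sub_prod:
  assumes "length Es = n" "length Xs = n" "\<And>i. i < n \<Longrightarrow> elem_sub (Es ! i) (Xs ! i)"
  shows "elem_sub (direct_prod Es) (direct_prod Xs)"
proof -
  have E: "is_bstr (Es ! i)" "Univ (Es ! i) \<subseteq> Univ (Xs ! i)"
    "Rel (Es ! i) = Rel (Xs ! i) \<inter> (Univ (Es ! i) \<times> Univ (Es ! i))" if "i < n" for i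
    using assms(3)[OF that] by (auto simp: elem_sub_def)
  have b: "is_bstr (direct_prod Es)" using E assms by (auto intro: is_bstr_prod)
  have sub: "Univ (direct_prod Es) \<subseteq> Univ (direct_prod Xs)"
    using E(2) assms(1,2) by (auto simp: in_prod subset_iff)
  have "Rel (direct_prod Es) = Rel (direct_prod Xs) \<inter> (Univ (direct_prod Es) \<times> Univ (direct_prod Es))"
  proof (rule set_eqI, clarify)
    fix x y
    show "(x, y) \<in> Rel (direct_prod Es) \<longleftrightarrow>
      (x, y) \<in> Rel (direct_prod Xs) \<inter> (Univ (direct_prod Es) \<times> Univ (direct_prod Es))"
    proof (cases "x \<in> Univ (direct_prod Es) \<and> y \<in> Univ (direct_prod Es)")
      case True
      then have "(x ! i, y ! i) \<in> Rel (Es ! i) \<longleftrightarrow> (x ! i, y ! i) \<in> Rel (Xs ! i)" if "i < n" for i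
        using E(3)[OF that] that assms(1) by (simp add: in_prod)
      then show ?thesis using True sub assms(1,2) by (auto simp: rel_prod)
    qed (auto simp: rel_prod)
  qed
  moreover have "bsat (direct_prod Es) e \<phi> \<longleftrightarrow> bsat (direct_prod Xs) e \<phi>"
    if "csts \<phi> = {}" "range e \<subseteq> Univ (direct_prod Es)" for \<phi> e
  proof -
    have e: "env (direct_prod Es) e" "env (direct_prod Xs) e" using that sub by (auto simp: env_def)
    obtain m where m: "\<phi> \<in> formulas {} m" using formulas_exists[of \<phi> "{}"] \<open>csts \<phi> = {}\<close> by auto
    have "tp m (Es ! i) (\<lambda>x. e x ! i) = tp m (Xs ! i) (\<lambda>x. e x ! i)" if "i < n" for i
      using assms(3)[OF that] env_prod[OF e(1)] that assms(1)
      by (auto simp: elem_sub_def tp_def formulas_def env_def)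
    from tp_eqD[OF prod_tp[OF assms(1,2) e this] m] show ?thesis .
  qed
  ultimately show ?thesis using b sub by (auto simp: elem_sub_def)
qed

section \<open>Ultrafilters and saturation of products\<close>

definition ultra :: "'x set set \<Rightarrow> bool" where
  "ultra U \<longleftrightarrow> (\<forall>A B. A \<inter> B \<in> U \<longleftrightarrow> A \<in> U \<and> B \<in> U) \<and> (\<forall>A. - A \<in> U \<longleftrightarrow> A \<notin> U)"

definition fip :: "'x set set \<Rightarrow> bool" where
  "fip G \<longleftrightarrow> (\<forall>F. finite F \<and> F \<subseteq> G \<longrightarrow> \<Inter>F \<noteq> {})"

text \<open>By Zorn's lemma there is a maximal family with the finite intersection property, and
  maximality decides every set.\<close>

lemma fip_extend:
  fixes G :: "'x set set"
  assumes "fip G" shows "\<exists>U. G \<subseteq> U \<and> ultra U"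
proof -
  have "\<exists>U\<in>{H. G \<subseteq> H \<and> fip H}. \<forall>X\<in>{H. G \<subseteq> H \<and> fip H}. U \<subseteq> X \<longrightarrow> X = U"
  proof (rule subset_Zorn_nonempty)
    show "{H. G \<subseteq> H \<and> fip H} \<noteq> {}" using assms by auto
    fix C assume C: "C \<noteq> {}" "subset.chain {H. G \<subseteq> H \<and> fip H} C"
    have "fip (\<Union>C)" unfolding fip_def
    proof (intro allI impI)
      fix F assume F: "finite F \<and> F \<subseteq> \<Union>C"
      then obtain H where "H \<in> C" "F \<subseteq> H"
        using finite_subset_Union_chain[of F C] C by metis
      then show "\<Inter>F \<noteq> {}" using C F by (auto simp: subset.chain_def fip_def)
    qed
    moreover have "G \<subseteq> \<Union>C"
    proof -
      obtain H where "H \<in> C" using C(1) by blast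
      moreover have "G \<subseteq> H" using C(2) \<open>H \<in> C\<close> unfolding subset.chain_def by blast
      ultimately show ?thesis by blast
    qed
    ultimately show "\<Union>C \<in> {H. G \<subseteq> H \<and> fip H}" by blast
  qed
  then obtain U where U: "G \<subseteq> U" "fip U" and max: "\<And>H. fip H \<Longrightarrow> U \<subseteq> H \<Longrightarrow> H = U"
    by (smt (verit) mem_Collect_eq subset_trans)
  have fin: "\<Inter>F \<in> U" if "finite F" "F \<subseteq> U" for F
  proof -
    have "fip (insert (\<Inter>F) U)" unfolding fip_def
    proof (intro allI impI)
      fix F' assume F': "finite F' \<and> F' \<subseteq> insert (\<Inter>F) U"
      have "\<Inter>((F' - {\<Inter>F}) \<union> F) \<noteq> {}"
        using U(2) that F' unfolding fip_def by (metis Diff_subset_conv finite_Diff finite_Un insert_is_Un le_sup_iff)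
      then show "\<Inter>F' \<noteq> {}" by auto
    qed
    then show ?thesis using max by blast
  qed
  have compl: "A \<in> U" if "- A \<notin> U" for A
  proof -
    have "\<not> fip (insert (- A) U)" using max that by blast
    then obtain F where F: "finite F" "F \<subseteq> insert (- A) U" "\<Inter>F = {}" by (auto simp: fip_def)
    have sub: "\<Inter>(F - {- A}) \<subseteq> A" using F(3) by auto
    have "fip (insert A U)" unfolding fip_def
    proof (intro allI impI)
      fix F' assume F': "finite F' \<and> F' \<subseteq> insert A U"
      have "\<Inter>((F' - {A}) \<union> (F - {- A})) \<noteq> {}"
        using U(2) F F' unfolding fip_def by (metis Diff_subset_conv finite_Diff finite_Un insert_is_Un le_sup_iff)
      then show "\<Inter>F' \<noteq> {}" using sub by auto
    qed
    then show ?thesis using max by blast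
  qed
  have up: "B \<in> U" if "A \<in> U" "A \<subseteq> B" for A B
  proof (rule compl, rule notI)
    assume "- B \<in> U"
    then have "\<Inter>{A, - B} \<noteq> {}" using U(2) that unfolding fip_def by (meson empty_subsetI finite.intros insert_subset)
    then show False using that by auto
  qed
  have "A \<notin> U \<or> - A \<notin> U" for A
  proof (rule ccontr)
    assume "\<not> (A \<notin> U \<or> - A \<notin> U)"
    then have "\<Inter>{A, - A} \<noteq> {}" using U(2) unfolding fip_def by (meson empty_subsetI finite.intros insert_subset)
    then show False by auto
  qed
  moreover have "A \<inter> B \<in> U \<longleftrightarrow> A \<in> U \<and> B \<in> U" for A B
    using fin[of "{A, B}"] up by auto
  ultimately have "ultra U" using compl unfolding ultra_def by blast
  then show ?thesis using U by blast
qed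

lemma ultra_simps:
  assumes "ultra U"
  shows "A \<inter> B \<in> U \<longleftrightarrow> A \<in> U \<and> B \<in> U" "- A \<in> U \<longleftrightarrow> A \<notin> U"
    "UNIV \<in> U" "{} \<notin> U" "A \<in> U \<Longrightarrow> A \<subseteq> B \<Longrightarrow> B \<in> U"
proof -
  show 1: "A \<inter> B \<in> U \<longleftrightarrow> A \<in> U \<and> B \<in> U" and 2: "- A \<in> U \<longleftrightarrow> A \<notin> U" for A B
    using assms by (auto simp: ultra_def)
  show 3: "UNIV \<in> U" using 1[of UNIV] 2 by (metis Int_UNIV_left)
  show "{} \<notin> U" using 2[of UNIV] 3 by auto
  show "A \<in> U \<Longrightarrow> A \<subseteq> B \<Longrightarrow> B \<in> U" using 1 by (metis inf.absorb1)
qed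

lemma ultra_Collect:
  assumes "ultra U"
  shows "{x. P x \<and> Q x} \<in> U \<longleftrightarrow> {x. P x} \<in> U \<and> {x. Q x} \<in> U" "{x. \<not> P x} \<in> U \<longleftrightarrow> {x. P x} \<notin> U"
    "{x. P x \<longrightarrow> Q x} \<in> U \<longleftrightarrow> ({x. P x} \<in> U \<longrightarrow> {x. Q x} \<in> U)"
proof -
  show 1: "{x. P x \<and> Q x} \<in> U \<longleftrightarrow> {x. P x} \<in> U \<and> {x. Q x} \<in> U" for P Q
    using ultra_simps(1)[OF assms, of "{x. P x}" "{x. Q x}"] by (simp add: Collect_conj_eq)
  show 2: "{x. \<not> P x} \<in> U \<longleftrightarrow> {x. P x} \<notin> U" for P
    using ultra_simps(2)[OF assms, of "{x. P x}"] by (simp add: Collect_neg_eq)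
  show "{x. P x \<longrightarrow> Q x} \<in> U \<longleftrightarrow> ({x. P x} \<in> U \<longrightarrow> {x. Q x} \<in> U)"
    using 1[of P "\<lambda>x. \<not> Q x"] 2[of Q] 2[of "\<lambda>x. P x \<and> \<not> Q x"] by simp
qed

lemma ultra_finite_ball:
  assumes "ultra U" "finite F"
  shows "{x. \<forall>a\<in>F. P a x} \<in> U \<longleftrightarrow> (\<forall>a\<in>F. {x. P a x} \<in> U)"
  using assms(2)
  by (induction F) (auto simp: ultra_simps(3)[OF assms(1)] ultra_Collect(1)[OF assms(1)])

lemma ultra_finite_bex:
  assumes "ultra U" "finite F"
  shows "{x. \<exists>a\<in>F. P a x} \<in> U \<longleftrightarrow> (\<exists>a\<in>F. {x. P a x} \<in> U)"
  using ultra_finite_ball[OF assms, of "\<lambda>a x. \<not> P a x"] ultra_Collect(2)[OF assms(1), of "\<lambda>x. \<exists>a\<in>F. P a x"]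
  by (simp add: ultra_Collect(2)[OF assms(1)]) blast

lemma sat_map_fm: "sat M I e (map_fm g \<phi>) \<longleftrightarrow> sat M (\<lambda>c. I (g c)) e \<phi>"
proof (induction \<phi> arbitrary: e)
  case (Rl s t)
  then show ?case by (cases s; cases t) auto
next
  case (Eq s t)
  then show ?case by (cases s; cases t) auto
qed auto

lemma fv_map_fm [simp]: "fv (map_fm g \<phi>) = fv \<phi>"
proof (induction \<phi>)
  case (Rl s t)
  then show ?case by (cases s; cases t) auto
next
  case (Eq s t)
  then show ?case by (cases s; cases t) auto
qed auto

lemma types_exp_iff:
  assumes "is_bstr M" "A \<subseteq> Univ M"
  shows "p \<in> types A (Th_exp A M) 1 \<longleftrightarrow> p \<subseteq> formulas A 1 \<and>
    (\<forall>\<Psi>. finite \<Psi> \<and> \<Psi> \<subseteq> p \<longrightarrow> (\<exists>a\<in>Univ M. \<forall>\<psi>\<in>\<Psi>. sat M (\<lambda>c. c) (\<lambda>_. a) \<psi>)) \<and>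
    (\<forall>\<phi>\<in>formulas A 1. \<phi> \<in> p \<or> Neg \<phi> \<in> p)"
proof -
  have *: "(\<exists>e. env M e \<and> (\<forall>\<psi>\<in>\<Psi>. sat M (\<lambda>c. c) e \<psi>)) \<longleftrightarrow> (\<exists>a\<in>Univ M. \<forall>\<psi>\<in>\<Psi>. sat M (\<lambda>c. c) (\<lambda>_. a) \<psi>)"
    if "\<Psi> \<subseteq> formulas A 1" for \<Psi>
  proof -
    have s: "sat M (\<lambda>c. c) e \<psi> \<longleftrightarrow> sat M (\<lambda>c. c) (\<lambda>_. e 0) \<psi>" if "\<psi> \<in> \<Psi>" for e \<psi>
      by (rule sat_cong) (use that \<open>\<Psi> \<subseteq> formulas A 1\<close> in \<open>auto simp: formulas_def\<close>)
    have 1: "(\<forall>\<psi>\<in>\<Psi>. sat M (\<lambda>c. c) e \<psi>) \<longleftrightarrow> (\<forall>\<psi>\<in>\<Psi>. sat M (\<lambda>c. c) (\<lambda>_. e 0) \<psi>)" for e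
      by (rule ball_cong[OF refl s])
    show ?thesis
    proof
      assume "\<exists>e. env M e \<and> (\<forall>\<psi>\<in>\<Psi>. sat M (\<lambda>c. c) e \<psi>)"
      then obtain e where e: "env M e" "\<forall>\<psi>\<in>\<Psi>. sat M (\<lambda>c. c) e \<psi>" by blast
      show "\<exists>a\<in>Univ M. \<forall>\<psi>\<in>\<Psi>. sat M (\<lambda>c. c) (\<lambda>_. a) \<psi>"
        using e(2)[THEN 1[of e, THEN iffD1]] env_in[OF e(1)] by blast
    qed (meson env_iff)
  qed
  show ?thesis
  proof (cases "p \<subseteq> formulas A 1")
    case True
    have "consistent_with (Th_exp A M) p \<longleftrightarrow>
        (\<forall>\<Psi>. finite \<Psi> \<and> \<Psi> \<subseteq> p \<longrightarrow> (\<exists>e. env M e \<and> (\<forall>\<psi>\<in>\<Psi>. sat M (\<lambda>c. c) e \<psi>)))"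
      unfolding Th_exp_thy by (rule consistent_thy) (use assms True in \<open>auto simp: is_bstr_def\<close>)
    also have "\<dots> \<longleftrightarrow> (\<forall>\<Psi>. finite \<Psi> \<and> \<Psi> \<subseteq> p \<longrightarrow> (\<exists>a\<in>Univ M. \<forall>\<psi>\<in>\<Psi>. sat M (\<lambda>c. c) (\<lambda>_. a) \<psi>))"
      using * True by (meson subset_trans)
    finally show ?thesis by (auto simp: types_def)
  qed (auto simp: types_def)
qed

text \<open>Choose an ultrafilter on the product that contains the solution set of each formula in the type
  \<open>p\<close>. Its projection to a coordinate \<open>i\<close> is a type \<open>q i\<close> over the \<open>i\<close>-th coordinates of the
  parameters, which the \<open>i\<close>-th factor realises. By the Feferman--Vaught theorem each formula of \<open>p\<close> is
  a finite union of rectangles; the ultrafilter contains one of them, and so the point whose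
  coordinates realise the \<open>q i\<close> lies in it.\<close>

theorem saturated_prod:
  fixes Xs :: "'a bstr list" and \<kappa> :: "'k rel"
  assumes X: "\<And>i. i < length Xs \<Longrightarrow> is_bstr (Xs ! i)" "\<And>i. i < length Xs \<Longrightarrow> saturated \<kappa> (Xs ! i)"
  shows "saturated \<kappa> (direct_prod Xs)"
  unfolding saturated_def
proof (intro allI impI ballI)
  let ?P = "direct_prod Xs" and ?n = "length Xs"
  fix A p assume A: "A \<subseteq> Univ ?P" "|A| <o \<kappa>" and p: "p \<in> types A (Th_exp A ?P) 1"
  have P: "is_bstr ?P" using X by (auto intro: is_bstr_prod)
  have p1: "p \<subseteq> formulas A 1"
    "\<And>\<Psi>. finite \<Psi> \<Longrightarrow> \<Psi> \<subseteq> p \<Longrightarrow> \<exists>a\<in>Univ ?P. \<forall>\<psi>\<in>\<Psi>. sat ?P (\<lambda>c. c) (\<lambda>_. a) \<psi>"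
    using p types_exp_iff[OF P A(1)] by auto
  let ?D = "\<lambda>\<phi>. {x \<in> Univ ?P. sat ?P (\<lambda>c. c) (\<lambda>_. x) \<phi>}"
  have "fip (insert (Univ ?P) (?D ` p))" unfolding fip_def
  proof (intro allI impI)
    fix F assume F: "finite F \<and> F \<subseteq> insert (Univ ?P) (?D ` p)"
    then have "finite (F - {Univ ?P})" "F - {Univ ?P} \<subseteq> ?D ` p" by auto
    then obtain \<Psi> where \<Psi>: "finite \<Psi>" "\<Psi> \<subseteq> p" "F - {Univ ?P} = ?D ` \<Psi>"
      using finite_subset_image by (metis (no_types, lifting))
    obtain a where "a \<in> Univ ?P" "\<forall>\<psi>\<in>\<Psi>. sat ?P (\<lambda>c. c) (\<lambda>_. a) \<psi>" using p1(2)[OF \<Psi>(1,2)] by blast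
    then have "a \<in> S" if "S \<in> F" for S using \<Psi>(3) that by (cases "S = Univ ?P") auto
    then show "\<Inter>F \<noteq> {}" by blast
  qed
  then obtain U where U: "insert (Univ ?P) (?D ` p) \<subseteq> U" "ultra U" using fip_extend by blast
  define B where "B i = (\<lambda>a. a ! i) ` A" for i
  define q where "q i = {\<psi> \<in> formulas (B i) 1. {x. sat (Xs ! i) (\<lambda>c. c) (\<lambda>_. x ! i) \<psi>} \<in> U}" for i
  have "\<exists>c\<in>Univ (Xs ! i). \<forall>\<psi>\<in>q i. sat (Xs ! i) (\<lambda>c. c) (\<lambda>_. c) \<psi>" if i: "i < ?n" for i
  proof -
    have B: "B i \<subseteq> Univ (Xs ! i)" using A(1) i by (auto simp: B_def in_prod)
    have "\<exists>a\<in>Univ (Xs ! i). \<forall>\<psi>\<in>\<Psi>. sat (Xs ! i) (\<lambda>c. c) (\<lambda>_. a) \<psi>" if "finite \<Psi>" "\<Psi> \<subseteq> q i" for \<Psi>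
    proof -
      have "{x. \<forall>\<psi>\<in>\<Psi>. sat (Xs ! i) (\<lambda>c. c) (\<lambda>_. x ! i) \<psi>} \<in> U"
        using ultra_finite_ball[OF U(2) that(1)] that(2) by (fastforce simp: q_def)
      then have "Univ ?P \<inter> {x. \<forall>\<psi>\<in>\<Psi>. sat (Xs ! i) (\<lambda>c. c) (\<lambda>_. x ! i) \<psi>} \<in> U"
        using U(1) ultra_simps(1)[OF U(2)] by simp
      then have "Univ ?P \<inter> {x. \<forall>\<psi>\<in>\<Psi>. sat (Xs ! i) (\<lambda>c. c) (\<lambda>_. x ! i) \<psi>} \<noteq> {}"
        using ultra_simps(4)[OF U(2)] by metis
      then show ?thesis using i by (auto simp: in_prod)
    qed
    moreover have "\<phi> \<in> q i \<or> Neg \<phi> \<in> q i" if "\<phi> \<in> formulas (B i) 1" for \<phi>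
      using that ultra_Collect(2)[OF U(2), of "\<lambda>x. sat (Xs ! i) (\<lambda>c. c) (\<lambda>_. x ! i) \<phi>"]
      by (auto simp: q_def)
    moreover have "q i \<subseteq> formulas (B i) 1" by (auto simp: q_def)
    ultimately have "q i \<in> types (B i) (Th_exp (B i) (Xs ! i)) 1"
      unfolding types_exp_iff[OF X(1)[OF i] B] by (intro conjI allI impI ballI) simp_all
    moreover have "|B i| <o \<kappa>"
      unfolding B_def using card_of_image A(2) ordLeq_ordLess_trans by blast
    ultimately show ?thesis using X(2)[OF i] B unfolding saturated_def by blast
  qed
  then obtain c where c: "\<And>i. i < ?n \<Longrightarrow> c i \<in> Univ (Xs ! i)"
    "\<And>i \<psi>. i < ?n \<Longrightarrow> \<psi> \<in> q i \<Longrightarrow> sat (Xs ! i) (\<lambda>c. c) (\<lambda>_. c i) \<psi>" by metis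
  define a where "a = map c [0..<?n]"
  have a: "a \<in> Univ ?P" unfolding a_def by (rule map_in_prod) (use c in auto)
  have "sat ?P (\<lambda>c. c) (\<lambda>_. a) \<phi>" if "\<phi> \<in> p" for \<phi>
  proof -
    have \<phi>: "\<phi> \<in> formulas A 1" using p1 that by auto
    then have FV: "sat ?P (\<lambda>c. c) (\<lambda>_. x) \<phi> \<longleftrightarrow> rects_sat Xs (\<lambda>c. c) (\<lambda>_. x) (rects ?n \<phi>)" if "x \<in> Univ ?P" for x
      by (intro feferman_vaught) (use A that in \<open>auto simp: env_iff formulas_def\<close>)
    let ?S = "\<lambda>r i x. sat (Xs ! i) (\<lambda>c. c ! i) (\<lambda>_. x) (r ! i)"
    have "?D \<phi> \<subseteq> {x. \<exists>r\<in>set (rects ?n \<phi>). \<forall>i\<in>{..<?n}. ?S r i (x ! i)}"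
      using FV by (fastforce simp: rects_sat_def in_prod)
    then have "{x. \<exists>r\<in>set (rects ?n \<phi>). \<forall>i\<in>{..<?n}. ?S r i (x ! i)} \<in> U"
      using U that ultra_simps(5)[OF U(2)] by blast
    then obtain r where r: "r \<in> set (rects ?n \<phi>)" "\<And>i. i < ?n \<Longrightarrow> {x. ?S r i (x ! i)} \<in> U"
      using ultra_finite_bex[OF U(2), of "set (rects ?n \<phi>)"] ultra_finite_ball[OF U(2), of "{..<?n}"] by auto
    have "?S r i (c i)" if i: "i < ?n" for i
    proof -
      have "r ! i \<in> formulas A 1" using rects_formulas[OF \<phi> r(1) i] .
      then have "map_fm (\<lambda>c. c ! i) (r ! i) \<in> formulas (B i) 1"
        by (auto simp: formulas_def fm.set_map B_def)
      then have "map_fm (\<lambda>c. c ! i) (r ! i) \<in> q i" using r(2)[OF i] by (simp add: q_def sat_map_fm)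
      from c(2)[OF i this] show ?thesis by (simp add: sat_map_fm)
    qed
    then show ?thesis using r(1) FV[OF a] by (auto simp: rects_sat_def a_def)
  qed
  then show "\<exists>a\<in>Univ ?P. \<forall>\<phi>\<in>p. sat ?P (\<lambda>c. c) (\<lambda>_. a) \<phi>" using a by blast
qed

section \<open>Ultrapowers are compact\<close>

text \<open>This is \<open>\<aleph>\<^sub>1\<close>-saturation for systems of formulas in several unknowns: \<open>V\<close> is the set of unknowns
  and the other variables are parameters. All sets of formulas are countable here.\<close>

definition compact_str :: "'a bstr \<Rightarrow> bool" where
  "compact_str W \<longleftrightarrow> is_bstr W \<and> (\<forall>e V \<Phi>. env W e \<and> (\<forall>\<phi>\<in>\<Phi>. csts \<phi> = {}) \<and>
     (\<forall>F. finite F \<and> F \<subseteq> \<Phi> \<longrightarrow> (\<exists>e'. env W e' \<and> agree V e e' \<and> (\<forall>\<phi>\<in>F. bsat W e' \<phi>))) \<longrightarrow>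
     (\<exists>e'. env W e' \<and> agree V e e' \<and> (\<forall>\<phi>\<in>\<Phi>. bsat W e' \<phi>)))"

definition nat_ultra :: "nat set set" where
  "nat_ultra = (SOME U. {A. finite (- A)} \<subseteq> U \<and> ultra U)"

lemma nat_ultra: "ultra nat_ultra" "finite (- A) \<Longrightarrow> A \<in> nat_ultra"
proof -
  have "fip {A :: nat set. finite (- A)}" unfolding fip_def
  proof (intro allI impI)
    fix F :: "nat set set" assume "finite F \<and> F \<subseteq> {A. finite (- A)}"
    then have "finite (\<Union>A\<in>F. - A)" by auto
    moreover have "(\<Union>A\<in>F. - A) = - \<Inter>F" by auto
    ultimately show "\<Inter>F \<noteq> {}" by (metis Compl_empty_eq infinite_UNIV_nat)
  qed
  then have "{A. finite (- A)} \<subseteq> nat_ultra \<and> ultra nat_ultra"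
    unfolding nat_ultra_def using someI_ex[OF fip_extend] by fast
  then show "ultra nat_ultra" "finite (- A) \<Longrightarrow> A \<in> nat_ultra" by auto
qed

text \<open>The elements of the ultrapower are classes of sequences, as equality of a structure is
  equality of elements.\<close>

definition uclass :: "'a bstr \<Rightarrow> (nat \<Rightarrow> 'a) \<Rightarrow> (nat \<Rightarrow> 'a) set" where
  "uclass M f = {g. env M g \<and> {i. f i = g i} \<in> nat_ultra}"

definition upower :: "'a bstr \<Rightarrow> (nat \<Rightarrow> 'a) set bstr" where
  "upower M = \<lparr>Univ = uclass M ` {f. env M f},
    Rel = {(uclass M f, uclass M g) | f g. env M f \<and> env M g \<and> {i. (f i, g i) \<in> Rel M} \<in> nat_ultra}\<rparr>"

lemma uclass_eq:
  assumes "env M f" "env M g"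
  shows "uclass M f = uclass M g \<longleftrightarrow> {i. f i = g i} \<in> nat_ultra"
proof
  have "g \<in> uclass M g" using assms ultra_simps(3)[OF nat_ultra(1)] by (auto simp: uclass_def)
  then show "{i. f i = g i} \<in> nat_ultra" if "uclass M f = uclass M g"
    unfolding that[symmetric] by (simp add: uclass_def)
next
  assume *: "{i. f i = g i} \<in> nat_ultra"
  have "{i. f i = h i} \<in> nat_ultra \<longleftrightarrow> {i. g i = h i} \<in> nat_ultra" for h
  proof
    show "{i. g i = h i} \<in> nat_ultra" if "{i. f i = h i} \<in> nat_ultra"
      using ultra_simps(1)[OF nat_ultra(1), THEN iffD2, OF conjI[OF * that]]
      by (rule ultra_simps(5)[OF nat_ultra(1)]) auto
    show "{i. f i = h i} \<in> nat_ultra" if "{i. g i = h i} \<in> nat_ultra"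
      using ultra_simps(1)[OF nat_ultra(1), THEN iffD2, OF conjI[OF * that]]
      by (rule ultra_simps(5)[OF nat_ultra(1)]) auto
  qed
  then show "uclass M f = uclass M g" by (simp add: uclass_def)
qed

lemma uclass_rel:
  assumes "env M f" "env M g"
  shows "(uclass M f, uclass M g) \<in> Rel (upower M) \<longleftrightarrow> {i. (f i, g i) \<in> Rel M} \<in> nat_ultra"
proof
  assume "(uclass M f, uclass M g) \<in> Rel (upower M)"
  then obtain f' g' where *: "env M f'" "env M g'" "uclass M f = uclass M f'" "uclass M g = uclass M g'"
    "{i. (f' i, g' i) \<in> Rel M} \<in> nat_ultra" by (auto simp: upower_def)
  then have "{i. f i = f' i} \<inter> {i. g i = g' i} \<inter> {i. (f' i, g' i) \<in> Rel M} \<in> nat_ultra"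
    using uclass_eq[OF assms(1) *(1)] uclass_eq[OF assms(2) *(2)] by (simp add: ultra_simps(1)[OF nat_ultra(1)])
  then show "{i. (f i, g i) \<in> Rel M} \<in> nat_ultra"
    by (rule ultra_simps(5)[OF nat_ultra(1)]) auto
next
  assume "{i. (f i, g i) \<in> Rel M} \<in> nat_ultra"
  then show "(uclass M f, uclass M g) \<in> Rel (upower M)" using assms unfolding upower_def by simp blast
qed

text \<open>In the quantifier step, a counterexample is chosen at each index that has one; these choices
  together represent an element of the ultrapower.\<close>

lemma los:
  assumes "\<And>x. env M (r x)" "csts \<phi> = {}"
  shows "bsat (upower M) (\<lambda>x. uclass M (r x)) \<phi> \<longleftrightarrow> {i. bsat M (\<lambda>x. r x i) \<phi>} \<in> nat_ultra"
  using assms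
proof (induction \<phi> arbitrary: r)
  case Fls
  then show ?case using ultra_simps(4)[OF nat_ultra(1)] by simp
next
  case (Rl s t)
  then show ?case by (cases s; cases t) (auto simp: uclass_rel)
next
  case (Eq s t)
  then show ?case by (cases s; cases t) (auto simp: uclass_eq)
next
  case (Imp \<phi> \<psi>)
  then show ?case by (simp add: ultra_Collect[OF nat_ultra(1)])
next
  case (Forall x \<phi>)
  have upd: "(\<lambda>y. uclass M (r y))(x := uclass M f) = (\<lambda>y. uclass M ((r(x := f)) y))" for f by (simp add: fun_eq_iff)
  have upd': "(\<lambda>y. (r(x := f)) y i) = (\<lambda>y. r y i)(x := f i)" for f i by auto
  have "bsat (upower M) (\<lambda>x. uclass M (r x)) (Forall x \<phi>) \<longleftrightarrow>
      (\<forall>f. env M f \<longrightarrow> {i. bsat M ((\<lambda>y. r y i)(x := f i)) \<phi>} \<in> nat_ultra)"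
  proof -
    have "bsat (upower M) (\<lambda>y. uclass M ((r(x := f)) y)) \<phi> \<longleftrightarrow>
        {i. bsat M ((\<lambda>y. r y i)(x := f i)) \<phi>} \<in> nat_ultra" if "env M f" for f
      using Forall.IH[of "r(x := f)"] Forall.prems that by (simp only: upd') auto
    moreover have "bsat (upower M) (\<lambda>x. uclass M (r x)) (Forall x \<phi>) \<longleftrightarrow>
      (\<forall>f. env M f \<longrightarrow> bsat (upower M) (\<lambda>y. uclass M ((r(x := f)) y)) \<phi>)"
      by (auto simp: upower_def upd[symmetric] simp del: fun_upd_apply)
    ultimately show ?thesis by blast
  qed
  also have "\<dots> \<longleftrightarrow> {i. \<forall>a\<in>Univ M. bsat M ((\<lambda>y. r y i)(x := a)) \<phi>} \<in> nat_ultra" (is "?L \<longleftrightarrow> ?R")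
  proof
    assume R: ?R
    show ?L
    proof (intro allI impI)
      fix f assume "env M f"
      then show "{i. bsat M ((\<lambda>y. r y i)(x := f i)) \<phi>} \<in> nat_ultra"
        by (intro ultra_simps(5)[OF nat_ultra(1) R]) (auto simp: env_iff)
    qed
  next
    assume L: ?L
    have "\<exists>f. \<forall>i. f i \<in> Univ M \<and> (bsat M ((\<lambda>y. r y i)(x := f i)) \<phi> \<longrightarrow>
        (\<forall>a\<in>Univ M. bsat M ((\<lambda>y. r y i)(x := a)) \<phi>))"
    proof (rule choice, rule allI)
      fix i
      have "r x i \<in> Univ M" using Forall.prems by (simp add: env_iff)
      then show "\<exists>b. b \<in> Univ M \<and> (bsat M ((\<lambda>y. r y i)(x := b)) \<phi> \<longrightarrow>
        (\<forall>a\<in>Univ M. bsat M ((\<lambda>y. r y i)(x := a)) \<phi>))" by blast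
    qed
    then obtain f where f: "env M f" "\<And>i. bsat M ((\<lambda>y. r y i)(x := f i)) \<phi> \<Longrightarrow>
        \<forall>a\<in>Univ M. bsat M ((\<lambda>y. r y i)(x := a)) \<phi>" by (auto simp: env_iff)
    show ?R by (rule ultra_simps(5)[OF nat_ultra(1) L[rule_format, OF f(1)]]) (use f(2) in blast)
  qed
  finally show ?case by simp
qed

lemma env_upower:
  assumes "env (upower M) e"
  shows "\<exists>r. (\<forall>x. env M (r x)) \<and> e = (\<lambda>x. uclass M (r x))"
proof -
  have "e x \<in> uclass M ` {f. env M f}" for x using env_in[OF assms, of x] by (simp add: upower_def)
  then have "\<forall>x. \<exists>f. env M f \<and> e x = uclass M f" by (metis (no_types, lifting) imageE mem_Collect_eq)
  then show ?thesis by (metis ext)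
qed

lemma upower_Univ: "env M f \<Longrightarrow> uclass M f \<in> Univ (upower M)"
  by (auto simp: upower_def)

lemma is_bstr_upower: assumes "is_bstr M" shows "is_bstr (upower M)"
  using is_bstr_env[OF assms] upower_Univ[of M] by (auto simp: is_bstr_def upower_def)

lemma Th_upower:
  assumes "is_bstr M" shows "Th (upower M) = Th M"
proof -
  obtain d where d: "env M d" using is_bstr_env[OF assms] by blast
  have 1: "env (upower M) (\<lambda>x. uclass M (\<lambda>i. d x))"
    unfolding env_iff[of "upower M"] using d upower_Univ[of M] by (simp add: env_iff)
  have "\<phi> \<in> Th (upower M) \<longleftrightarrow> \<phi> \<in> Th M" if \<phi>: "\<phi> \<in> formulas {} 0" for \<phi>
  proof -
    have "bsat (upower M) (\<lambda>x. uclass M (\<lambda>i. d x)) \<phi> \<longleftrightarrow> bsat M d \<phi>"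
      using los[of M "\<lambda>x i. d x" \<phi>] d \<phi> ultra_simps(3,4)[OF nat_ultra(1)]
      by (cases "bsat M d \<phi>") (auto simp: env_iff formulas_def)
    then show ?thesis using Th_iff[OF assms \<phi> d] Th_iff[OF is_bstr_upower[OF assms] \<phi> 1] by simp
  qed
  then show ?thesis by (auto simp: Th_def)
qed

text \<open>The argument for \<open>\<aleph>\<^sub>1\<close>-saturation. Enumerate the formulas. At index \<open>i\<close>, pick an assignment that satisfies
  as long an initial segment of the enumeration as possible, but of length at most \<open>i\<close>. Each formula
  is then satisfied at almost all indices, by finite satisfiability and because the ultrafilter contains
  all cofinite sets.\<close>

theorem compact_upower:
  assumes "is_bstr M" shows "compact_str (upower M)"
  unfolding compact_str_def
proof (intro conjI allI impI is_bstr_upower[OF assms], elim conjE)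
  let ?W = "upower M"
  fix e V and \<Phi> :: "unit fm set"
  assume e: "env ?W e" and pure: "\<forall>\<phi>\<in>\<Phi>. csts \<phi> = {}" and
    fin: "\<forall>F. finite F \<and> F \<subseteq> \<Phi> \<longrightarrow> (\<exists>e'. env ?W e' \<and> agree V e e' \<and> (\<forall>\<phi>\<in>F. bsat ?W e' \<phi>))"
  obtain r where r: "\<And>x. env M (r x)" "e = (\<lambda>x. uclass M (r x))" using env_upower[OF e] by blast
  define P where "P m i d \<longleftrightarrow> env M d \<and> agree V (\<lambda>x. r x i) d \<and>
    (\<forall>j<m. from_nat j \<in> \<Phi> \<longrightarrow> bsat M d (from_nat j))" for m i d
  define D where "D m i \<longleftrightarrow> (\<exists>d. P m i d)" for m i
  have D0: "D 0 i" for i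
    unfolding D_def P_def by (rule exI[of _ "\<lambda>x. r x i"]) (use r in \<open>auto simp: agree_def env_iff\<close>)
  have DU: "{i. D m i} \<in> nat_ultra" for m
  proof -
    let ?F = "from_nat ` {..<m} \<inter> \<Phi>"
    obtain e' where e': "env ?W e'" "agree V e e'" "\<forall>\<phi>\<in>?F. bsat ?W e' \<phi>"
      using fin by (metis finite_Int finite_imageI finite_lessThan inf_le2)
    obtain s where s: "\<And>x. env M (s x)" "e' = (\<lambda>x. uclass M (s x))" using env_upower[OF e'(1)] by blast
    \<comment> \<open>The representatives of the variables held fixed must not change with the finite subset.\<close>
    define q where "q x = (if x \<in> V then s x else r x)" for x
    have q: "\<And>x. env M (q x)" "e' = (\<lambda>x. uclass M (q x))"
      using s r e'(2) by (auto simp: q_def agree_def fun_eq_iff)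
    have "{i. \<forall>\<phi>\<in>?F. bsat M (\<lambda>x. q x i) \<phi>} \<in> nat_ultra"
      using e'(3) los[OF q(1)] pure unfolding q(2)
      by (subst ultra_finite_ball[OF nat_ultra(1)]) auto
    moreover have "{i. \<forall>\<phi>\<in>?F. bsat M (\<lambda>x. q x i) \<phi>} \<subseteq> {i. D m i}"
    proof
      fix i assume "i \<in> {i. \<forall>\<phi>\<in>?F. bsat M (\<lambda>x. q x i) \<phi>}"
      then have "P m i (\<lambda>x. q x i)" using q(1) by (auto simp: P_def agree_def q_def env_iff)
      then show "i \<in> {i. D m i}" by (auto simp: D_def)
    qed
    ultimately show ?thesis by (rule ultra_simps(5)[OF nat_ultra(1)])
  qed
  define k where "k i = Max {m. m \<le> i \<and> D m i}" for i
  have k: "D (k i) i" "\<And>m. m \<le> i \<Longrightarrow> D m i \<Longrightarrow> m \<le> k i" for i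
  proof -
    have *: "finite {m. m \<le> i \<and> D m i}" "{m. m \<le> i \<and> D m i} \<noteq> {}" using D0 by auto
    show "D (k i) i" using Max_in[OF *] by (simp add: k_def)
    show "m \<le> k i" if "m \<le> i" "D m i" for m using Max_ge[OF *(1), of m] that by (simp add: k_def)
  qed
  obtain d where d: "\<And>i. P (k i) i (d i)" using k(1) unfolding D_def by metis
  define s where "s x i = d i x" for x i
  have s: "env M (s x)" for x using d by (auto simp: s_def P_def env_iff)
  have "bsat ?W (\<lambda>x. uclass M (s x)) \<phi>" if "\<phi> \<in> \<Phi>" for \<phi>
  proof -
    obtain j where j: "\<phi> = from_nat j" by (metis from_nat_to_nat)
    have "{i. D (Suc j) i} \<inter> {Suc j..} \<in> nat_ultra"
      using DU nat_ultra(2)[of "{Suc j..}"] ultra_simps(1)[OF nat_ultra(1)] by (simp add: Compl_atLeast)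
    moreover have "{i. D (Suc j) i} \<inter> {Suc j..} \<subseteq> {i. bsat M (\<lambda>x. s x i) \<phi>}"
    proof
      fix i assume "i \<in> {i. D (Suc j) i} \<inter> {Suc j..}"
      then have "j < k i" using k(2)[of "Suc j" i] by auto
      then show "i \<in> {i. bsat M (\<lambda>x. s x i) \<phi>}" using d[of i] that j by (auto simp: P_def s_def)
    qed
    ultimately have "{i. bsat M (\<lambda>x. s x i) \<phi>} \<in> nat_ultra" by (rule ultra_simps(5)[OF nat_ultra(1)])
    then show ?thesis using los[OF s, of \<phi>] pure that by simp
  qed
  moreover have "env ?W (\<lambda>x. uclass M (s x))" using s upower_Univ by (auto simp: env_iff[of ?W])
  moreover have "agree V e (\<lambda>x. uclass M (s x))" unfolding agree_def
  proof (intro allI impI)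
    fix x assume "x \<notin> V"
    then have "s x = r x" using d by (auto simp: s_def P_def agree_def)
    then show "uclass M (s x) = e x" using r by simp
  qed
  ultimately show "\<exists>e'. env ?W e' \<and> agree V e e' \<and> (\<forall>\<phi>\<in>\<Phi>. bsat ?W e' \<phi>)" by blast
qed

lemma compactD:
  assumes "compact_str W" "env W e" "\<And>\<phi>. \<phi> \<in> \<Phi> \<Longrightarrow> csts \<phi> = {}"
    "\<And>F. finite F \<Longrightarrow> F \<subseteq> \<Phi> \<Longrightarrow> \<exists>e'. env W e' \<and> agree V e e' \<and> (\<forall>\<phi>\<in>F. bsat W e' \<phi>)"
  shows "\<exists>e'. env W e' \<and> agree V e e' \<and> (\<forall>\<phi>\<in>\<Phi>. bsat W e' \<phi>)"
  using assms(1)[unfolded compact_str_def, THEN conjunct2, rule_format, of e \<Phi> V] assms(2-4) by blast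

lemma compact_realizes:
  assumes "compact_str W" "p \<in> types {} (Th W) n"
  shows "\<exists>e. env W e \<and> p = tp n W e"
proof -
  have W: "is_bstr W" using assms by (simp add: compact_str_def)
  have p: "p \<subseteq> formulas {} n" "\<And>\<Psi>. finite \<Psi> \<Longrightarrow> \<Psi> \<subseteq> p \<Longrightarrow> \<exists>e. env W e \<and> (\<forall>\<psi>\<in>\<Psi>. bsat W e \<psi>)"
    "\<And>\<phi>. \<phi> \<in> formulas {} n \<Longrightarrow> \<phi> \<in> p \<or> Neg \<phi> \<in> p"
    using assms(2) types_iff[OF W] by blast+
  obtain d where d: "env W d" using is_bstr_env[OF W] by blast
  have "\<exists>e'. env W e' \<and> agree UNIV d e' \<and> (\<forall>\<phi>\<in>p. bsat W e' \<phi>)"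
    by (rule compactD[OF assms(1) d]) (use p in \<open>auto simp: agree_def formulas_def\<close>)
  then obtain e where e: "env W e" "\<And>\<phi>. \<phi> \<in> p \<Longrightarrow> bsat W e \<phi>" by blast
  have "\<phi> \<in> p" if "\<phi> \<in> tp n W e" for \<phi> using p(3)[of \<phi>] e(2)[of "Neg \<phi>"] that by (auto simp: tp_def)
  then have "p = tp n W e" using e(2) p(1) by (auto simp: tp_def)
  then show ?thesis using e by blast
qed

section \<open>Finite structures are determined by their theory\<close>

text \<open>Enumerate the universe; the atomic diagram of the enumeration together with the statement that
  it is exhaustive is a formula in finitely many variables.\<close>

lemma finite_Th_iso:
  fixes M :: "'a bstr" and N :: "'b bstr"
  assumes "is_bstr M" "is_bstr N" "Th M = Th N" "finite (Univ M)"
  shows "M \<simeq> N"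
proof -
  obtain k f where f: "bij_betw f {0..<k :: nat} (Univ M)" using ex_bij_betw_nat_finite[OF assms(4)] by blast
  obtain d where d: "env M d" using is_bstr_env[OF assms(1)] by blast
  define e where "e x = (if x < k then f x else d x)" for x
  have e: "env M e" using f d by (auto simp: e_def env_iff bij_betw_def)
  define dg where "dg \<phi> = (if bsat M e \<phi> then \<phi> else Neg \<phi>)" for \<phi> :: "unit fm"
  define L where "L = concat (map (\<lambda>i. concat (map (\<lambda>j. [dg (Rl (Var i) (Var j)), dg (Eq (Var i) (Var j))]) [0..<k])) [0..<k])"
  define \<delta> where "\<delta> = And (Conj L) (Forall k (Disj (map (\<lambda>i. Eq (Var k) (Var i)) [0..<k])))"
  have "dg \<phi> \<in> formulas {} k" if "\<phi> \<in> formulas {} k" for \<phi>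
    using that by (simp add: dg_def)
  then have "\<forall>\<phi>\<in>set L. \<phi> \<in> formulas {} k" by (auto simp: L_def formulas_def)
  then have \<delta>: "\<delta> \<in> formulas {} k" unfolding \<delta>_def by (auto simp: formulas_def)
  have "\<exists>i\<in>{0..<k}. a = e i" if "a \<in> Univ M" for a
    using f that by (auto simp: bij_betw_def e_def image_iff)
  moreover have "\<forall>\<phi>\<in>set L. bsat M e \<phi>" by (auto simp: L_def dg_def)
  ultimately have "bsat M e \<delta>" by (simp add: \<delta>_def)
  then obtain e' where e': "env N e'" "bsat N e' \<delta>"
    using Th_eq_ex[OF assms(1-3) \<delta>, THEN iffD1] e by blast
  have dg: "bsat M e \<phi> \<longleftrightarrow> bsat N e' \<phi>" if "bsat N e' (dg \<phi>)" for \<phi>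
    using that by (auto simp: dg_def split: if_splits)
  have L: "\<forall>i<k. \<forall>j<k. bsat N e' (dg (Rl (Var i) (Var j))) \<and> bsat N e' (dg (Eq (Var i) (Var j)))"
    using e'(2) by (auto simp: \<delta>_def L_def)
  have R: "(f i, f j) \<in> Rel M \<longleftrightarrow> (e' i, e' j) \<in> Rel N" and E: "f i = f j \<longleftrightarrow> e' i = e' j"
    if "i < k" "j < k" for i j
    using dg[of "Rl (Var i) (Var j)"] dg[of "Eq (Var i) (Var j)"] L that by (auto simp: e_def)
  have S: "\<exists>i<k. b = e' i" if "b \<in> Univ N" for b
    using e'(2) that by (simp add: \<delta>_def) (metis atLeastLessThan_iff)
  define h where "h x = e' (inv_into {0..<k} f x)" for x
  have h: "h (f i) = e' i" if "i < k" for i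
    using f that by (simp add: h_def bij_betw_def)
  have M: "Univ M = f ` {0..<k}" using f by (simp add: bij_betw_def)
  have "inj_on h (Univ M)" unfolding M by (auto simp: inj_on_def h E)
  moreover have "h ` Univ M = Univ N"
  proof
    show "h ` Univ M \<subseteq> Univ N" unfolding M using e'(1) by (auto simp: h env_iff)
    show "Univ N \<subseteq> h ` Univ M"
    proof
      fix b assume "b \<in> Univ N"
      then obtain i where "i < k" "b = h (f i)" using S h by metis
      then show "b \<in> h ` Univ M" unfolding M by auto
    qed
  qed
  moreover have "\<forall>x\<in>Univ M. \<forall>y\<in>Univ M. (x, y) \<in> Rel M \<longleftrightarrow> (h x, h y) \<in> Rel N"
    unfolding M by (auto simp: h R)
  ultimately have "iso_map h M N" by (simp add: iso_map_def bij_betw_def)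
  then show ?thesis by (auto simp: iso_iff)
qed

section \<open>Elementary substructures and Skolem hulls\<close>

definition sub :: "'a bstr \<Rightarrow> 'a set \<Rightarrow> 'a bstr" where
  "sub M N = \<lparr>Univ = N, Rel = Rel M \<inter> (N \<times> N)\<rparr>"

lemma Univ_sub [simp]: "Univ (sub M N) = N" by (simp add: sub_def)

lemma elem_sub_bsat: "elem_sub E M \<Longrightarrow> env E e \<Longrightarrow> csts \<phi> = {} \<Longrightarrow> bsat E e \<phi> \<longleftrightarrow> bsat M e \<phi>"
  by (auto simp: elem_sub_def env_def)

lemma elem_sub_env: "elem_sub E M \<Longrightarrow> env E e \<Longrightarrow> env M e"
  by (auto simp: elem_sub_def env_def)

lemma elem_sub_bstr: "elem_sub E M \<Longrightarrow> is_bstr E"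
  by (auto simp: elem_sub_def)

lemma elem_sub_tp: "elem_sub E M \<Longrightarrow> env E e \<Longrightarrow> tp n E e = tp n M e"
  using elem_sub_bsat[of E M e] by (auto simp: tp_def formulas_def)

lemma elem_sub_Th:
  assumes "elem_sub E M" "is_bstr M" shows "Th E = Th M"
proof -
  obtain e where e: "env E e" using is_bstr_env[OF elem_sub_bstr[OF assms(1)]] by blast
  show ?thesis
    using elem_sub_tp[OF assms(1) e, of 0] tp_0[OF elem_sub_bstr[OF assms(1)] e]
      tp_0[OF assms(2) elem_sub_env[OF assms(1) e]] by simp
qed

lemma tarski_vaught:
  assumes M: "is_bstr M" and N: "N \<subseteq> Univ M" "N \<noteq> {}"
    and w: "\<And>\<phi> x e b. csts \<phi> = {} \<Longrightarrow> range e \<subseteq> N \<Longrightarrow> b \<in> Univ M \<Longrightarrow> bsat M (e(x := b)) \<phi> \<Longrightarrow>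
      \<exists>b\<in>N. bsat M (e(x := b)) \<phi>"
  shows "elem_sub (sub M N) M"
proof -
  have "bsat (sub M N) e \<phi> \<longleftrightarrow> bsat M e \<phi>" if "csts \<phi> = {}" "range e \<subseteq> N" for e \<phi>
    using that
  proof (induction \<phi> arbitrary: e)
    case (Rl s t)
    then show ?case by (cases s; cases t) (auto simp: sub_def)
  next
    case (Eq s t)
    then show ?case by (cases s; cases t) auto
  next
    case (Forall x \<phi>)
    have "bsat (sub M N) (e(x := b)) \<phi> \<longleftrightarrow> bsat M (e(x := b)) \<phi>" if "b \<in> N" for b
      by (rule Forall.IH) (use Forall.prems that in auto)
    moreover have "(\<forall>b\<in>N. bsat M (e(x := b)) \<phi>) \<longleftrightarrow> (\<forall>b\<in>Univ M. bsat M (e(x := b)) \<phi>)"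
    proof -
      have "\<exists>b\<in>N. \<not> bsat M (e(x := b)) \<phi>" if "b \<in> Univ M" "\<not> bsat M (e(x := b)) \<phi>" for b
        using w[of "Neg \<phi>" e b x] Forall.prems that by simp
      then show ?thesis using N by blast
    qed
    ultimately show ?case by simp
  qed simp_all
  then show ?thesis using N by (auto simp: elem_sub_def is_bstr_def sub_def)
qed

text \<open>Close \<open>A\<close> under chosen solutions of countably many systems of formulas in one unknown. The
  systems \<open>{\<phi>}\<close> make the closure an elementary submodel; further systems, for example complete types,
  can be put into \<open>FF\<close>.\<close>

lemma skolem_hull:
  assumes M: "is_bstr M" and F: "countable FF" "\<And>\<Phi>. \<Phi> \<in> FF \<Longrightarrow> \<exists>n. \<Phi> \<subseteq> formulas {} n"
    and A: "countable A" "A \<subseteq> Univ M"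
  shows "\<exists>N. A \<subseteq> N \<and> countable N \<and> elem_sub (sub M N) M \<and>
    (\<forall>\<Phi>\<in>FF. \<forall>x e b. range e \<subseteq> N \<and> b \<in> Univ M \<and> (\<forall>\<phi>\<in>\<Phi>. bsat M (e(x := b)) \<phi>) \<longrightarrow>
       (\<exists>b\<in>N. \<forall>\<phi>\<in>\<Phi>. bsat M (e(x := b)) \<phi>))"
proof -
  obtain d where d: "d \<in> Univ M" using M by (auto simp: is_bstr_def)
  define GG where "GG = FF \<union> (\<lambda>\<phi>. {\<phi>}) ` {\<phi> :: unit fm. csts \<phi> = {}}"
  have GG: "\<exists>n. \<Phi> \<subseteq> formulas {} n" if "\<Phi> \<in> GG" for \<Phi>
  proof (cases "\<Phi> \<in> FF")
    case False
    then obtain \<phi> where "\<Phi> = {\<phi>}" "csts \<phi> = {}" using \<open>\<Phi> \<in> GG\<close> by (auto simp: GG_def)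
    then show ?thesis using formulas_exists[of \<phi> "{}"] by auto
  qed (use F(2) in blast)
  have cGG: "countable GG" using F(1) by (auto simp: GG_def)
  define el where "el xs i = (if i < length xs then xs ! i else d)" for xs :: "'a list" and i
  define good where "good \<Phi> x xs b \<longleftrightarrow> b \<in> Univ M \<and> (\<forall>\<phi>\<in>\<Phi>. bsat M ((el xs)(x := b)) \<phi>)" for \<Phi> x xs b
  define c where "c \<Phi> x xs = (if \<exists>b. good \<Phi> x xs b then SOME b. good \<Phi> x xs b else d)" for \<Phi> x xs
  have c: "c \<Phi> x xs \<in> Univ M" "good \<Phi> x xs b \<Longrightarrow> good \<Phi> x xs (c \<Phi> x xs)" for \<Phi> x xs b
  proof -
    show *: "good \<Phi> x xs b \<Longrightarrow> good \<Phi> x xs (c \<Phi> x xs)" for b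
      using someI[of "good \<Phi> x xs" b] by (auto simp: c_def)
    show "c \<Phi> x xs \<in> Univ M"
    proof (cases "\<exists>b. good \<Phi> x xs b")
      case True
      then have "good \<Phi> x xs (c \<Phi> x xs)" using * by blast
      then show ?thesis by (simp add: good_def)
    qed (simp add: c_def d)
  qed
  define S where "S = rec_nat (insert d A) (\<lambda>_ S. S \<union> (\<lambda>(\<Phi>, x, xs). c \<Phi> x xs) ` (GG \<times> UNIV \<times> lists S))"
  have S0: "S 0 = insert d A" and SS: "S (Suc n) = S n \<union> (\<lambda>(\<Phi>, x, xs). c \<Phi> x xs) ` (GG \<times> UNIV \<times> lists (S n))" for n
    by (auto simp: S_def)
  have Sc: "countable (S n)" for n
    by (induction n) (auto simp: S0 SS A cGG intro!: countable_SIGMA countable_lists)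
  have SM: "S n \<subseteq> Univ M" for n
    by (induction n) (use A d c in \<open>auto simp: S0 SS\<close>)
  have Smono: "m \<le> n \<Longrightarrow> S m \<subseteq> S n" for m n
    by (rule lift_Suc_mono_le[of S]) (auto simp: SS)
  define N where "N = (\<Union>n. S n)"
  have fin: "\<exists>n. set xs \<subseteq> S n" if "set xs \<subseteq> N" for xs
    using that
  proof (induction xs)
    case (Cons x xs)
    then obtain n m where "set xs \<subseteq> S n" "x \<in> S m" by (auto simp: N_def)
    then have "set (x # xs) \<subseteq> S (max n m)" using Smono[of n "max n m"] Smono[of m "max n m"] by auto
    then show ?case by blast
  qed simp
  have closed: "\<exists>b\<in>N. \<forall>\<phi>\<in>\<Phi>. bsat M (e(x := b)) \<phi>"
    if h: "\<Phi> \<in> GG" "range e \<subseteq> N" "b \<in> Univ M" "\<forall>\<phi>\<in>\<Phi>. bsat M (e(x := b)) \<phi>" for \<Phi> x e b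
  proof -
    obtain n where n: "\<Phi> \<subseteq> formulas {} n" using GG[OF h(1)] by blast
    let ?xs = "map e [0..<n]"
    have "set ?xs \<subseteq> N" using h(2) by auto
    then obtain l where l: "set ?xs \<subseteq> S l" using fin[of ?xs] by blast
    have eq: "bsat M ((el ?xs)(x := b)) \<phi> \<longleftrightarrow> bsat M (e(x := b)) \<phi>" if "\<phi> \<in> \<Phi>" for b \<phi>
      by (rule bsat_formulas_cong[of _ "{}" n]) (use n that in \<open>auto simp: el_def\<close>)
    have "good \<Phi> x ?xs b" using h(3,4) eq by (simp add: good_def)
    then have g: "good \<Phi> x ?xs (c \<Phi> x ?xs)" by (rule c(2))
    have "(\<Phi>, x, ?xs) \<in> GG \<times> UNIV \<times> lists (S l)" using l h(1) by auto
    then have "c \<Phi> x ?xs \<in> S (Suc l)" unfolding SS by (intro UnI2 image_eqI[of _ _ "(\<Phi>, x, ?xs)"]) auto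
    then have "c \<Phi> x ?xs \<in> N" by (auto simp: N_def)
    then show ?thesis using g eq unfolding good_def by blast
  qed
  have "elem_sub (sub M N) M"
  proof (rule tarski_vaught[OF M])
    show "N \<subseteq> Univ M" using SM by (auto simp: N_def)
    show "N \<noteq> {}" using S0 by (auto simp: N_def)
    fix \<phi> :: "unit fm" and x e b
    assume "csts \<phi> = {}" "range e \<subseteq> N" "b \<in> Univ M" "bsat M (e(x := b)) \<phi>"
    moreover from this have "{\<phi>} \<in> GG" by (auto simp: GG_def)
    ultimately show "\<exists>b\<in>N. bsat M (e(x := b)) \<phi>" using closed[of "{\<phi>}" e b x] by auto
  qed
  moreover have "A \<subseteq> N" using S0 by (auto simp: N_def)
  moreover have "countable N" using Sc by (auto simp: N_def)
  moreover have "\<forall>\<Phi>\<in>FF. \<forall>x e b. range e \<subseteq> N \<and> b \<in> Univ M \<and> (\<forall>\<phi>\<in>\<Phi>. bsat M (e(x := b)) \<phi>) \<longrightarrow>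
       (\<exists>b\<in>N. \<forall>\<phi>\<in>\<Phi>. bsat M (e(x := b)) \<phi>)"
  proof (intro ballI allI impI, elim conjE)
    fix \<Phi> x e b assume "\<Phi> \<in> FF" "range e \<subseteq> N" "b \<in> Univ M" "\<forall>\<phi>\<in>\<Phi>. bsat M (e(x := b)) \<phi>"
    then show "\<exists>b\<in>N. \<forall>\<phi>\<in>\<Phi>. bsat M (e(x := b)) \<phi>" by (intro closed) (simp_all add: GG_def)
  qed
  ultimately show ?thesis by (intro exI[of _ N] conjI)
qed

lemma lowenheim_skolem:
  assumes "is_bstr M" "countable A" "A \<subseteq> Univ M"
  shows "\<exists>N. A \<subseteq> N \<and> countable N \<and> elem_sub (sub M N) M"
  using skolem_hull[of M "{}" A] assms by auto

lemma countable_nat_model: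
  assumes "is_bstr M"
  shows "\<exists>N :: nat bstr. is_bstr N \<and> Th N = Th M"
proof -
  obtain N where N: "countable N" "elem_sub (sub M N) M"
    using lowenheim_skolem[OF assms, of "{}"] by auto
  obtain K :: "nat bstr" where "is_bstr K" "sub M N \<simeq> K"
    using countable_copy[OF elem_sub_bstr[OF N(2)]] N(1) by auto
  then show ?thesis
    using iso_Th[OF _ elem_sub_bstr[OF N(2)]] elem_sub_Th[OF N(2) assms] by metis
qed

section \<open>Countably saturated structures\<close>

text \<open>A reformulation of \<open>\<omega>\<close>-saturation in which variables take the place of constants.\<close>

definition omega_sat :: "'a bstr \<Rightarrow> bool" where
  "omega_sat N \<longleftrightarrow> is_bstr N \<and> (\<forall>n e \<Phi>. env N e \<and> \<Phi> \<subseteq> formulas {} (Suc n) \<and>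
     (\<forall>F. finite F \<and> F \<subseteq> \<Phi> \<longrightarrow> (\<exists>b\<in>Univ N. \<forall>\<phi>\<in>F. bsat N (e(n := b)) \<phi>)) \<longrightarrow>
     (\<exists>b\<in>Univ N. \<forall>\<phi>\<in>\<Phi>. bsat N (e(n := b)) \<phi>))"

lemma omega_satD:
  assumes "omega_sat N" "env N e" "\<Phi> \<subseteq> formulas {} (Suc n)"
    "\<And>F. finite F \<Longrightarrow> F \<subseteq> \<Phi> \<Longrightarrow> \<exists>b\<in>Univ N. \<forall>\<phi>\<in>F. bsat N (e(n := b)) \<phi>"
  shows "\<exists>b\<in>Univ N. \<forall>\<phi>\<in>\<Phi>. bsat N (e(n := b)) \<phi>"
  using assms(1)[unfolded omega_sat_def, THEN conjunct2, rule_format, of e \<Phi> n] assms(2-4) by blast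

lemma omega_sat_iso:
  assumes "M \<simeq> N" "is_bstr N" "omega_sat M" shows "omega_sat N"
  unfolding omega_sat_def
proof (intro conjI allI impI assms(2), elim conjE)
  obtain f where f: "iso_map f N M" using iso_sym[OF assms(1)] iso_iff by blast
  fix n e \<Phi> assume e: "env N e" and \<Phi>: "\<Phi> \<subseteq> formulas {} (Suc n)"
    and fin: "\<forall>F. finite F \<and> F \<subseteq> \<Phi> \<longrightarrow> (\<exists>b\<in>Univ N. \<forall>\<phi>\<in>F. bsat N (e(n := b)) \<phi>)"
  have eq: "bsat N (e(n := b)) \<phi> \<longleftrightarrow> bsat M ((\<lambda>x. f (e x))(n := f b)) \<phi>" if "\<phi> \<in> \<Phi>" "b \<in> Univ N" for \<phi> b
  proof -
    have "(\<lambda>x. f (e x))(n := f b) = (\<lambda>x. f ((e(n := b)) x))" by (simp add: fun_eq_iff)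
    then show ?thesis using iso_bsat[OF f _ env_upd[OF e that(2)]] \<Phi> that(1) by (auto simp: formulas_def)
  qed
  have "\<exists>b\<in>Univ M. \<forall>\<phi>\<in>\<Phi>. bsat M ((\<lambda>x. f (e x))(n := b)) \<phi>"
  proof (rule omega_satD[OF assms(3) iso_map_env[OF f e] \<Phi>])
    fix F assume F: "finite F" "F \<subseteq> \<Phi>"
    then obtain b where "b \<in> Univ N" "\<forall>\<phi>\<in>F. bsat N (e(n := b)) \<phi>" using fin by blast
    then show "\<exists>b\<in>Univ M. \<forall>\<phi>\<in>F. bsat M ((\<lambda>x. f (e x))(n := b)) \<phi>"
      using eq F iso_map_in[OF f] by (intro bexI[of _ "f b"]) auto
  qed
  then obtain c where c: "c \<in> Univ M" "\<forall>\<phi>\<in>\<Phi>. bsat M ((\<lambda>x. f (e x))(n := c)) \<phi>" by blast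
  then have "c \<in> f ` Univ N" using f by (simp add: iso_map_def bij_betw_def)
  then obtain b where "b \<in> Univ N" "c = f b" by blast
  then show "\<exists>b\<in>Univ N. \<forall>\<phi>\<in>\<Phi>. bsat N (e(n := b)) \<phi>" using c(2) eq by blast
qed

text \<open>The finitely many constants are numbered and become variables; the unknown becomes the next
  variable.\<close>

lemma omega_sat_saturated:
  assumes "omega_sat N" shows "saturated natLeq N"
  unfolding saturated_def
proof (intro allI impI ballI)
  have N: "is_bstr N" using assms by (simp add: omega_sat_def)
  fix A p assume A: "A \<subseteq> Univ N" "|A| <o natLeq" and p: "p \<in> types A (Th_exp A N) 1"
  then have "finite A" by (simp add: finite_iff_ordLess_natLeq)
  then obtain as where as: "set as = A" using finite_list by blast
  let ?k = "length as"
  obtain d where d: "d \<in> Univ N" using N by (auto simp: is_bstr_def)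
  define e where "e i = (if i < ?k then as ! i else d)" for i
  have e: "env N e" using A as d by (auto simp: e_def env_iff)
  define idx where "idx a = (SOME i. i < ?k \<and> as ! i = a)" for a
  have idx: "idx a < ?k" "as ! idx a = a" if "a \<in> A" for a
    using someI_ex[of "\<lambda>i. i < ?k \<and> as ! i = a"] that unfolding idx_def as[symmetric] in_set_conv_nth by auto
  define tr where "tr \<phi> = (sbst (\<lambda>a. Var (idx a)) \<phi> (\<lambda>_. Var ?k) :: unit fm)" for \<phi>
  have p1: "p \<subseteq> formulas A 1"
    "\<And>\<Psi>. finite \<Psi> \<Longrightarrow> \<Psi> \<subseteq> p \<Longrightarrow> \<exists>a\<in>Univ N. \<forall>\<psi>\<in>\<Psi>. sat N (\<lambda>c. c) (\<lambda>_. a) \<psi>"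
    using p types_exp_iff[OF N A(1)] by auto
  have tr: "bsat N (e(?k := b)) (tr \<phi>) \<longleftrightarrow> sat N (\<lambda>c. c) (\<lambda>_. b) \<phi>" if "\<phi> \<in> formulas A 1" for \<phi> b
    unfolding bsat_def tr_def sat_sbst
    by (rule sat_cong) (use that idx in \<open>auto simp: formulas_def e_def subset_iff less_imp_neq\<close>)
  have "\<exists>b\<in>Univ N. \<forall>\<phi>\<in>tr ` p. bsat N (e(?k := b)) \<phi>"
  proof (rule omega_satD[OF assms e])
    show "tr ` p \<subseteq> formulas {} (Suc ?k)"
    proof clarify
      fix \<phi> assume "\<phi> \<in> p"
      then have "csts \<phi> \<subseteq> A" using p1 by (auto simp: formulas_def)
      then have "idx c < Suc ?k" if "c \<in> csts \<phi>" for c using idx(1) that by (meson less_SucI subsetD)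
      moreover have "fv (tr \<phi>) \<subseteq> insert ?k (idx ` csts \<phi>)"
        unfolding tr_def by (rule subset_trans[OF fv_sbst]) auto
      moreover have "csts (tr \<phi>) \<subseteq> {}"
        unfolding tr_def by (rule subset_trans[OF csts_sbst]) auto
      ultimately show "tr \<phi> \<in> formulas {} (Suc ?k)" unfolding formulas_def by blast
    qed
    fix F assume F: "finite F" "F \<subseteq> tr ` p"
    then obtain \<Psi> where \<Psi>: "finite \<Psi>" "\<Psi> \<subseteq> p" "F = tr ` \<Psi>" by (metis finite_subset_image)
    obtain b where "b \<in> Univ N" "\<forall>\<psi>\<in>\<Psi>. sat N (\<lambda>c. c) (\<lambda>_. b) \<psi>" using p1(2)[OF \<Psi>(1,2)] by blast
    then show "\<exists>b\<in>Univ N. \<forall>\<phi>\<in>F. bsat N (e(?k := b)) \<phi>"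
      using tr p1(1) \<Psi>(2,3) by (intro bexI[of _ b]) auto
  qed
  then obtain b where b: "b \<in> Univ N" "\<forall>\<phi>\<in>p. bsat N (e(?k := b)) (tr \<phi>)" by blast
  then have "\<forall>\<phi>\<in>p. sat N (\<lambda>c. c) (\<lambda>_. b) \<phi>" using tr p1(1) by blast
  then show "\<exists>a\<in>Univ N. \<forall>\<phi>\<in>p. sat N (\<lambda>c. c) (\<lambda>_. a) \<phi>" using b(1) by blast
qed

text \<open>A small theory has only countably many types, so a countable hull can realise all of them over all
  finite tuples of the hull.\<close>

lemma saturated_submodel:
  assumes W: "compact_str W" and sm: "small_theory (Th W)" and A: "countable A" "A \<subseteq> Univ W"
  shows "\<exists>N. A \<subseteq> N \<and> countable N \<and> elem_sub (sub W N) W \<and> omega_sat (sub W N)"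
proof -
  have bW: "is_bstr W" using W by (simp add: compact_str_def)
  have "\<exists>N. A \<subseteq> N \<and> countable N \<and> elem_sub (sub W N) W \<and>
    (\<forall>\<Phi>\<in>(\<Union>n. types {} (Th W) n). \<forall>x e b. range e \<subseteq> N \<and> b \<in> Univ W \<and> (\<forall>\<phi>\<in>\<Phi>. bsat W (e(x := b)) \<phi>) \<longrightarrow>
       (\<exists>b\<in>N. \<forall>\<phi>\<in>\<Phi>. bsat W (e(x := b)) \<phi>))"
  proof (rule skolem_hull[OF bW _ _ A])
    show "countable (\<Union>n. types {} (Th W) n)" using sm by (simp add: small_theory_def)
    show "\<exists>n. \<Phi> \<subseteq> formulas {} n" if "\<Phi> \<in> (\<Union>n. types {} (Th W) n)" for \<Phi>
      using that unfolding types_def by blast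
  qed
  then obtain N where N: "A \<subseteq> N" "countable N" "elem_sub (sub W N) W" and
    cl0: "\<forall>\<Phi>\<in>(\<Union>n. types {} (Th W) n). \<forall>x e b. range e \<subseteq> N \<and> b \<in> Univ W \<and> (\<forall>\<phi>\<in>\<Phi>. bsat W (e(x := b)) \<phi>) \<longrightarrow>
       (\<exists>b\<in>N. \<forall>\<phi>\<in>\<Phi>. bsat W (e(x := b)) \<phi>)"
    by (elim exE conjE) (rule that)
  have cl: "\<And>\<Phi> n x e b. \<Phi> \<in> types {} (Th W) n \<Longrightarrow> range e \<subseteq> N \<Longrightarrow> b \<in> Univ W \<Longrightarrow>
      \<forall>\<phi>\<in>\<Phi>. bsat W (e(x := b)) \<phi> \<Longrightarrow> \<exists>b\<in>N. \<forall>\<phi>\<in>\<Phi>. bsat W (e(x := b)) \<phi>"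
    by (rule cl0[rule_format]) auto
  have "omega_sat (sub W N)" unfolding omega_sat_def
  proof (intro conjI allI impI elem_sub_bstr[OF N(3)], elim conjE)
    fix n e \<Phi> assume e: "env (sub W N) e" and \<Phi>: "\<Phi> \<subseteq> formulas {} (Suc n)"
      and fin: "\<forall>F. finite F \<and> F \<subseteq> \<Phi> \<longrightarrow> (\<exists>b\<in>Univ (sub W N). \<forall>\<phi>\<in>F. bsat (sub W N) (e(n := b)) \<phi>)"
    have eW: "env W e" by (rule elem_sub_env[OF N(3) e])
    have eq: "bsat (sub W N) (e(n := b)) \<phi> \<longleftrightarrow> bsat W (e(n := b)) \<phi>" if "\<phi> \<in> \<Phi>" "b \<in> N" for \<phi> b
      by (rule elem_sub_bsat[OF N(3)]) (use e \<Phi> that in \<open>auto simp: formulas_def\<close>)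
    have "\<exists>e'. env W e' \<and> agree {n} e e' \<and> (\<forall>\<phi>\<in>\<Phi>. bsat W e' \<phi>)"
    proof (rule compactD[OF W eW])
      show "\<phi> \<in> \<Phi> \<Longrightarrow> csts \<phi> = {}" for \<phi> using \<Phi> by (auto simp: formulas_def)
      fix F assume F: "finite F" "F \<subseteq> \<Phi>"
      then obtain b where b: "b \<in> N" "\<forall>\<phi>\<in>F. bsat (sub W N) (e(n := b)) \<phi>" using fin by auto
      then have "env W (e(n := b))" using elem_sub_env[OF N(3)] e by (metis Univ_sub env_upd)
      moreover have "agree {n} e (e(n := b))" by (simp add: agree_def)
      moreover have "\<forall>\<phi>\<in>F. bsat W (e(n := b)) \<phi>" using b eq F by blast
      ultimately show "\<exists>e'. env W e' \<and> agree {n} e e' \<and> (\<forall>\<phi>\<in>F. bsat W e' \<phi>)" by blast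
    qed
    then obtain e' where e': "env W e'" "agree {n} e e'" "\<forall>\<phi>\<in>\<Phi>. bsat W e' \<phi>" by blast
    have e'eq: "e' = e(n := e' n)" using e'(2) by (auto simp: agree_def fun_eq_iff)
    have "\<exists>b\<in>N. \<forall>\<phi>\<in>tp (Suc n) W e'. bsat W (e(n := b)) \<phi>"
    proof (rule cl[OF tp_in_types[OF bW bW refl e'(1)]])
      show "range e \<subseteq> N" using e by (simp add: env_def)
      show "e' n \<in> Univ W" using e' by (simp add: env_iff)
      show "\<forall>\<phi>\<in>tp (Suc n) W e'. bsat W (e(n := e' n)) \<phi>"
        unfolding e'eq[symmetric] by (simp add: tp_def)
    qed
    then obtain b where b: "b \<in> N" "\<forall>\<phi>\<in>tp (Suc n) W e'. bsat W (e(n := b)) \<phi>" by blast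
    then have "\<forall>\<phi>\<in>\<Phi>. bsat (sub W N) (e(n := b)) \<phi>" using e'(3) \<Phi> eq by (auto simp: tp_def)
    then show "\<exists>b\<in>Univ (sub W N). \<forall>\<phi>\<in>\<Phi>. bsat (sub W N) (e(n := b)) \<phi>" using b by auto
  qed
  then show ?thesis using N by blast
qed

text \<open>The entries are realised one after the other, the type over the earlier ones being finitely
  satisfiable because existential formulas transfer.\<close>

lemma omega_sat_realize:
  assumes el: "elem_sub N W" and ws: "omega_sat N" and e: "env W e" "\<And>i. i < k \<Longrightarrow> e i \<in> Univ N" and km: "k \<le> m"
  shows "\<exists>e'. env N e' \<and> (\<forall>i<k. e' i = e i) \<and> tp m W e' = tp m W e"
  using km
proof (induction m rule: dec_induct)
  case base
  obtain d where d: "env N d" using is_bstr_env[OF elem_sub_bstr[OF el]] by blast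
  let ?e = "\<lambda>i. if i < k then e i else d i"
  have "env N ?e" using d e by (auto simp: env_iff)
  moreover have "tp k W ?e = tp k W e" by (rule tp_cong) simp
  ultimately show ?case by (intro exI[of _ ?e]) auto
next
  case (step m)
  then obtain e' where e': "env N e'" "\<forall>i<k. e' i = e i" "tp m W e' = tp m W e" by blast
  let ?\<Phi> = "tp (Suc m) W e"
  have "\<exists>b\<in>Univ N. \<forall>\<phi>\<in>?\<Phi>. bsat N (e'(m := b)) \<phi>"
  proof (rule omega_satD[OF ws e'(1)])
    show "?\<Phi> \<subseteq> formulas {} (Suc m)" by (auto simp: tp_def)
    fix F assume F: "finite F" "F \<subseteq> ?\<Phi>"
    obtain L where L: "set L = F" using finite_list[OF F(1)] by blast
    let ?\<psi> = "Ex m (Conj L)"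
    have 1: "?\<psi> \<in> formulas {} m" by (rule formulas_Ex) (use L F in \<open>auto simp: tp_def\<close>)
    have "bsat W (e(m := e m)) (Conj L)" using L F by (auto simp: tp_def)
    then have "bsat W e ?\<psi>" using e(1) by (auto simp: env_iff simp del: fun_upd_triv)
    then have "bsat N e' ?\<psi>"
      using tp_eqD[OF e'(3) 1] elem_sub_tp[OF el e'(1), of m] tp_eqD[OF _ 1] by blast
    then show "\<exists>b\<in>Univ N. \<forall>\<phi>\<in>F. bsat N (e'(m := b)) \<phi>" using L by simp
  qed
  then obtain b where b: "b \<in> Univ N" "\<forall>\<phi>\<in>?\<Phi>. bsat N (e'(m := b)) \<phi>" by blast
  have "tp (Suc m) W e = tp (Suc m) N (e'(m := b))"
    by (rule tp_eqI) (use b in \<open>auto simp: tp_def\<close>)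
  moreover have "env N (e'(m := b))" using e' b by auto
  moreover from this have "tp (Suc m) N (e'(m := b)) = tp (Suc m) W (e'(m := b))" by (rule elem_sub_tp[OF el])
  moreover have "\<forall>i<k. (e'(m := b)) i = e i" using e'(2) step(1) by auto
  ultimately show ?case by metis
qed

section \<open>Isolated tuples and atomic substructures\<close>

text \<open>Isolation over parameters: only tuples with the same first \<open>k\<close> entries are compared, so \<open>k = 0\<close> gives
  the usual notion.\<close>

definition isolates :: "'a bstr \<Rightarrow> nat \<Rightarrow> nat \<Rightarrow> (nat \<Rightarrow> 'a) \<Rightarrow> unit fm \<Rightarrow> bool" where
  "isolates W k m e \<chi> \<longleftrightarrow> \<chi> \<in> formulas {} m \<and> bsat W e \<chi> \<and>
     (\<forall>e'. env W e' \<and> (\<forall>i<k. e' i = e i) \<and> bsat W e' \<chi> \<longrightarrow> tp m W e' = tp m W e)"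

text \<open>The density of isolated types among the types of tuples that extend the parameters
  \<open>a 0, \<dots>, a (k-1)\<close>. It is what the construction of atomic models needs.\<close>

definition isolated_dense :: "'a bstr \<Rightarrow> nat \<Rightarrow> (nat \<Rightarrow> 'a) \<Rightarrow> bool" where
  "isolated_dense W k a \<longleftrightarrow> (\<forall>m \<phi> e. k \<le> m \<and> \<phi> \<in> formulas {} m \<and> env W e \<and> (\<forall>i<k. e i = a i) \<and> bsat W e \<phi> \<longrightarrow>
     (\<exists>e' \<chi>. env W e' \<and> (\<forall>i<k. e' i = a i) \<and> bsat W e' \<phi> \<and> isolates W k m e' \<chi>))"

lemma isolates_tp:
  assumes "isolates W k m e \<chi>" "tp m W e' = tp m W e" "\<And>i. i < k \<Longrightarrow> e' i = e i"
  shows "isolates W k m e' \<chi>"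
  using assms tp_eqD[OF assms(2), of \<chi>] by (auto simp: isolates_def)

lemma isolates_complete:
  assumes "is_bstr W" "env W e" "isolates W 0 n e \<chi>" shows "complete_formula (Th W) n \<chi>"
proof -
  have \<chi>: "\<chi> \<in> formulas {} n" "bsat W e \<chi>" and
    u: "\<And>d. env W d \<Longrightarrow> bsat W d \<chi> \<Longrightarrow> tp n W d = tp n W e" using assms(3) by (auto simp: isolates_def)
  show ?thesis unfolding complete_formula_Th[OF assms(1)]
  proof (intro conjI allI impI \<chi>(1))
    show "\<exists>e. env W e \<and> bsat W e \<chi>" using assms(2) \<chi>(2) by blast
    fix d d' assume "env W d \<and> env W d' \<and> bsat W d \<chi> \<and> bsat W d' \<chi>"
    then show "tp n W d = tp n W d'" using u[of d] u[of d'] by simp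
  qed
qed

text \<open>The type of a tuple with all its entries taken from an isolated one is isolated: quantify the
  isolated tuple existentially. The parameters stay in front, as \<open>f\<close> fixes their positions.\<close>

lemma isolates_ren:
  assumes W: "env W s" and isl: "isolates W k m s \<chi>" and "k \<le> m" "k \<le> n"
    and f: "\<And>i. i < k \<Longrightarrow> f i = i" "\<And>i. i < n \<Longrightarrow> f i < m"
  shows "\<exists>\<chi>'. isolates W k n (\<lambda>i. s (f i)) \<chi>'"
proof -
  have \<chi>: "\<chi> \<in> formulas {} m" "bsat W s \<chi>" using isl by (auto simp: isolates_def)
  define \<psi> where "\<psi> = And (ren (\<lambda>i. n + i) \<chi>) (Conj (map (\<lambda>i. Eq (Var i) (Var (n + f i))) [0..<n]))"
  have "ren (\<lambda>i. n + i) \<chi> \<in> formulas {} (n + m)" by (rule ren_formulas[OF \<chi>(1)]) simp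
  then have "\<psi> \<in> formulas {} (n + m)" using f(2) by (auto simp: \<psi>_def formulas_def)
  then have 1: "Exs [n..<n + m] \<psi> \<in> formulas {} n" by (fastforce simp: formulas_def)
  have env: "env W (\<lambda>i. s (f i))" using W by (simp add: env_iff)
  have "isolates W k n (\<lambda>i. s (f i)) (Exs [n..<n + m] \<psi>)" unfolding isolates_def
  proof (intro conjI allI impI 1)
    let ?e = "\<lambda>x. if n \<le> x \<and> x < n + m then s (x - n) else s (f x)"
    have "env W ?e" using W by (simp add: env_iff)
    moreover have "agree (set [n..<n + m]) (\<lambda>i. s (f i)) ?e" by (auto simp: agree_def)
    moreover have "bsat W (\<lambda>i. ?e (n + i)) \<chi>"
      using bsat_formulas_cong[OF \<chi>(1), of s "\<lambda>i. ?e (n + i)" W] \<chi>(2) by simp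
    then have "bsat W ?e \<psi>" using f(2) by (simp add: \<psi>_def)
    ultimately show "bsat W (\<lambda>i. s (f i)) (Exs [n..<n + m] \<psi>)" using env by auto
    fix y assume y: "env W y \<and> (\<forall>i<k. y i = s (f i)) \<and> bsat W y (Exs [n..<n + m] \<psi>)"
    then obtain e' where e': "env W e'" "agree {n..<n + m} y e'" "bsat W e' \<psi>" by auto
    let ?t = "\<lambda>i. e' (n + i)"
    have yt: "y i = ?t (f i)" if "i < n" for i
      using e' that by (auto simp: \<psi>_def agree_def)
    have "tp m W ?t = tp m W s"
    proof -
      have "\<forall>i<k. ?t i = s i" using yt f(1) y assms(4) by (metis order.strict_trans2)
      moreover have "env W ?t" using e'(1) by (simp add: env_iff)
      moreover have "bsat W ?t \<chi>" using e'(3) by (simp add: \<psi>_def)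
      ultimately show ?thesis using isl by (simp add: isolates_def)
    qed
    then have "tp n W (\<lambda>i. ?t (f i)) = tp n W (\<lambda>i. s (f i))" using f(2) by (rule tp_ren)
    moreover have "tp n W y = tp n W (\<lambda>i. ?t (f i))" by (rule tp_cong) (rule yt)
    ultimately show "tp n W y = tp n W (\<lambda>i. s (f i))" by simp
  qed
  then show ?thesis by blast
qed

text \<open>A tuple with isolated type can be extended by a solution of \<open>\<phi>\<close>, if there is any, so that its type
  remains isolated.\<close>

lemma isolates_extend:
  assumes dn: "isolated_dense W k a" and km: "k \<le> m" and e: "env W e" "\<And>i. i < k \<Longrightarrow> e i = a i"
    and isl: "isolates W k m e \<chi>" and \<phi>: "\<phi> \<in> formulas {} (Suc m)" "b \<in> Univ W" "bsat W (e(m := b)) \<phi>"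
  shows "\<exists>b\<in>Univ W. \<exists>\<chi>'. isolates W k (Suc m) (e(m := b)) \<chi>' \<and> bsat W (e(m := b)) \<phi>"
proof -
  have \<chi>: "\<chi> \<in> formulas {} m" "bsat W e \<chi>" using isl by (auto simp: isolates_def)
  have 1: "And \<chi> \<phi> \<in> formulas {} (Suc m)" using \<chi>(1) \<phi>(1) formulas_mono[of m "Suc m" "{}"] by auto
  have "bsat W (e(m := b)) \<chi>" using bsat_formulas_cong[OF \<chi>(1), of "e(m := b)" e W] \<chi>(2) by simp
  then have 2: "bsat W (e(m := b)) (And \<chi> \<phi>)" using \<phi>(3) by simp
  have 3: "env W (e(m := b))" using e(1) \<phi>(2) by auto
  have 4: "\<forall>i<k. (e(m := b)) i = a i" using e(2) km by auto
  obtain e2 \<chi>2 where e2: "env W e2" "\<forall>i<k. e2 i = a i" "bsat W e2 (And \<chi> \<phi>)" "isolates W k (Suc m) e2 \<chi>2"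
    using dn[unfolded isolated_dense_def, rule_format, of "Suc m" "And \<chi> \<phi>" "e(m := b)"] 1 2 3 4 km by auto
  have \<chi>2: "\<chi>2 \<in> formulas {} (Suc m)" "bsat W e2 \<chi>2" using e2(4) by (auto simp: isolates_def)
  have "tp m W e2 = tp m W e" using isl e2 e(2) by (simp add: isolates_def)
  moreover have "bsat W e2 (Ex m \<chi>2)"
  proof -
    have "bsat W (e2(m := e2 m)) \<chi>2" using \<chi>2(2) by simp
    then show ?thesis using env_in[OF e2(1)] by (auto simp del: fun_upd_triv)
  qed
  ultimately have "bsat W e (Ex m \<chi>2)" using tp_eqD formulas_Ex[OF \<chi>2(1)] by blast
  then obtain b' where b': "b' \<in> Univ W" "bsat W (e(m := b')) \<chi>2" by auto
  have "env W (e(m := b'))" using e(1) b' by auto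
  moreover have 5: "\<forall>i<k. (e(m := b')) i = e2 i" using e(2) e2(2) km by auto
  ultimately have t: "tp (Suc m) W (e(m := b')) = tp (Suc m) W e2"
    using e2(4) b'(2) by (simp add: isolates_def)
  have "isolates W k (Suc m) (e(m := b')) \<chi>2" using isolates_tp[OF e2(4) t] 5 by blast
  moreover have "bsat W (e(m := b')) \<phi>" using tp_eqD[OF t \<phi>(1)] e2(3) by simp
  ultimately show ?thesis using b'(1) by blast
qed

text \<open>A witness has to be chosen with regard to all earlier choices, as the whole tuple must have an
  isolated type. So the model is the range of a sequence. The \<open>m\<close>-th step treats the
  requirement coded by the first component of \<open>prod_decode m\<close>: a formula \<open>\<phi>\<close>, the variable \<open>j\<close> to be
  witnessed, and a list \<open>fs\<close> of indices of earlier entries that serve as values of the other variables.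
  Every requirement comes up again and again, hence also after all its indices have been passed.\<close>

lemma atomic_submodel:
  assumes W: "is_bstr W" and a: "env W a" and dn: "isolated_dense W k a"
  shows "\<exists>N. a ` {..<k} \<subseteq> N \<and> countable N \<and> elem_sub (sub W N) W \<and>
    (\<forall>n e. k \<le> n \<and> range e \<subseteq> N \<and> (\<forall>i<k. e i = a i) \<longrightarrow> (\<exists>\<chi>. isolates W k n e \<chi>))"
proof -
  define ok where "ok m \<phi> j fs \<longleftrightarrow> csts \<phi> = {} \<and> fv \<phi> - {j} \<subseteq> {..<length fs} \<and> (\<forall>x<length fs. fs ! x < m)"
    for m :: nat and j and fs :: "nat list" and \<phi> :: "unit fm"
  define req where "req m e b \<longleftrightarrow> (\<forall>(\<phi> :: unit fm) (j :: nat) (fs :: nat list) c. fst (prod_decode m) = to_nat (\<phi>, j, fs) \<and> ok (k + m) \<phi> j fs \<and>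
      c \<in> Univ W \<and> bsat W ((\<lambda>x. e (fs ! x))(j := c)) \<phi> \<longrightarrow> bsat W ((\<lambda>x. e (fs ! x))(j := b)) \<phi>)" for m e b
  define P where "P m e \<longleftrightarrow> env W e \<and> (\<forall>i<k. e i = a i) \<and> (\<exists>\<chi>. isolates W k (k + m) e \<chi>)" for m e
  define Q where "Q m e e' \<longleftrightarrow> (\<exists>b. e' = e(k + m := b) \<and> req m e b)" for m e e'
  have "\<exists>E. \<forall>m. P m (E m) \<and> Q m (E m) (E (Suc m))"
  proof (rule dependent_nat_choice)
    show "\<exists>e. P 0 e"
      using dn[unfolded isolated_dense_def, rule_format, of k Tru a] a by (auto simp: P_def)
  next
    fix e m assume P: "P m e"
    then obtain \<chi> where e: "env W e" "\<And>i. i < k \<Longrightarrow> e i = a i" and \<chi>: "isolates W k (k + m) e \<chi>"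
      by (auto simp: P_def)
    have ext: "\<exists>b\<in>Univ W. \<exists>\<chi>'. isolates W k (Suc (k + m)) (e(k + m := b)) \<chi>' \<and> bsat W (e(k + m := b)) \<phi>"
      if "\<phi> \<in> formulas {} (Suc (k + m))" "c \<in> Univ W" "bsat W (e(k + m := c)) \<phi>" for \<phi> c
      by (rule isolates_extend[OF dn _ e \<chi> that]) auto
    have *: "\<exists>b\<in>Univ W. req m e b \<and> (\<exists>\<chi>'. isolates W k (Suc (k + m)) (e(k + m := b)) \<chi>')"
    proof (cases "\<exists>(\<phi> :: unit fm) (j :: nat) (fs :: nat list) c. fst (prod_decode m) = to_nat (\<phi>, j, fs) \<and> ok (k + m) \<phi> j fs \<and>
        c \<in> Univ W \<and> bsat W ((\<lambda>x. e (fs ! x))(j := c)) \<phi>")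
      case True
      then obtain \<phi> :: "unit fm" and j :: nat and fs :: "nat list" and c where r: "fst (prod_decode m) = to_nat (\<phi>, j, fs)" "ok (k + m) \<phi> j fs"
        "c \<in> Univ W" "bsat W ((\<lambda>x. e (fs ! x))(j := c)) \<phi>" by blast
      let ?f = "\<lambda>x. if x = j then k + m else fs ! x"
      have f: "ren ?f \<phi> \<in> formulas {} (Suc (k + m))"
      proof -
        have "?f x < Suc (k + m)" if "x \<in> fv \<phi>" for x
        proof (cases "x = j")
          case False
          then have "x < length fs" using r(2) that by (auto simp: ok_def)
          then show ?thesis using r(2) False by (auto simp: ok_def less_Suc_eq)
        qed simp
        then have "?f ` fv \<phi> \<subseteq> {..<Suc (k + m)}" by blast
        then have "fv (ren ?f \<phi>) \<subseteq> {..<Suc (k + m)}" using fv_ren[of ?f \<phi>] by blast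
        moreover have "csts (ren ?f \<phi>) \<subseteq> {}" using csts_ren[of ?f \<phi>] r(2) by (simp add: ok_def)
        ultimately show ?thesis by (simp add: formulas_def)
      qed
      have eq: "bsat W (e(k + m := b)) (ren ?f \<phi>) \<longleftrightarrow> bsat W ((\<lambda>x. e (fs ! x))(j := b)) \<phi>" for b
        unfolding bsat_simps
        by (rule bsat_cong) (use r(2) in \<open>auto simp: ok_def dest: subsetD\<close>)
      obtain b \<chi>' where b: "b \<in> Univ W" "isolates W k (Suc (k + m)) (e(k + m := b)) \<chi>'"
        "bsat W (e(k + m := b)) (ren ?f \<phi>)"
        using ext[OF f r(3)] r(4) eq by blast
      have "req m e b" unfolding req_def
      proof (intro allI impI, elim conjE)
        fix \<phi>' :: "unit fm" and j' :: nat and fs' :: "nat list" assume "fst (prod_decode m) = to_nat (\<phi>', j', fs')"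
        then have "(\<phi>', j', fs') = (\<phi>, j, fs)" using r(1) by simp
        then show "bsat W ((\<lambda>x. e (fs' ! x))(j' := b)) \<phi>'" using b(3) eq by simp
      qed
      then show ?thesis using b by blast
    next
      case False
      then have "req m e b" for b unfolding req_def by blast
      moreover have "e 0 \<in> Univ W" using e(1) by (simp add: env_iff)
      ultimately show ?thesis using ext[of Tru "e 0"] by auto
    qed
    then obtain b \<chi>' where b: "b \<in> Univ W" "req m e b" "isolates W k (Suc (k + m)) (e(k + m := b)) \<chi>'" by blast
    then have "P (Suc m) (e(k + m := b))" using e by (auto simp: P_def)
    then show "\<exists>e'. P (Suc m) e' \<and> Q m e e'" using b(2) by (auto simp: Q_def)
  qed
  then obtain E where E: "\<And>m. P m (E m)" "\<And>m. Q m (E m) (E (Suc m))" by blast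
  define s where "s i = (if i < k then a i else E (Suc (i - k)) i)" for i
  have Es: "i < k + m \<Longrightarrow> E m i = s i" for i m
  proof (induction m)
    case 0
    then show ?case using E(1)[of 0] by (simp add: P_def s_def)
  next
    case (Suc m)
    obtain b where b: "E (Suc m) = (E m)(k + m := b)" using E(2)[of m] by (auto simp: Q_def)
    show ?case
    proof (cases "i = k + m")
      case False
      then show ?thesis using Suc b by simp
    qed (simp add: s_def)
  qed
  have s_env: "env W s" using a E(1) by (auto simp: s_def P_def env_iff)
  have s_isol: "\<exists>\<chi>. isolates W k (k + m) s \<chi>" for m
  proof -
    obtain \<chi> where "isolates W k (k + m) (E m) \<chi>" using E(1) by (auto simp: P_def)
    moreover have "tp (k + m) W s = tp (k + m) W (E m)" by (rule tp_cong) (simp add: Es)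
    ultimately show ?thesis using isolates_tp[of W k "k + m" "E m" \<chi> s] Es by auto
  qed
  let ?N = "range s"
  have el: "elem_sub (sub W ?N) W"
  proof (rule tarski_vaught[OF W])
    show "?N \<subseteq> Univ W" using s_env by (simp add: env_def)
    fix \<phi> :: "unit fm" and x e b
    assume A: "csts \<phi> = {}" "range e \<subseteq> ?N" "b \<in> Univ W" "bsat W (e(x := b)) \<phi>"
    have "\<forall>y. \<exists>i. e y = s i" using A(2) by (auto simp: image_subset_iff)
    then obtain f where f: "\<And>y. e y = s (f y)" by metis
    obtain n where n: "\<phi> \<in> formulas {} n" using formulas_exists[of \<phi> "{}"] A(1) by auto
    define fs where "fs = map f [0..<n]"
    define m where "m = prod_encode (to_nat (\<phi>, x, fs), Suc (sum_list fs))"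
    have m: "fst (prod_decode m) = to_nat (\<phi>, x, fs)" by (simp add: m_def)
    have "fs ! y < k + m" if "y < length fs" for y
    proof -
      have "fs ! y \<le> sum_list fs" using that by (simp add: elem_le_sum_list)
      also have "\<dots> < m" unfolding m_def using le_prod_encode_2[of "Suc (sum_list fs)"] by (metis Suc_le_eq)
      finally show ?thesis by simp
    qed
    then have ok: "ok (k + m) \<phi> x fs" using n A(1) by (auto simp: ok_def fs_def formulas_def)
    have eq: "bsat W ((\<lambda>y. E m (fs ! y))(x := c)) \<phi> \<longleftrightarrow> bsat W (e(x := c)) \<phi>" for c
    proof (rule bsat_formulas_cong[OF n])
      fix y assume "y < n"
      then have "E m (fs ! y) = e y" using ok Es[of "fs ! y" m] f by (auto simp: ok_def fs_def)
      then show "((\<lambda>y. E m (fs ! y))(x := c)) y = (e(x := c)) y" by simp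
    qed
    obtain c where c: "E (Suc m) = (E m)(k + m := c)" "req m (E m) c" using E(2)[of m] by (auto simp: Q_def)
    have "bsat W ((\<lambda>y. E m (fs ! y))(x := c)) \<phi>"
      using c(2) m ok A(3,4) eq unfolding req_def by blast
    moreover have "c = s (k + m)" using c(1) Es[of "k + m" "Suc m"] by simp
    ultimately show "\<exists>b\<in>?N. bsat W (e(x := b)) \<phi>" using eq by blast
  qed simp
  have "\<exists>\<chi>. isolates W k n e \<chi>" if e: "k \<le> n" "range e \<subseteq> ?N" "\<forall>i<k. e i = a i" for n e
  proof -
    have "\<forall>y. \<exists>i. e y = s i" using e(2) by (auto simp: image_subset_iff)
    then obtain g where g: "\<And>y. e y = s (g y)" by metis
    define f where "f i = (if i < k then i else g i)" for i
    have f: "e i = s (f i)" for i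
      using e(3) g[of i] by (cases "i < k") (simp_all add: f_def s_def[of i])
    define m where "m = Suc (\<Sum>i<n. f i)"
    have fm: "f i < k + m" if "i < n" for i
      using member_le_sum[of i "{..<n}" f] that by (simp add: m_def)
    obtain \<chi> where "isolates W k (k + m) s \<chi>" using s_isol by blast
    from isolates_ren[OF s_env this _ e(1) _ fm] have "\<exists>\<chi>'. isolates W k n (\<lambda>i. s (f i)) \<chi>'" by (simp add: f_def)
    moreover have "(\<lambda>i. s (f i)) = e" using f by auto
    ultimately show ?thesis by simp
  qed
  moreover have "a ` {..<k} \<subseteq> ?N"
  proof clarify
    fix i assume "i < k"
    then have "a i = s i" by (simp add: s_def)
    then show "a i \<in> ?N" by simp
  qed
  ultimately show ?thesis using el by (intro exI[of _ ?N]) auto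
qed

lemma atomic_theory_dense:
  assumes "is_bstr W" "atomic_theory (Th W)" shows "isolated_dense W 0 a"
  unfolding isolated_dense_def
proof (intro allI impI, elim conjE)
  fix m \<phi> e assume "\<phi> \<in> formulas {} m" "env W e" "bsat W e \<phi>"
  then obtain \<chi> e' where "complete_formula (Th W) m \<chi>" "env W e'" "bsat W e' \<chi>" "bsat W e' \<phi>"
    using assms(2) unfolding atomic_theory_Th[OF assms(1)] by blast
  moreover from this have "isolates W 0 m e' \<chi>"
    unfolding complete_formula_Th[OF assms(1)] isolates_def by blast
  ultimately show "\<exists>e' \<chi>. env W e' \<and> (\<forall>i<0. e' i = a i) \<and> bsat W e' \<phi> \<and> isolates W 0 m e' \<chi>" by auto
qed

lemma atomic_model_exists:
  assumes "is_bstr M" "atomic_theory (Th M)"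
  shows "\<exists>N. countable N \<and> elem_sub (sub M N) M \<and> atomic_model (sub M N)"
proof -
  obtain a where a: "env M a" using is_bstr_env[OF assms(1)] by blast
  obtain N where N: "countable N" "elem_sub (sub M N) M"
    "\<And>n e. range e \<subseteq> N \<Longrightarrow> \<exists>\<chi>. isolates M 0 n e \<chi>"
    using atomic_submodel[OF assms(1) a atomic_theory_dense[OF assms]] by auto
  have "\<exists>\<phi>. complete_formula (Th (sub M N)) n \<phi> \<and> bsat (sub M N) e \<phi>" if e: "env (sub M N) e" for n e
  proof -
    obtain \<chi> where \<chi>: "isolates M 0 n e \<chi>" using N(3)[of e n] e by (auto simp: env_def)
    have "complete_formula (Th M) n \<chi>" by (rule isolates_complete[OF assms(1) elem_sub_env[OF N(2) e] \<chi>])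
    moreover have "bsat (sub M N) e \<chi>"
      using elem_sub_bsat[OF N(2) e, of \<chi>] \<chi> by (auto simp: isolates_def formulas_def)
    ultimately show ?thesis using elem_sub_Th[OF N(2) assms(1)] by auto
  qed
  then show ?thesis using N by (auto simp: atomic_model_env)
qed

section \<open>Uniqueness of countable atomic models\<close>

lemma complete_formula_tp:
  assumes "is_bstr M" "is_bstr N" "Th M = Th N" "complete_formula (Th M) n \<chi>"
    "env M e" "env N d" "bsat M e \<chi>" "bsat N d \<chi>"
  shows "tp n M e = tp n N d"
proof (rule tp_eqI)
  fix \<psi> :: "unit fm" assume \<psi>: "\<psi> \<in> formulas {} n" "bsat M e \<psi>"
  have \<chi>: "\<chi> \<in> formulas {} n" using assms(4) by (simp add: complete_formula_def)
  then have f: "Imp \<chi> \<psi> \<in> formulas {} n" "Imp \<chi> (Neg \<psi>) \<in> formulas {} n" using \<psi> by auto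
  have "\<not> Th M \<turnstile> Imp \<chi> (Neg \<psi>)" using Th_proves[OF assms(1) f(2)] assms(5,7) \<psi>(2) by auto
  then have "Th M \<turnstile> Imp \<chi> \<psi>" using assms(4) \<psi>(1) by (auto simp: complete_formula_def)
  then have "Th N \<turnstile> Imp \<chi> \<psi>" using assms(3) by simp
  then show "bsat N d \<psi>" using Th_proves[OF assms(2) f(1)] assms(6,8) by auto
qed

text \<open>If a complete formula isolates the type of the longer tuple, its existential quantification is in
  the type of the shorter one.\<close>

lemma atomic_forth:
  assumes M: "is_bstr M" and N: "is_bstr N" and T: "Th M = Th N" and at: "atomic_model M"
    and e: "env M e" and d: "env N d" and t: "tp m M e = tp m N d" and a: "a \<in> Univ M"
  shows "\<exists>b\<in>Univ N. tp (Suc m) M (e(m := a)) = tp (Suc m) N (d(m := b))"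
proof -
  obtain \<chi> where \<chi>: "complete_formula (Th M) (Suc m) \<chi>" "bsat M (e(m := a)) \<chi>"
    using at a e unfolding atomic_model_env by blast
  then have "Ex m \<chi> \<in> formulas {} m" by (auto simp: complete_formula_def intro: formulas_Ex)
  moreover have "bsat M e (Ex m \<chi>)" using \<chi>(2) a by auto
  ultimately have "bsat N d (Ex m \<chi>)" using tp_eqD[OF t] by blast
  then obtain b where b: "b \<in> Univ N" "bsat N (d(m := b)) \<chi>" by auto
  have "tp (Suc m) M (e(m := a)) = tp (Suc m) N (d(m := b))"
    by (rule complete_formula_tp[OF M N T \<chi>(1) _ _ \<chi>(2) b(2)]) (use e d a b in auto)
  then show ?thesis using b(1) by blast
qed

text \<open>The entries of the two sequences that are built alternate between the enumerations of the two
  structures, so both sequences are exhaustive.\<close>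

lemma back_and_forth:
  assumes M: "is_bstr M" "countable (Univ M)" and N: "is_bstr N" "countable (Univ N)" and T: "Th M = Th N"
    and forw: "\<And>m e d a. env M e \<Longrightarrow> env N d \<Longrightarrow> tp m M e = tp m N d \<Longrightarrow> a \<in> Univ M \<Longrightarrow>
      \<exists>b\<in>Univ N. tp (Suc m) M (e(m := a)) = tp (Suc m) N (d(m := b))"
    and backw: "\<And>m e d b. env M e \<Longrightarrow> env N d \<Longrightarrow> tp m M e = tp m N d \<Longrightarrow> b \<in> Univ N \<Longrightarrow>
      \<exists>a\<in>Univ M. tp (Suc m) M (e(m := a)) = tp (Suc m) N (d(m := b))"
  shows "M \<simeq> N"
proof -
  have ne: "Univ M \<noteq> {}" "Univ N \<noteq> {}" using M N by (auto simp: is_bstr_def)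
  define P where "P m ed \<longleftrightarrow> (case ed of (e, d) \<Rightarrow> env M e \<and> env N d \<and> tp m M e = tp m N d)" for m ed
  define Q where "Q m ed ed' \<longleftrightarrow> (\<exists>a b. fst ed' = (fst ed)(m := a) \<and> snd ed' = (snd ed)(m := b) \<and>
    (even m \<longrightarrow> a = from_nat_into (Univ M) (m div 2)) \<and> (odd m \<longrightarrow> b = from_nat_into (Univ N) (m div 2)))" for m ed ed'
  have "\<exists>E. \<forall>m. P m (E m) \<and> Q m (E m) (E (Suc m))"
  proof (rule dependent_nat_choice)
    obtain e where "env M e" using is_bstr_env[OF M(1)] by blast
    moreover obtain d where "env N d" using is_bstr_env[OF N(1)] by blast
    ultimately have "P 0 (e, d)" using tp_0[OF M(1)] tp_0[OF N(1)] T by (simp add: P_def)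
    then show "\<exists>ed. P 0 ed" by blast
  next
    fix ed m assume P: "P m ed"
    obtain e d where ed: "ed = (e, d)" by (metis surj_pair)
    then have p: "env M e" "env N d" "tp m M e = tp m N d" using P by (auto simp: P_def)
    show "\<exists>ed'. P (Suc m) ed' \<and> Q m ed ed'"
    proof (cases "even m")
      case True
      let ?a = "from_nat_into (Univ M) (m div 2)"
      have a: "?a \<in> Univ M" using ne by (simp add: from_nat_into)
      obtain b where b: "b \<in> Univ N" "tp (Suc m) M (e(m := ?a)) = tp (Suc m) N (d(m := b))"
        using forw[OF p a] by blast
      have "P (Suc m) (e(m := ?a), d(m := b))" using p a b by (auto simp: P_def)
      moreover have "Q m ed (e(m := ?a), d(m := b))" using True unfolding Q_def ed by auto
      ultimately show ?thesis by blast
    next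
      case False
      let ?b = "from_nat_into (Univ N) (m div 2)"
      have b: "?b \<in> Univ N" using ne by (simp add: from_nat_into)
      obtain a where a: "a \<in> Univ M" "tp (Suc m) M (e(m := a)) = tp (Suc m) N (d(m := ?b))"
        using backw[OF p b] by blast
      have "P (Suc m) (e(m := a), d(m := ?b))" using p a b by (auto simp: P_def)
      moreover have "Q m ed (e(m := a), d(m := ?b))" using False unfolding Q_def ed by auto
      ultimately show ?thesis by blast
    qed
  qed
  then obtain E where E: "\<And>m. P m (E m)" "\<And>m. Q m (E m) (E (Suc m))" by blast
  define s where "s i = fst (E (Suc i)) i" for i
  define t where "t i = snd (E (Suc i)) i" for i
  have st: "i < m \<Longrightarrow> fst (E m) i = s i \<and> snd (E m) i = t i" for i m
  proof (induction m)
    case (Suc m)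
    obtain a b where "fst (E (Suc m)) = (fst (E m))(m := a)" "snd (E (Suc m)) = (snd (E m))(m := b)"
      using E(2)[of m] by (auto simp: Q_def)
    then show ?case using Suc by (cases "i = m") (auto simp: s_def t_def)
  qed simp
  have env: "env M (fst (E m))" "env N (snd (E m))" "tp m M (fst (E m)) = tp m N (snd (E m))" for m
    using E(1)[of m] by (auto simp: P_def split: prod.splits)
  have tp: "tp m M s = tp m N t" for m
    using env(3)[of m] tp_cong[of m "fst (E m)" s M] tp_cong[of m "snd (E m)" t N] st by auto
  have "s (2 * i) = from_nat_into (Univ M) i" for i
    using E(2)[of "2 * i"] by (auto simp: Q_def s_def)
  then have "from_nat_into (Univ M) i \<in> range s" for i by (metis rangeI)
  then have "range (from_nat_into (Univ M)) \<subseteq> range s" by blast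
  moreover have "range s \<subseteq> Univ M" using env(1) by (auto simp: s_def env_iff)
  ultimately have rs: "range s = Univ M" using range_from_nat_into[OF ne(1) M(2)] by blast
  have "t (2 * i + 1) = from_nat_into (Univ N) i" for i
    using E(2)[of "2 * i + 1"] by (auto simp: Q_def t_def)
  then have "from_nat_into (Univ N) i \<in> range t" for i by (metis rangeI)
  then have "range (from_nat_into (Univ N)) \<subseteq> range t" by blast
  moreover have "range t \<subseteq> Univ N" using env(2) by (auto simp: t_def env_iff)
  ultimately have rt: "range t = Univ N" using range_from_nat_into[OF ne(2) N(2)] by blast
  have at: "bsat M s \<phi> \<longleftrightarrow> bsat N t \<phi>" if "csts \<phi> = {}" for \<phi>
    using formulas_exists[of \<phi> "{}"] that tp_eqD[OF tp] by auto
  have eq: "s i = s j \<longleftrightarrow> t i = t j" and rl: "(s i, s j) \<in> Rel M \<longleftrightarrow> (t i, t j) \<in> Rel N" for i j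
    using at[of "Eq (Var i) (Var j)"] at[of "Rl (Var i) (Var j)"] by auto
  define h where "h x = t (inv s x)" for x
  have h: "h (s i) = t i" for i
    using eq[of "inv s (s i)" i] by (simp add: h_def f_inv_into_f)
  have "bij_betw h (Univ M) (Univ N)"
    unfolding bij_betw_def rs[symmetric] rt[symmetric] by (auto simp: inj_on_def h eq image_iff)
  moreover have "\<forall>x\<in>Univ M. \<forall>y\<in>Univ M. (x, y) \<in> Rel M \<longleftrightarrow> (h x, h y) \<in> Rel N"
    unfolding rs[symmetric] by (auto simp: h rl)
  ultimately show ?thesis unfolding iso_iff iso_map_def by blast
qed

lemma atomic_unique:
  assumes M: "is_bstr M" "countable (Univ M)" "atomic_model M" and N: "is_bstr N" "countable (Univ N)" "atomic_model N"
    and T: "Th M = Th N"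
  shows "M \<simeq> N"
proof (rule back_and_forth[OF M(1,2) N(1,2) T])
  show "\<exists>b\<in>Univ N. tp (Suc m) M (e(m := a)) = tp (Suc m) N (d(m := b))"
    if "env M e" "env N d" "tp m M e = tp m N d" "a \<in> Univ M" for m e d a
    using atomic_forth[OF M(1) N(1) T M(3) that] .
  show "\<exists>a\<in>Univ M. tp (Suc m) M (e(m := a)) = tp (Suc m) N (d(m := b))"
    if "env M e" "env N d" "tp m M e = tp m N d" "b \<in> Univ N" for m e d b
    using atomic_forth[OF N(1) M(1) T[symmetric] N(3) that(2,1) that(3)[symmetric] that(4)] by metis
qed

section \<open>Vaught's theorem: never exactly two countable models\<close>

text \<open>Suppose that no type below \<open>\<phi>\<close> is isolated, and enumerate the countably many types. Starting with
  \<open>\<phi>\<close>, strengthen the formula in step \<open>j\<close> so that it excludes the \<open>j\<close>-th type; this is possible since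
  the formula reached so far does not isolate a type. By compactness some tuple satisfies all
  these formulas, and its type has been excluded.\<close>

lemma small_dense:
  assumes W: "compact_str W" and sm: "small_theory (Th W)" and a: "env W a"
  shows "isolated_dense W k a"
  unfolding isolated_dense_def
proof (intro allI impI, elim conjE, rule ccontr)
  have bW: "is_bstr W" using W by (simp add: compact_str_def)
  fix m \<phi> e assume km: "k \<le> m" and \<phi>: "\<phi> \<in> formulas {} m" and e: "env W e" "\<forall>i<k. e i = a i" "bsat W e \<phi>"
    and no: "\<not> (\<exists>e' \<chi>. env W e' \<and> (\<forall>i<k. e' i = a i) \<and> bsat W e' \<phi> \<and> isolates W k m e' \<chi>)"
  let ?T = "types {} (Th W) m"
  have T: "countable ?T" using sm unfolding small_theory_def by (rule countable_subset[rotated]) auto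
  have T': "tp m W d \<in> ?T" if "env W d" for d using tp_in_types[OF bW bW refl that] .
  define p where "p j = from_nat_into ?T j" for j
  define P where "P \<psi> \<longleftrightarrow> \<psi> \<in> formulas {} m \<and> (\<exists>d. env W d \<and> (\<forall>i<k. d i = a i) \<and> bsat W d \<psi>) \<and>
    (\<forall>d. env W d \<and> bsat W d \<psi> \<longrightarrow> bsat W d \<phi>)" for \<psi>
  define Q where "Q j \<psi> \<psi>' \<longleftrightarrow> (\<forall>d. env W d \<and> bsat W d \<psi>' \<longrightarrow> bsat W d \<psi> \<and> tp m W d \<noteq> p j)" for j \<psi> \<psi>'
  have "\<exists>E. \<forall>j :: nat. P (E j) \<and> Q j (E j) (E (Suc j))"
  proof (rule dependent_nat_choice)
    show "\<exists>\<psi>. P \<psi>" using \<phi> e by (auto simp: P_def)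
  next
    fix \<psi> j assume P: "P \<psi>"
    then obtain d where d: "env W d" "\<forall>i<k. d i = a i" "bsat W d \<psi>" and \<psi>: "\<psi> \<in> formulas {} m" by (auto simp: P_def)
    have "\<exists>d. env W d \<and> (\<forall>i<k. d i = a i) \<and> bsat W d \<psi> \<and> tp m W d \<noteq> p j"
    proof (cases "tp m W d = p j")
      case True
      have "\<not> isolates W k m d \<psi>" using no d P by (auto simp: P_def)
      then show ?thesis using \<psi> d True by (auto simp: isolates_def)
    qed (use d in blast)
    then obtain d where d: "env W d" "\<forall>i<k. d i = a i" "bsat W d \<psi>" "tp m W d \<noteq> p j" by blast
    show "\<exists>\<psi>'. P \<psi>' \<and> Q j \<psi> \<psi>'"
    proof (cases "\<exists>d'. env W d' \<and> tp m W d' = p j")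
      case True
      then obtain d' where d': "tp m W d' = p j" by blast
      then obtain \<theta> where \<theta>: "\<theta> \<in> formulas {} m" "bsat W d \<theta>" "\<not> bsat W d' \<theta>"
        using tp_eqI[of m W d W d'] d(4) by metis
      have "P (And \<psi> \<theta>)" using P d \<theta> by (auto simp: P_def)
      moreover have "Q j \<psi> (And \<psi> \<theta>)" unfolding Q_def
      proof (intro allI impI conjI)
        fix c assume c: "env W c \<and> bsat W c (And \<psi> \<theta>)"
        then show "bsat W c \<psi>" by simp
        show "tp m W c \<noteq> p j"
        proof
          assume "tp m W c = p j"
          then have "tp m W c = tp m W d'" using d' by simp
          from tp_eqD[OF this \<theta>(1)] show False using c \<theta>(3) by simp
        qed
      qed
      ultimately show ?thesis by blast
    qed (use P in \<open>auto simp: Q_def\<close>)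
  qed
  then obtain E where E: "\<And>j. P (E j)" "\<And>j. Q j (E j) (E (Suc j))" by blast
  have mono: "bsat W d (E j) \<Longrightarrow> i \<le> j \<Longrightarrow> bsat W d (E i)" if "env W d" for d i j
    using that
  proof (induction j)
    case (Suc j)
    then show ?case using E(2)[of j] by (cases "i = Suc j") (auto simp: Q_def)
  qed simp
  have "\<exists>e'. env W e' \<and> agree (- {..<k}) a e' \<and> (\<forall>\<psi>\<in>range E. bsat W e' \<psi>)"
  proof (rule compactD[OF W a])
    show "\<psi> \<in> range E \<Longrightarrow> csts \<psi> = {}" for \<psi> using E(1) by (auto simp: P_def formulas_def)
    fix F assume "finite F" "F \<subseteq> range E"
    then obtain J where J: "finite J" "F = E ` J" by (metis finite_subset_image)
    obtain l where l: "\<forall>j\<in>J. j \<le> l" using J(1) by (metis Max_ge)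
    obtain d where d: "env W d" "\<forall>i<k. d i = a i" "bsat W d (E l)" using E(1)[of l] by (auto simp: P_def)
    then have "agree (- {..<k}) a d" by (auto simp: agree_def)
    moreover have "\<forall>\<psi>\<in>F. bsat W d \<psi>" using J(2) l mono[OF d(1,3)] by auto
    ultimately show "\<exists>e'. env W e' \<and> agree (- {..<k}) a e' \<and> (\<forall>\<psi>\<in>F. bsat W e' \<psi>)" using d(1) by blast
  qed
  then obtain e' where e': "env W e'" "\<And>j. bsat W e' (E j)" by blast
  obtain l where "tp m W e' = p l"
    unfolding p_def using from_nat_into_surj[OF T T'[OF e'(1)]] by metis
  then show False using E(2)[of l] e'(1) e'(2)[of "Suc l"] by (auto simp: Q_def)
qed

text \<open>If all \<open>2k\<close>-tuples that extend \<open>a\<close> have isolated types over \<open>a\<close>, finitely many of the isolating formulas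
  cover all of them, by compactness. So only finitely many types of \<open>k\<close>-tuples exist, and finitely many
  types can be separated from each other by formulas.\<close>

lemma isolated_if_isolated_over:
  assumes W: "compact_str W" and a: "env W a"
    and iso: "\<And>e. env W e \<Longrightarrow> \<forall>i<k. e i = a i \<Longrightarrow> \<exists>\<chi>. isolates W k (2 * k) e \<chi>"
  shows "\<exists>\<chi>. isolates W 0 k a \<chi>"
proof -
  let ?\<Phi> = "{Neg \<chi> | \<chi> e. env W e \<and> (\<forall>i<k. e i = a i) \<and> isolates W k (2 * k) e \<chi>}"
  have "\<not> (\<exists>e'. env W e' \<and> agree (- {..<k}) a e' \<and> (\<forall>\<psi>\<in>?\<Phi>. bsat W e' \<psi>))"
  proof
    assume "\<exists>e'. env W e' \<and> agree (- {..<k}) a e' \<and> (\<forall>\<psi>\<in>?\<Phi>. bsat W e' \<psi>)"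
    then obtain e' where e': "env W e'" "agree (- {..<k}) a e'" "\<forall>\<psi>\<in>?\<Phi>. bsat W e' \<psi>" by blast
    have 1: "\<forall>i<k. e' i = a i" using e'(2) by (auto simp: agree_def)
    obtain \<chi> where \<chi>: "isolates W k (2 * k) e' \<chi>" using iso[OF e'(1) 1] by blast
    then have "Neg \<chi> \<in> ?\<Phi>" using e'(1) 1 by blast
    then have "bsat W e' (Neg \<chi>)" using e'(3) by blast
    then show False using \<chi> by (simp add: isolates_def)
  qed
  moreover have "\<psi> \<in> ?\<Phi> \<Longrightarrow> csts \<psi> = {}" for \<psi> by (auto simp: isolates_def formulas_def)
  ultimately obtain F where F: "finite F" "F \<subseteq> ?\<Phi>"
    "\<not> (\<exists>e'. env W e' \<and> agree (- {..<k}) a e' \<and> (\<forall>\<psi>\<in>F. bsat W e' \<psi>))"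
    using compactD[OF W a, of ?\<Phi> "- {..<k}"] by blast
  have "\<forall>\<psi>\<in>F. \<exists>p. \<forall>e. env W e \<and> (\<forall>i<k. e i = a i) \<and> \<not> bsat W e \<psi> \<longrightarrow> tp (2 * k) W e = p"
  proof
    fix \<psi> assume "\<psi> \<in> F"
    then obtain \<chi> e where \<chi>: "\<psi> = Neg \<chi>" "env W e" "\<forall>i<k. e i = a i" "isolates W k (2 * k) e \<chi>" using F(2) by blast
    then have "tp (2 * k) W e' = tp (2 * k) W e" if "env W e'" "\<forall>i<k. e' i = a i" "bsat W e' \<chi>" for e'
      using that unfolding isolates_def by metis
    then have "\<forall>e'. env W e' \<and> (\<forall>i<k. e' i = a i) \<and> \<not> bsat W e' \<psi> \<longrightarrow> tp (2 * k) W e' = tp (2 * k) W e"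
      using \<chi>(1) by simp
    then show "\<exists>p. \<forall>e. env W e \<and> (\<forall>i<k. e i = a i) \<and> \<not> bsat W e \<psi> \<longrightarrow> tp (2 * k) W e = p" by blast
  qed
  then obtain p where p: "\<And>\<psi> e. \<psi> \<in> F \<Longrightarrow> env W e \<Longrightarrow> \<forall>i<k. e i = a i \<Longrightarrow> \<not> bsat W e \<psi> \<Longrightarrow> tp (2 * k) W e = p \<psi>"
    by metis
  define G where "G q = {\<phi> \<in> formulas {} k. ren (\<lambda>i. k + i) \<phi> \<in> q}" for q :: "unit fm set"
  have "tp k W b \<in> G ` p ` F" if b: "env W b" for b
  proof -
    let ?e = "\<lambda>i. if i < k then a i else b (i - k)"
    have e: "env W ?e" "\<forall>i<k. ?e i = a i" using a b by (auto simp: env_iff)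
    moreover have "agree (- {..<k}) a ?e" by (auto simp: agree_def)
    ultimately obtain \<psi> where "\<psi> \<in> F" "\<not> bsat W ?e \<psi>" using F(3) by blast
    then have "tp (2 * k) W ?e = p \<psi>" using p e by blast
    moreover have "tp k W b = G (tp (2 * k) W ?e)"
    proof -
      have "\<phi> \<in> formulas {} k \<Longrightarrow> ren (\<lambda>i. k + i) \<phi> \<in> formulas {} (2 * k)" for \<phi> :: "unit fm"
        by (rule ren_formulas) auto
      then show ?thesis by (auto simp: G_def tp_def)
    qed
    ultimately show ?thesis using \<open>\<psi> \<in> F\<close> by auto
  qed
  then have "{tp k W b | b. env W b} \<subseteq> G ` p ` F" by blast
  then have fin: "finite {tp k W b | b. env W b}" using F(1) by (meson finite_imageI finite_subset)
  let ?S = "{tp k W b | b. env W b} - {tp k W a}"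
  have "\<forall>q\<in>?S. \<exists>\<psi>. \<psi> \<in> tp k W a - q"
  proof
    fix q assume "q \<in> ?S"
    then obtain b where b: "q = tp k W b" "tp k W a \<noteq> tp k W b" by auto
    then obtain \<psi> where "\<psi> \<in> formulas {} k" "bsat W a \<psi>" "\<not> bsat W b \<psi>" using tp_eqI[of k W a W b] by blast
    then show "\<exists>\<psi>. \<psi> \<in> tp k W a - q" using b(1) by (auto simp: tp_def)
  qed
  from bchoice[OF this] obtain \<theta> where \<theta>: "\<And>q. q \<in> ?S \<Longrightarrow> \<theta> q \<in> tp k W a - q" by blast
  have "finite (\<theta> ` ?S)" using fin by simp
  from finite_list[OF this] obtain L where L: "set L = \<theta> ` ?S" by blast
  have "isolates W 0 k a (Conj L)" unfolding isolates_def
  proof (intro conjI allI impI)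
    show "Conj L \<in> formulas {} k" "bsat W a (Conj L)" using L \<theta> by (auto simp: tp_def)
    fix b assume b: "env W b \<and> (\<forall>i<0. b i = a i) \<and> bsat W b (Conj L)"
    show "tp k W b = tp k W a"
    proof (rule ccontr)
      assume "tp k W b \<noteq> tp k W a"
      then have "tp k W b \<in> ?S" using b by blast
      then have "\<theta> (tp k W b) \<in> tp k W a - tp k W b" "\<theta> (tp k W b) \<in> set L" using \<theta> L by blast+
      then show False using b by (auto simp: tp_def)
    qed
  qed
  then show ?thesis by blast
qed

text \<open>If all types are isolated, all countable models are atomic and there is only one. Otherwise
  some tuple \<open>a\<close> has a type that is not isolated. An atomic model \<open>A\<close> omits this type. A countably saturated model
  \<open>B\<close> and a model \<open>C\<close> that is atomic over \<open>a\<close> realise it, so both differ from \<open>A\<close>. If \<open>C\<close> were isomorphic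
  to \<open>B\<close>, it would realise all types over \<open>a\<close>, which would therefore be isolated over \<open>a\<close>; then the
  type of \<open>a\<close> would be isolated.\<close>

theorem three_models:
  assumes W: "compact_str W" and sm: "small_theory (Th W)"
  shows "(\<forall>(M :: nat bstr) (N :: nat bstr). is_bstr M \<and> is_bstr N \<and> Th M = Th W \<and> Th N = Th W \<longrightarrow> M \<simeq> N) \<or>
    (\<exists>A B C. (\<forall>N\<in>{A, B, C}. countable N \<and> elem_sub (sub W N) W) \<and>
       \<not> sub W A \<simeq> sub W B \<and> \<not> sub W A \<simeq> sub W C \<and> \<not> sub W B \<simeq> sub W C)"
proof (cases "\<forall>n e. env W e \<longrightarrow> (\<exists>\<chi>. isolates W 0 n e \<chi>)")
  case True
  have bW: "is_bstr W" using W by (simp add: compact_str_def)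
  have "atomic_model M" if M: "is_bstr M" "Th M = Th W" for M :: "nat bstr"
    unfolding atomic_model_env
  proof (intro allI impI)
    fix n e assume e: "env M e"
    then obtain d where d: "env W d" "tp n M e = tp n W d"
      using compact_realizes[OF W tp_in_types[OF bW M(1) M(2)[symmetric] e]] by metis
    obtain \<chi> where \<chi>: "isolates W 0 n d \<chi>" using True d by blast
    have "complete_formula (Th M) n \<chi>" unfolding M(2) by (rule isolates_complete[OF bW d(1) \<chi>])
    moreover have "bsat M e \<chi>" using tp_eqD[OF d(2)] \<chi> by (auto simp: isolates_def)
    ultimately show "\<exists>\<chi>. complete_formula (Th M) n \<chi> \<and> bsat M e \<chi>" by blast
  qed
  then have *: "M \<simeq> N" if "is_bstr M" "is_bstr N" "Th M = Th W" "Th N = Th W" for M N :: "nat bstr"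
    using atomic_unique[of M N] that by simp
  show ?thesis
  proof (intro disjI1 allI impI, elim conjE)
    fix M N :: "nat bstr" assume "is_bstr M" "is_bstr N" "Th M = Th W" "Th N = Th W"
    then show "M \<simeq> N" by (rule *)
  qed
next
  case False
  then obtain k a where a: "env W a" and nis: "\<And>\<chi>. \<not> isolates W 0 k a \<chi>" by blast
  have bW: "is_bstr W" using W by (simp add: compact_str_def)
  have aW: "a ` {..<k} \<subseteq> Univ W" "countable (a ` {..<k})" using a by (auto simp: env_iff)
  obtain A where A: "countable A" "elem_sub (sub W A) W" "\<And>n e. range e \<subseteq> A \<Longrightarrow> \<exists>\<chi>. isolates W 0 n e \<chi>"
    using atomic_submodel[OF bW a small_dense[OF W sm a], of 0] by auto
  obtain B where B: "a ` {..<k} \<subseteq> B" "countable B" "elem_sub (sub W B) W" "omega_sat (sub W B)"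
    using saturated_submodel[OF W sm aW(2,1)] by blast
  obtain C where C': "a ` {..<k} \<subseteq> C \<and> countable C \<and> elem_sub (sub W C) W \<and>
    (\<forall>n e. k \<le> n \<and> range e \<subseteq> C \<and> (\<forall>i<k. e i = a i) \<longrightarrow> (\<exists>\<chi>. isolates W k n e \<chi>))"
    using atomic_submodel[OF bW a small_dense[OF W sm a], of k] ..
  have C: "a ` {..<k} \<subseteq> C" "countable C" "elem_sub (sub W C) W"
    "\<And>n e. k \<le> n \<Longrightarrow> range e \<subseteq> C \<Longrightarrow> \<forall>i<k. e i = a i \<Longrightarrow> \<exists>\<chi>. isolates W k n e \<chi>"
    using C' by simp_all
  have notA: "\<not> sub W A \<simeq> sub W N" if N: "a ` {..<k} \<subseteq> N" "elem_sub (sub W N) W" for N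
  proof
    assume "sub W A \<simeq> sub W N"
    then obtain f where f: "iso_map f (sub W N) (sub W A)" using iso_sym iso_iff by blast
    obtain d where d: "env (sub W N) d" using is_bstr_env[OF elem_sub_bstr[OF N(2)]] by blast
    let ?e = "\<lambda>i. if i < k then a i else d i"
    have e: "env (sub W N) ?e" using d N(1) by (auto simp: env_iff)
    have fe: "env (sub W A) (\<lambda>x. f (?e x))" by (rule iso_map_env[OF f e])
    have "tp k W a = tp k W ?e" by (rule tp_cong) simp
    also have "\<dots> = tp k (sub W N) ?e" using elem_sub_tp[OF N(2) e] by simp
    also have "\<dots> = tp k (sub W A) (\<lambda>x. f (?e x))" by (rule tp_iso[OF f e])
    also have "\<dots> = tp k W (\<lambda>x. f (?e x))" by (rule elem_sub_tp[OF A(2) fe])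
    finally have t: "tp k W a = tp k W (\<lambda>x. f (?e x))" .
    obtain \<chi> where "isolates W 0 k (\<lambda>x. f (?e x)) \<chi>" using A(3) fe unfolding env_def by fastforce
    then show False using isolates_tp[OF _ t] nis by blast
  qed
  have "\<not> sub W B \<simeq> sub W C"
  proof
    assume "sub W B \<simeq> sub W C"
    then have ws: "omega_sat (sub W C)" using omega_sat_iso elem_sub_bstr[OF C(3)] B(4) by blast
    have "\<exists>\<chi>. isolates W k (2 * k) e \<chi>" if e: "env W e" "\<forall>i<k. e i = a i" for e
    proof -
      have "\<And>i. i < k \<Longrightarrow> e i \<in> Univ (sub W C)" using e C(1) by auto
      from omega_sat_realize[OF C(3) ws e(1) this, of k "2 * k"]
      obtain e' where e': "env (sub W C) e'" "\<forall>i<k. e' i = e i" "tp (2 * k) W e' = tp (2 * k) W e" by auto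
      have "range e' \<subseteq> C" "\<forall>i<k. e' i = a i" using e' e by (auto simp: env_iff)
      then obtain \<chi> where "isolates W k (2 * k) e' \<chi>" using C(4)[of "2 * k" e'] by auto
      then show ?thesis using isolates_tp[of W k "2 * k" e' \<chi> e] e' by auto
    qed
    from isolated_if_isolated_over[OF W a this] show False using nis by blast
  qed
  then show ?thesis using notA[OF B(1,3)] notA[OF C(1,3)] A B C by blast
qed

section \<open>Rooted trees are axiomatised by one sentence\<close>

abbreviation le_fm :: "nat \<Rightarrow> nat \<Rightarrow> unit fm" where "le_fm x y \<equiv> Rl (Var x) (Var y)"

definition tree_axiom :: "unit fm" where
  "tree_axiom = Conj [Forall 0 (le_fm 0 0),
     Forall 0 (Forall 1 (Imp (And (le_fm 0 1) (le_fm 1 0)) (Eq (Var 0) (Var 1)))),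
     Forall 0 (Forall 1 (Forall 2 (Imp (And (le_fm 0 1) (le_fm 1 2)) (le_fm 0 2)))),
     Forall 0 (Forall 1 (Forall 2 (Imp (And (le_fm 1 0) (le_fm 2 0)) (Or (le_fm 1 2) (le_fm 2 1))))),
     Ex 0 (Forall 1 (le_fm 0 1)),
     Ex 0 (Ex 1 (Neg (Eq (Var 0) (Var 1))))]"

lemma rooted_trees_iff:
  "M \<in> rooted_trees_gt1 \<longleftrightarrow> is_bstr M \<and> (\<forall>x\<in>Univ M. (x, x) \<in> Rel M) \<and>
    (\<forall>x\<in>Univ M. \<forall>y\<in>Univ M. (x, y) \<in> Rel M \<and> (y, x) \<in> Rel M \<longrightarrow> x = y) \<and>
    (\<forall>x\<in>Univ M. \<forall>y\<in>Univ M. \<forall>z\<in>Univ M. (x, y) \<in> Rel M \<and> (y, z) \<in> Rel M \<longrightarrow> (x, z) \<in> Rel M) \<and>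
    (\<forall>x\<in>Univ M. \<forall>y\<in>Univ M. \<forall>z\<in>Univ M. (y, x) \<in> Rel M \<and> (z, x) \<in> Rel M \<longrightarrow> (y, z) \<in> Rel M \<or> (z, y) \<in> Rel M) \<and>
    (\<exists>r\<in>Univ M. \<forall>x\<in>Univ M. (r, x) \<in> Rel M) \<and> (\<exists>x\<in>Univ M. \<exists>y\<in>Univ M. x \<noteq> y)"
proof (cases "is_bstr M")
  case True
  then have sub: "Rel M \<subseteq> Univ M \<times> Univ M" by (simp add: is_bstr_def)
  have 1: "refl_on (Univ M) (Rel M) \<longleftrightarrow> (\<forall>x\<in>Univ M. (x, x) \<in> Rel M)"
    using sub by (auto simp: refl_on_def)
  have 2: "antisym (Rel M) \<longleftrightarrow> (\<forall>x\<in>Univ M. \<forall>y\<in>Univ M. (x, y) \<in> Rel M \<and> (y, x) \<in> Rel M \<longrightarrow> x = y)"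
    using sub unfolding antisym_def by blast
  have 3: "trans (Rel M) \<longleftrightarrow> (\<forall>x\<in>Univ M. \<forall>y\<in>Univ M. \<forall>z\<in>Univ M. (x, y) \<in> Rel M \<and> (y, z) \<in> Rel M \<longrightarrow> (x, z) \<in> Rel M)"
    using sub unfolding trans_def by blast
  have 4: "(\<forall>x\<in>Univ M. total_on {y \<in> Univ M. (y, x) \<in> Rel M} (Rel M)) \<longleftrightarrow>
    (\<forall>x\<in>Univ M. \<forall>y\<in>Univ M. \<forall>z\<in>Univ M. (y, x) \<in> Rel M \<and> (z, x) \<in> Rel M \<longrightarrow> (y, z) \<in> Rel M \<or> (z, y) \<in> Rel M)"
    if r: "\<forall>x\<in>Univ M. (x, x) \<in> Rel M"
  proof (rule ball_cong[OF refl])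
    fix x
    have "total_on {y \<in> Univ M. (y, x) \<in> Rel M} (Rel M) \<longleftrightarrow> (\<forall>y\<in>Univ M. \<forall>z\<in>Univ M. (y, x) \<in> Rel M \<and> (z, x) \<in> Rel M \<longrightarrow>
        y \<noteq> z \<longrightarrow> (y, z) \<in> Rel M \<or> (z, y) \<in> Rel M)" unfolding total_on_def by auto
    also have "\<dots> \<longleftrightarrow> (\<forall>y\<in>Univ M. \<forall>z\<in>Univ M. (y, x) \<in> Rel M \<and> (z, x) \<in> Rel M \<longrightarrow> (y, z) \<in> Rel M \<or> (z, y) \<in> Rel M)"
      using r by metis
    finally show "total_on {y \<in> Univ M. (y, x) \<in> Rel M} (Rel M) \<longleftrightarrow>
      (\<forall>y\<in>Univ M. \<forall>z\<in>Univ M. (y, x) \<in> Rel M \<and> (z, x) \<in> Rel M \<longrightarrow> (y, z) \<in> Rel M \<or> (z, y) \<in> Rel M)" .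
  qed
  have 5: "partial_order_on (Univ M) (Rel M) \<longleftrightarrow> refl_on (Univ M) (Rel M) \<and> antisym (Rel M) \<and> trans (Rel M)"
    using sub by (auto simp: partial_order_on_def preorder_on_def)
  have 6: "M \<in> rooted_trees_gt1 \<longleftrightarrow> (refl_on (Univ M) (Rel M) \<and> antisym (Rel M) \<and> trans (Rel M)) \<and>
      (\<forall>x\<in>Univ M. total_on {y \<in> Univ M. (y, x) \<in> Rel M} (Rel M)) \<and>
      (\<exists>r\<in>Univ M. \<forall>x\<in>Univ M. (r, x) \<in> Rel M) \<and> (\<exists>x\<in>Univ M. \<exists>y\<in>Univ M. x \<noteq> y)"
    unfolding rooted_trees_gt1_def rooted_tree_def tree_def using True by (simp add: 5)
  show ?thesis
  proof (cases "\<forall>x\<in>Univ M. (x, x) \<in> Rel M")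
    case True
    show ?thesis unfolding 6 1 2[symmetric] 3[symmetric] 4[OF True, symmetric] using \<open>is_bstr M\<close> by simp
  next
    case False
    show ?thesis unfolding 6 1 by (simp only: False simp_thms)
  qed
qed (auto simp: rooted_trees_gt1_def rooted_tree_def tree_def)

lemma tree_axiom_iff:
  assumes "is_bstr M" shows "tree_axiom \<in> Th M \<longleftrightarrow> M \<in> rooted_trees_gt1"
proof -
  obtain e where e: "env M e" using is_bstr_env[OF assms] by blast
  have "tree_axiom \<in> formulas {} 0" by (auto simp: tree_axiom_def formulas_def)
  from Th_iff[OF assms this e] show ?thesis
    unfolding rooted_trees_iff using assms by (simp add: tree_axiom_def)
qed

lemma rooted_trees_Th:
  assumes "is_bstr M" "is_bstr N" "Th M = Th N" "M \<in> rooted_trees_gt1"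
  shows "N \<in> rooted_trees_gt1"
  using tree_axiom_iff[OF assms(1)] tree_axiom_iff[OF assms(2)] assms(3,4) by simp

lemma rooted_treesD:
  assumes "M \<in> rooted_trees_gt1"
  shows "is_bstr M" "x \<in> Univ M \<Longrightarrow> (x, x) \<in> Rel M"
    "(x, y) \<in> Rel M \<Longrightarrow> (y, x) \<in> Rel M \<Longrightarrow> x = y"
    "(x, y) \<in> Rel M \<Longrightarrow> (y, z) \<in> Rel M \<Longrightarrow> (x, z) \<in> Rel M"
    "(y, x) \<in> Rel M \<Longrightarrow> (z, x) \<in> Rel M \<Longrightarrow> (y, z) \<in> Rel M \<or> (z, y) \<in> Rel M"
    "\<exists>r\<in>Univ M. \<forall>x\<in>Univ M. (r, x) \<in> Rel M" "\<exists>x\<in>Univ M. \<exists>y\<in>Univ M. x \<noteq> y"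
proof -
  note T = assms[unfolded rooted_trees_iff]
  show b: "is_bstr M" by (rule T[THEN conjunct1])
  then have U: "(x, y) \<in> Rel M \<Longrightarrow> x \<in> Univ M \<and> y \<in> Univ M" for x y by (auto simp: is_bstr_def)
  show "x \<in> Univ M \<Longrightarrow> (x, x) \<in> Rel M" using T[THEN conjunct2, THEN conjunct1] by blast
  show "(x, y) \<in> Rel M \<Longrightarrow> (y, x) \<in> Rel M \<Longrightarrow> x = y"
    using T[THEN conjunct2, THEN conjunct2, THEN conjunct1] U[of x y] by blast
  show "(x, y) \<in> Rel M \<Longrightarrow> (y, z) \<in> Rel M \<Longrightarrow> (x, z) \<in> Rel M"
    using T[THEN conjunct2, THEN conjunct2, THEN conjunct2, THEN conjunct1] U[of x y] U[of y z] by blast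
  show "(y, x) \<in> Rel M \<Longrightarrow> (z, x) \<in> Rel M \<Longrightarrow> (y, z) \<in> Rel M \<or> (z, y) \<in> Rel M"
    using T[THEN conjunct2, THEN conjunct2, THEN conjunct2, THEN conjunct2, THEN conjunct1] U[of y x] U[of z x] by blast
  show "\<exists>r\<in>Univ M. \<forall>x\<in>Univ M. (r, x) \<in> Rel M"
    by (rule T[THEN conjunct2, THEN conjunct2, THEN conjunct2, THEN conjunct2, THEN conjunct2, THEN conjunct1])
  show "\<exists>x\<in>Univ M. \<exists>y\<in>Univ M. x \<noteq> y"
    by (rule T[THEN conjunct2, THEN conjunct2, THEN conjunct2, THEN conjunct2, THEN conjunct2, THEN conjunct2])
qed

section \<open>Branches and decompositions\<close>

definition is_root :: "'a bstr \<Rightarrow> 'a \<Rightarrow> bool" where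
  "is_root M a \<longleftrightarrow> (\<forall>y\<in>Univ M. (a, y) \<in> Rel M)"

text \<open>In a product of rooted trees these are the elements with exactly one coordinate different from
  the root, because two coordinates above the root give incomparable predecessors.\<close>

definition branch :: "'a bstr \<Rightarrow> 'a \<Rightarrow> bool" where
  "branch M a \<longleftrightarrow> \<not> is_root M a \<and> (\<forall>y\<in>Univ M. \<forall>z\<in>Univ M. (y, a) \<in> Rel M \<and> (z, a) \<in> Rel M \<longrightarrow>
     (y, z) \<in> Rel M \<or> (z, y) \<in> Rel M)"

text \<open>Meant for branch elements of a product of trees: on one axis an upper bound makes them comparable,
  and on different axes they are incomparable but have an upper bound.\<close>

definition same :: "'a bstr \<Rightarrow> 'a \<Rightarrow> 'a \<Rightarrow> bool" where
  "same M a b \<longleftrightarrow> (a, b) \<in> Rel M \<or> (b, a) \<in> Rel M \<or> \<not> (\<exists>w\<in>Univ M. (a, w) \<in> Rel M \<and> (b, w) \<in> Rel M)"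

text \<open>When \<open>a\<close> is on the \<open>i\<close>-th axis of a product of trees, this compares the \<open>i\<close>-th coordinates of \<open>x\<close> and
  \<open>y\<close>: the greatest element of the axis below \<open>x\<close> carries the \<open>i\<close>-th coordinate of \<open>x\<close>.\<close>

definition proj_le :: "'a bstr \<Rightarrow> 'a \<Rightarrow> 'a \<Rightarrow> 'a \<Rightarrow> bool" where
  "proj_le M a x y \<longleftrightarrow> (\<forall>z\<in>Univ M. branch M z \<and> same M a z \<and> (z, x) \<in> Rel M \<longrightarrow> (z, y) \<in> Rel M)"

text \<open>A first-order property of an \<open>n\<close>-tuple, which holds in a product of \<open>n\<close> trees for a choice of one
  element on each axis. The first five clauses say that the tuple represents the classes
  of \<open>same\<close> among the branch elements and that \<open>proj_le\<close> depends on the class only; this makes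
  decompositions unique. The last three say that the structure is the product of its
  quotients by the preorders \<open>proj_le\<close>.\<close>

definition decomp :: "'a bstr \<Rightarrow> nat \<Rightarrow> (nat \<Rightarrow> 'a) \<Rightarrow> bool" where
  "decomp Y n as \<longleftrightarrow>
     (\<forall>i<n. branch Y (as i)) \<and>
     (\<forall>i<n. \<forall>j<n. same Y (as i) (as j) \<longrightarrow> i = j) \<and>
     (\<forall>b\<in>Univ Y. branch Y b \<longrightarrow> (\<exists>i<n. same Y (as i) b)) \<and>
     (\<forall>i<n. \<forall>b\<in>Univ Y. \<forall>c\<in>Univ Y. branch Y b \<and> branch Y c \<and> same Y (as i) b \<and> same Y (as i) c \<longrightarrow> same Y b c) \<and>
     (\<forall>i<n. \<forall>b\<in>Univ Y. branch Y b \<and> same Y (as i) b \<longrightarrow>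
        (\<forall>x\<in>Univ Y. \<forall>y\<in>Univ Y. proj_le Y (as i) x y \<longleftrightarrow> proj_le Y b x y)) \<and>
     (\<forall>x\<in>Univ Y. \<forall>y\<in>Univ Y. (x, y) \<in> Rel Y \<longleftrightarrow> (\<forall>i<n. proj_le Y (as i) x y)) \<and>
     (\<forall>x\<in>Univ Y. \<forall>y\<in>Univ Y. (x, y) \<in> Rel Y \<and> (y, x) \<in> Rel Y \<longrightarrow> x = y) \<and>
     (\<forall>xs. env Y xs \<longrightarrow> (\<exists>y\<in>Univ Y. \<forall>i<n. proj_le Y (as i) (xs i) y \<and> proj_le Y (as i) y (xs i)))"

lemma decompD:
  assumes "decomp Y n as"
  shows "i < n \<Longrightarrow> branch Y (as i)"
    "i < n \<Longrightarrow> j < n \<Longrightarrow> same Y (as i) (as j) \<Longrightarrow> i = j"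
    "b \<in> Univ Y \<Longrightarrow> branch Y b \<Longrightarrow> \<exists>i<n. same Y (as i) b"
    "i < n \<Longrightarrow> b \<in> Univ Y \<Longrightarrow> c \<in> Univ Y \<Longrightarrow> branch Y b \<Longrightarrow> branch Y c \<Longrightarrow> same Y (as i) b \<Longrightarrow> same Y (as i) c \<Longrightarrow> same Y b c"
    "i < n \<Longrightarrow> b \<in> Univ Y \<Longrightarrow> branch Y b \<Longrightarrow> same Y (as i) b \<Longrightarrow> x \<in> Univ Y \<Longrightarrow> y \<in> Univ Y \<Longrightarrow>
       proj_le Y (as i) x y \<longleftrightarrow> proj_le Y b x y"
    "x \<in> Univ Y \<Longrightarrow> y \<in> Univ Y \<Longrightarrow> (x, y) \<in> Rel Y \<longleftrightarrow> (\<forall>i<n. proj_le Y (as i) x y)"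
    "x \<in> Univ Y \<Longrightarrow> y \<in> Univ Y \<Longrightarrow> (x, y) \<in> Rel Y \<Longrightarrow> (y, x) \<in> Rel Y \<Longrightarrow> x = y"
    "env Y xs \<Longrightarrow> \<exists>y\<in>Univ Y. \<forall>i<n. proj_le Y (as i) (xs i) y \<and> proj_le Y (as i) y (xs i)"
proof -
  note D = assms[unfolded decomp_def]
  show "i < n \<Longrightarrow> branch Y (as i)" using D[THEN conjunct1] by blast
  show "i < n \<Longrightarrow> j < n \<Longrightarrow> same Y (as i) (as j) \<Longrightarrow> i = j" using D[THEN conjunct2, THEN conjunct1] by blast
  show "b \<in> Univ Y \<Longrightarrow> branch Y b \<Longrightarrow> \<exists>i<n. same Y (as i) b" using D[THEN conjunct2, THEN conjunct2, THEN conjunct1] by blast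
  show "i < n \<Longrightarrow> b \<in> Univ Y \<Longrightarrow> c \<in> Univ Y \<Longrightarrow> branch Y b \<Longrightarrow> branch Y c \<Longrightarrow> same Y (as i) b \<Longrightarrow> same Y (as i) c \<Longrightarrow> same Y b c"
    using D[THEN conjunct2, THEN conjunct2, THEN conjunct2, THEN conjunct1] by blast
  show "i < n \<Longrightarrow> b \<in> Univ Y \<Longrightarrow> branch Y b \<Longrightarrow> same Y (as i) b \<Longrightarrow> x \<in> Univ Y \<Longrightarrow> y \<in> Univ Y \<Longrightarrow>
       proj_le Y (as i) x y \<longleftrightarrow> proj_le Y b x y" using D[THEN conjunct2, THEN conjunct2, THEN conjunct2, THEN conjunct2, THEN conjunct1] by blast
  show "x \<in> Univ Y \<Longrightarrow> y \<in> Univ Y \<Longrightarrow> (x, y) \<in> Rel Y \<longleftrightarrow> (\<forall>i<n. proj_le Y (as i) x y)" using D[THEN conjunct2, THEN conjunct2, THEN conjunct2, THEN conjunct2, THEN conjunct2, THEN conjunct1] by blast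
  show "x \<in> Univ Y \<Longrightarrow> y \<in> Univ Y \<Longrightarrow> (x, y) \<in> Rel Y \<Longrightarrow> (y, x) \<in> Rel Y \<Longrightarrow> x = y" using D[THEN conjunct2, THEN conjunct2, THEN conjunct2, THEN conjunct2, THEN conjunct2, THEN conjunct2, THEN conjunct1] by blast
  show "env Y xs \<Longrightarrow> \<exists>y\<in>Univ Y. \<forall>i<n. proj_le Y (as i) (xs i) y \<and> proj_le Y (as i) y (xs i)" using D[THEN conjunct2, THEN conjunct2, THEN conjunct2, THEN conjunct2, THEN conjunct2, THEN conjunct2, THEN conjunct2] by blast
qed

definition Iff :: "'c fm \<Rightarrow> 'c fm \<Rightarrow> 'c fm" where "Iff \<phi> \<psi> = And (Imp \<phi> \<psi>) (Imp \<psi> \<phi>)"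

definition fRoot :: "nat \<Rightarrow> unit fm" where
  "fRoot a = Forall (Suc a) (le_fm a (Suc a))"

definition fBranch :: "nat \<Rightarrow> unit fm" where
  "fBranch a = And (Neg (fRoot a)) (Forall (Suc a) (Forall (Suc (Suc a))
     (Imp (And (le_fm (Suc a) a) (le_fm (Suc (Suc a)) a)) (Or (le_fm (Suc a) (Suc (Suc a))) (le_fm (Suc (Suc a)) (Suc a))))))"

definition fSame :: "nat \<Rightarrow> nat \<Rightarrow> unit fm" where
  "fSame a b = Or (le_fm a b) (Or (le_fm b a) (Neg (Ex (Suc (a + b)) (And (le_fm a (Suc (a + b))) (le_fm b (Suc (a + b)))))))"

definition fProj_le :: "nat \<Rightarrow> nat \<Rightarrow> nat \<Rightarrow> unit fm" where
  "fProj_le a x y = (let z = Suc (a + x + y) in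
     Forall z (Imp (And (fBranch z) (And (fSame a z) (le_fm z x))) (le_fm z y)))"

definition fDec :: "nat \<Rightarrow> unit fm" where
  "fDec n = Conj [
     Conj (map fBranch [0..<n]),
     Conj (map (\<lambda>i. Conj (map (\<lambda>j. Neg (fSame i j)) (filter (\<lambda>j. i \<noteq> j) [0..<n]))) [0..<n]),
     Forall n (Imp (fBranch n) (Disj (map (\<lambda>i. fSame i n) [0..<n]))),
     Conj (map (\<lambda>i. Forall n (Forall (Suc n) (Imp (And (And (fBranch n) (fBranch (Suc n)))
       (And (fSame i n) (fSame i (Suc n)))) (fSame n (Suc n))))) [0..<n]),
     Conj (map (\<lambda>i. Forall n (Imp (And (fBranch n) (fSame i n)) (Forall (Suc n) (Forall (Suc (Suc n))
       (Iff (fProj_le i (Suc n) (Suc (Suc n))) (fProj_le n (Suc n) (Suc (Suc n)))))))) [0..<n]),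
     Forall n (Forall (Suc n) (Iff (le_fm n (Suc n)) (Conj (map (\<lambda>i. fProj_le i n (Suc n)) [0..<n])))),
     Forall n (Forall (Suc n) (Imp (And (le_fm n (Suc n)) (le_fm (Suc n) n)) (Eq (Var n) (Var (Suc n))))),
     Alls [n..<n + n] (Ex (n + n) (Conj (map (\<lambda>i. And (fProj_le i (n + i) (n + n)) (fProj_le i (n + n) (n + i))) [0..<n])))]"

lemma bsat_Iff [simp]: "bsat M e (Iff \<phi> \<psi>) \<longleftrightarrow> (bsat M e \<phi> \<longleftrightarrow> bsat M e \<psi>)"
  by (auto simp: Iff_def)

lemma bsat_fRoot [simp]: "bsat M e (fRoot a) \<longleftrightarrow> is_root M (e a)"
  by (simp add: fRoot_def is_root_def)

lemma bsat_fBranch [simp]: "bsat M e (fBranch a) \<longleftrightarrow> branch M (e a)"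
  by (simp add: fBranch_def branch_def)

lemma bsat_fSame [simp]: "bsat M e (fSame a b) \<longleftrightarrow> same M (e a) (e b)"
  by (simp add: fSame_def same_def)

lemma bsat_fProj_le [simp]: "bsat M e (fProj_le a x y) \<longleftrightarrow> proj_le M (e a) (e x) (e y)"
  by (simp add: fProj_le_def proj_le_def Let_def)

lemma fv_f [simp]: "fv (fRoot a) = {a}" "fv (fBranch a) = {a}" "fv (fSame a b) = {a, b}" "fv (fProj_le a x y) = {a, x, y}"
  "fv (Iff \<phi> \<psi>) = fv \<phi> \<union> fv \<psi>"
  by (auto simp: fRoot_def fBranch_def fSame_def fProj_le_def Let_def Iff_def)

lemma csts_f [simp]: "csts (fRoot a) = {}" "csts (fBranch a) = {}" "csts (fSame a b) = {}" "csts (fProj_le a x y) = {}"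
  "csts (Iff \<phi> \<psi>) = csts \<phi> \<union> csts \<psi>"
  by (auto simp: fRoot_def fBranch_def fSame_def fProj_le_def Let_def Iff_def)

lemma fDec_formulas: "fDec n \<in> formulas {} n"
  unfolding fDec_def formulas_Conj by (auto simp: formulas_def)

lemma ball_upt: "(\<forall>i\<in>set [0..<n]. Q i) \<longleftrightarrow> (\<forall>i<n. Q i)" "(\<exists>i\<in>set [0..<n]. Q i) \<longleftrightarrow> (\<exists>i<n. Q i)"
  by auto

lemma bsat_Conj8: "bsat M e (Conj [a, b, c, d, f, g, h, k]) \<longleftrightarrow>
    bsat M e a \<and> bsat M e b \<and> bsat M e c \<and> bsat M e d \<and> bsat M e f \<and> bsat M e g \<and> bsat M e h \<and> bsat M e k"
  by simp

lemma bsat_fDec: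
  assumes e: "env Y e" shows "bsat Y e (fDec n) \<longleftrightarrow> decomp Y n e"
proof -
  have 8: "(\<forall>e'. env Y e' \<and> agree (set [n..<n + n]) e e' \<longrightarrow>
      (\<exists>y\<in>Univ Y. \<forall>i\<in>set [0..<n]. proj_le Y (e' i) (e' (n + i)) y \<and> proj_le Y (e' i) y (e' (n + i)))) \<longleftrightarrow>
    (\<forall>xs. env Y xs \<longrightarrow> (\<exists>y\<in>Univ Y. \<forall>i<n. proj_le Y (e i) (xs i) y \<and> proj_le Y (e i) y (xs i)))" (is "?l \<longleftrightarrow> ?r")
  proof
    assume l: ?l
    show ?r
    proof (intro allI impI)
      fix xs assume xs: "env Y xs"
      let ?e = "\<lambda>x. if n \<le> x \<and> x < n + n then xs (x - n) else e x"
      have "env Y ?e" "agree (set [n..<n + n]) e ?e" using xs e by (auto simp: env_iff agree_def)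
      with l obtain y where y: "y \<in> Univ Y" "\<forall>i\<in>set [0..<n]. proj_le Y (?e i) (?e (n + i)) y \<and> proj_le Y (?e i) y (?e (n + i))"
        by blast
      then show "\<exists>y\<in>Univ Y. \<forall>i<n. proj_le Y (e i) (xs i) y \<and> proj_le Y (e i) y (xs i)"
        by (intro bexI[of _ y]) auto
    qed
  next
    assume r: ?r
    show ?l
    proof (intro allI impI, elim conjE)
      fix e' assume e': "env Y e'" "agree (set [n..<n + n]) e e'"
      have "env Y (\<lambda>i. e' (n + i))" using e' by (simp add: env_iff)
      with r obtain y where y: "y \<in> Univ Y" "\<forall>i<n. proj_le Y (e i) (e' (n + i)) y \<and> proj_le Y (e i) y (e' (n + i))"
        by blast
      moreover have "e' i = e i" if "i < n" for i using e'(2) that by (simp add: agree_def)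
      ultimately show "\<exists>y\<in>Univ Y. \<forall>i\<in>set [0..<n]. proj_le Y (e' i) (e' (n + i)) y \<and> proj_le Y (e' i) y (e' (n + i))"
        by (intro bexI[of _ y]) auto
    qed
  qed
  have 1: "bsat Y e (Conj (map fBranch [0..<n])) \<longleftrightarrow> (\<forall>i<n. branch Y (e i))" by auto
  have 2: "bsat Y e (Conj (map (\<lambda>i. Conj (map (\<lambda>j. Neg (fSame i j)) (filter (\<lambda>j. i \<noteq> j) [0..<n]))) [0..<n])) \<longleftrightarrow>
    (\<forall>i<n. \<forall>j<n. same Y (e i) (e j) \<longrightarrow> i = j)" by auto
  have 3: "bsat Y e (Forall n (Imp (fBranch n) (Disj (map (\<lambda>i. fSame i n) [0..<n])))) \<longleftrightarrow>
    (\<forall>b\<in>Univ Y. branch Y b \<longrightarrow> (\<exists>i<n. same Y (e i) b))" by (simp add: ball_upt[unfolded set_upt])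
  have 4: "bsat Y e (Conj (map (\<lambda>i. Forall n (Forall (Suc n) (Imp (And (And (fBranch n) (fBranch (Suc n)))
       (And (fSame i n) (fSame i (Suc n)))) (fSame n (Suc n))))) [0..<n])) \<longleftrightarrow>
    (\<forall>i<n. \<forall>b\<in>Univ Y. \<forall>c\<in>Univ Y. branch Y b \<and> branch Y c \<and> same Y (e i) b \<and> same Y (e i) c \<longrightarrow> same Y b c)"
    by (simp add: ball_upt[unfolded set_upt])
  have 5: "bsat Y e (Conj (map (\<lambda>i. Forall n (Imp (And (fBranch n) (fSame i n)) (Forall (Suc n) (Forall (Suc (Suc n))
       (Iff (fProj_le i (Suc n) (Suc (Suc n))) (fProj_le n (Suc n) (Suc (Suc n)))))))) [0..<n])) \<longleftrightarrow>
    (\<forall>i<n. \<forall>b\<in>Univ Y. branch Y b \<and> same Y (e i) b \<longrightarrow>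
        (\<forall>x\<in>Univ Y. \<forall>y\<in>Univ Y. proj_le Y (e i) x y \<longleftrightarrow> proj_le Y b x y))" by (simp add: ball_upt[unfolded set_upt])
  have 6: "bsat Y e (Forall n (Forall (Suc n) (Iff (le_fm n (Suc n)) (Conj (map (\<lambda>i. fProj_le i n (Suc n)) [0..<n]))))) \<longleftrightarrow>
    (\<forall>x\<in>Univ Y. \<forall>y\<in>Univ Y. (x, y) \<in> Rel Y \<longleftrightarrow> (\<forall>i<n. proj_le Y (e i) x y))" by (simp add: ball_upt[unfolded set_upt])
  have 7: "bsat Y e (Forall n (Forall (Suc n) (Imp (And (le_fm n (Suc n)) (le_fm (Suc n) n)) (Eq (Var n) (Var (Suc n)))))) \<longleftrightarrow>
    (\<forall>x\<in>Univ Y. \<forall>y\<in>Univ Y. (x, y) \<in> Rel Y \<and> (y, x) \<in> Rel Y \<longrightarrow> x = y)" by simp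
  have c8: "bsat Y e (Alls [n..<n + n] (Ex (n + n) (Conj (map (\<lambda>i. And (fProj_le i (n + i) (n + n)) (fProj_le i (n + n) (n + i))) [0..<n])))) \<longleftrightarrow>
    (\<forall>xs. env Y xs \<longrightarrow> (\<exists>y\<in>Univ Y. \<forall>i<n. proj_le Y (e i) (xs i) y \<and> proj_le Y (e i) y (xs i)))"
    unfolding 8[symmetric] bsat_Alls[OF e] by (simp add: ball_upt[unfolded set_upt])
  show ?thesis unfolding fDec_def decomp_def
    by (simp only: bsat_Conj8 1 2 3 4 5 6 7 c8)
qed

lemma decomp_inj:
  assumes as: "decomp Y n as" and bs: "decomp Y m bs" "\<And>i. i < m \<Longrightarrow> bs i \<in> Univ Y"
  shows "\<exists>\<pi>. inj_on \<pi> {..<m} \<and> \<pi> ` {..<m} \<subseteq> {..<n} \<and>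
    (\<forall>i<m. \<forall>x\<in>Univ Y. \<forall>y\<in>Univ Y. proj_le Y (bs i) x y \<longleftrightarrow> proj_le Y (as (\<pi> i)) x y)"
proof -
  have "\<forall>i. \<exists>j. i < m \<longrightarrow> j < n \<and> same Y (as j) (bs i)"
    using decompD(3)[OF as] decompD(1)[OF bs(1)] bs(2) by blast
  then obtain \<pi> where \<pi>: "\<And>i. i < m \<Longrightarrow> \<pi> i < n \<and> same Y (as (\<pi> i)) (bs i)" by metis
  have "inj_on \<pi> {..<m}"
  proof (rule inj_onI)
    fix i j assume ij: "i \<in> {..<m}" "j \<in> {..<m}" "\<pi> i = \<pi> j"
    then have "same Y (bs i) (bs j)"
      using decompD(4)[OF as, of "\<pi> i" "bs i" "bs j"] \<pi>[of i] \<pi>[of j] bs(2) decompD(1)[OF bs(1)] by auto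
    then show "i = j" using decompD(2)[OF bs(1)] ij by auto
  qed
  moreover have "proj_le Y (bs i) x y \<longleftrightarrow> proj_le Y (as (\<pi> i)) x y" if "i < m" "x \<in> Univ Y" "y \<in> Univ Y" for i x y
    using decompD(5)[OF as, of "\<pi> i" "bs i" x y] \<pi>[OF that(1)] bs(2)[OF that(1)] decompD(1)[OF bs(1) that(1)] that
    by auto
  ultimately show ?thesis using \<pi> by (intro exI[of _ \<pi>]) auto
qed

text \<open>Both tuples represent the same classes of branch elements.\<close>

lemma decomp_unique:
  assumes as: "decomp Y n as" "\<And>i. i < n \<Longrightarrow> as i \<in> Univ Y" and bs: "decomp Y m bs" "\<And>i. i < m \<Longrightarrow> bs i \<in> Univ Y"
  shows "n = m \<and> (\<exists>\<pi>. \<pi> permutes {..<n} \<and>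
    (\<forall>i<n. \<forall>x\<in>Univ Y. \<forall>y\<in>Univ Y. proj_le Y (bs i) x y \<longleftrightarrow> proj_le Y (as (\<pi> i)) x y))"
proof -
  obtain \<pi> where \<pi>0: "inj_on \<pi> {..<m} \<and> \<pi> ` {..<m} \<subseteq> {..<n} \<and>
    (\<forall>i<m. \<forall>x\<in>Univ Y. \<forall>y\<in>Univ Y. proj_le Y (bs i) x y \<longleftrightarrow> proj_le Y (as (\<pi> i)) x y)"
    using decomp_inj[OF as(1) bs] ..
  then have \<pi>: "inj_on \<pi> {..<m}" "\<pi> ` {..<m} \<subseteq> {..<n}"
    "\<And>i x y. i < m \<Longrightarrow> x \<in> Univ Y \<Longrightarrow> y \<in> Univ Y \<Longrightarrow> proj_le Y (bs i) x y \<longleftrightarrow> proj_le Y (as (\<pi> i)) x y"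
    by simp_all
  obtain \<rho> where \<rho>0: "inj_on \<rho> {..<n} \<and> \<rho> ` {..<n} \<subseteq> {..<m} \<and>
    (\<forall>i<n. \<forall>x\<in>Univ Y. \<forall>y\<in>Univ Y. proj_le Y (as i) x y \<longleftrightarrow> proj_le Y (bs (\<rho> i)) x y)"
    using decomp_inj[OF bs(1) as] ..
  then have \<rho>: "inj_on \<rho> {..<n}" "\<rho> ` {..<n} \<subseteq> {..<m}" by simp_all
  have nm: "n = m" using card_inj_on_le[OF \<pi>(1,2)] card_inj_on_le[OF \<rho>] by simp
  define \<pi>' where "\<pi>' i = (if i < n then \<pi> i else i)" for i
  have "bij_betw \<pi> {..<n} {..<n}"
    using \<pi>(1,2) nm endo_inj_surj[of "{..<n}" \<pi>] by (auto simp: bij_betw_def)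
  then have "bij_betw \<pi>' {..<n} {..<n}" by (rule bij_betw_cong[THEN iffD1, rotated]) (simp add: \<pi>'_def)
  then have "\<pi>' permutes {..<n}" by (rule bij_imp_permutes) (simp add: \<pi>'_def)
  then show ?thesis using \<pi>(3) nm by (intro conjI exI[of _ \<pi>']) (auto simp: \<pi>'_def)
qed

section \<open>Interpreting the factors\<close>

text \<open>Up to the map \<open>g\<close>, the structure \<open>Z\<close> is the quotient of \<open>Y\<close> by the preorder that \<open>a\<close> defines.\<close>

definition proj_onto :: "'a bstr \<Rightarrow> 'a \<Rightarrow> ('a \<Rightarrow> 'b) \<Rightarrow> 'b bstr \<Rightarrow> bool" where
  "proj_onto Y a g Z \<longleftrightarrow> g ` Univ Y = Univ Z \<and> antisym (Rel Z) \<and>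
     (\<forall>x\<in>Univ Y. \<forall>y\<in>Univ Y. proj_le Y a x y \<longleftrightarrow> (g x, g y) \<in> Rel Z)"

fun shift_var :: "nat \<Rightarrow> 'c trm \<Rightarrow> nat" where
  "shift_var k (Var x) = k + x" | "shift_var k (Cst c) = 0"

text \<open>Variable \<open>p < k\<close> holds the parameter that defines the factor, and the variables of the given
  formula are moved up by \<open>k\<close>. Quantifiers range over the whole product because the projection is
  onto.\<close>

primrec factor_fm :: "nat \<Rightarrow> nat \<Rightarrow> unit fm \<Rightarrow> unit fm" where
  "factor_fm k p Fls = Fls"
| "factor_fm k p (Rl s t) = fProj_le p (shift_var k s) (shift_var k t)"
| "factor_fm k p (Eq s t) = And (fProj_le p (shift_var k s) (shift_var k t)) (fProj_le p (shift_var k t) (shift_var k s))"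
| "factor_fm k p (Imp \<phi> \<psi>) = Imp (factor_fm k p \<phi>) (factor_fm k p \<psi>)"
| "factor_fm k p (Forall x \<phi>) = Forall (k + x) (factor_fm k p \<phi>)"

lemma proj_le_refl: "proj_le Y a x x" by (simp add: proj_le_def)

lemma proj_le_trans: "proj_le Y a x y \<Longrightarrow> proj_le Y a y z \<Longrightarrow> proj_le Y a x z" by (simp add: proj_le_def)

lemma bsat_factor_fm:
  assumes g: "proj_onto Y (e p) g Z" and "p < k" "env Y e" "csts \<phi> = {}"
  shows "bsat Y e (factor_fm k p \<phi>) \<longleftrightarrow> bsat Z (\<lambda>x. g (e (k + x))) \<phi>"
  using assms
proof (induction \<phi> arbitrary: e)
  case (Rl s t)
  then show ?case by (cases s; cases t) (auto simp: proj_onto_def env_iff)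
next
  case (Eq s t)
  have "proj_le Y (e p) x y \<and> proj_le Y (e p) y x \<longleftrightarrow> g x = g y" if "x \<in> Univ Y" "y \<in> Univ Y" for x y
    using Eq.prems(1) that proj_le_refl[of Y "e p"] unfolding proj_onto_def antisym_def by metis
  then show ?case using Eq by (cases s; cases t) (auto simp: env_iff)
next
  case (Forall x \<phi>)
  have "bsat Y (e(k + x := a)) (factor_fm k p \<phi>) \<longleftrightarrow> bsat Z ((\<lambda>x. g (e (k + x)))(x := g a)) \<phi>" if "a \<in> Univ Y" for a
  proof -
    have "(\<lambda>y. g ((e(k + x := a)) (k + y))) = (\<lambda>x. g (e (k + x)))(x := g a)" by (simp add: fun_eq_iff)
    moreover have "bsat Y (e(k + x := a)) (factor_fm k p \<phi>) \<longleftrightarrow> bsat Z (\<lambda>y. g ((e(k + x := a)) (k + y))) \<phi>"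
      by (rule Forall.IH) (use Forall.prems that in \<open>auto intro!: env_upd simp del: fun_upd_apply\<close>, simp add: fun_upd_def)
    ultimately show ?thesis by simp
  qed
  moreover have "Univ Z = g ` Univ Y" using Forall.prems(1) by (simp add: proj_onto_def)
  ultimately show ?case by simp
qed simp_all

lemma factor_fm_formulas:
  assumes "\<phi> \<in> formulas {} m" "p < k" shows "factor_fm k p \<phi> \<in> formulas {} (k + m)"
proof -
  have "fv (factor_fm k p \<phi>) \<subseteq> insert p ((+) k ` fv \<phi>) \<and> csts (factor_fm k p \<phi>) = {}" if "csts \<phi> = {}"
    using that
  proof (induction \<phi>)
    case (Rl s t)
    then show ?case by (cases s; cases t) auto
  next
    case (Eq s t)
    then show ?case by (cases s; cases t) auto
  next
    case (Forall x \<phi>)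
    then have "fv (factor_fm k p \<phi>) \<subseteq> insert p ((+) k ` fv \<phi>)" "csts (factor_fm k p \<phi>) = {}" by auto
    then show ?case by fastforce
  qed auto
  then show ?thesis using assms by (fastforce simp: formulas_def)
qed

lemma proj_onto_cong:
  "(\<And>x y. x \<in> Univ Y \<Longrightarrow> y \<in> Univ Y \<Longrightarrow> proj_le Y b x y \<longleftrightarrow> proj_le Y a x y) \<Longrightarrow> proj_onto Y a g Z \<Longrightarrow> proj_onto Y b g Z"
  by (simp add: proj_onto_def)

lemma proj_onto_unique:
  assumes g: "proj_onto Y a g Z" and h: "proj_onto Y a h Z'" shows "Z \<simeq> Z'"
proof -
  have G: "g ` Univ Y = Univ Z" "\<And>x y. x \<in> Univ Y \<Longrightarrow> y \<in> Univ Y \<Longrightarrow> (g x, g y) \<in> Rel Z \<longleftrightarrow> proj_le Y a x y"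
    using g by (auto simp: proj_onto_def)
  have H: "h ` Univ Y = Univ Z'" "\<And>x y. x \<in> Univ Y \<Longrightarrow> y \<in> Univ Y \<Longrightarrow> (h x, h y) \<in> Rel Z' \<longleftrightarrow> proj_le Y a x y"
    using h by (auto simp: proj_onto_def)
  have eqG: "g x = g y \<longleftrightarrow> proj_le Y a x y \<and> proj_le Y a y x" if "x \<in> Univ Y" "y \<in> Univ Y" for x y
    using g that proj_le_refl[of Y a] unfolding proj_onto_def antisym_def by metis
  have eqH: "h x = h y \<longleftrightarrow> proj_le Y a x y \<and> proj_le Y a y x" if "x \<in> Univ Y" "y \<in> Univ Y" for x y
    using h that proj_le_refl[of Y a] unfolding proj_onto_def antisym_def by metis
  define f where "f z = h (inv_into (Univ Y) g z)" for z
  have f: "f (g x) = h x" if "x \<in> Univ Y" for x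
  proof -
    have "inv_into (Univ Y) g (g x) \<in> Univ Y" "g (inv_into (Univ Y) g (g x)) = g x"
      using that by (auto intro: inv_into_into f_inv_into_f)
    then show ?thesis using eqG eqH that by (simp add: f_def)
  qed
  have "f ` g ` Univ Y = h ` Univ Y" unfolding image_image by (rule image_cong[OF refl f])
  then have "iso_map f Z Z'" unfolding iso_map_def bij_betw_def G(1)[symmetric] H(1)[symmetric]
    by (auto simp: f inj_on_def eqG eqH G(2) H(2))
  then show ?thesis by (auto simp: iso_iff)
qed

lemma iso_proj_le:
  assumes f: "iso_map f M N" and "a \<in> Univ M" "x \<in> Univ M" "y \<in> Univ M"
  shows "proj_le M a x y \<longleftrightarrow> proj_le N (f a) (f x) (f y)"
proof -
  let ?e = "\<lambda>i :: nat. if i = 0 then a else if i = 1 then x else y"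
  have "env M ?e" using assms by (simp add: env_iff)
  from iso_bsat[OF f _ this, of "fProj_le 0 1 2"] show ?thesis by simp
qed

lemma iso_decomp:
  assumes f: "iso_map f M N" and as: "env M as" and "decomp M n as"
  shows "decomp N n (\<lambda>i. f (as i))"
  using iso_bsat[OF f _ as, of "fDec n"] assms bsat_fDec[OF as] bsat_fDec[OF iso_map_env[OF f as]]
    fDec_formulas[of n] by (auto simp: formulas_def)

lemma iso_proj_onto:
  assumes f: "iso_map f M N" and a: "a \<in> Univ M" and g: "proj_onto N (f a) g Z"
  shows "proj_onto M a (g \<circ> f) Z"
proof -
  have "f ` Univ M = Univ N" using f by (simp add: iso_map_def bij_betw_def)
  then have "(g \<circ> f) ` Univ M = Univ Z"
    unfolding image_comp[symmetric] using g by (simp add: proj_onto_def)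
  then show ?thesis using g iso_proj_le[OF f a] iso_map_in[OF f] by (simp add: proj_onto_def)
qed

section \<open>A decomposition splits a structure into a product\<close>

text \<open>The factors are built on representatives of the classes, transported by \<open>h\<close>, so that they can be
  placed on any type into which the universe embeds.\<close>

lemma decomp_product:
  fixes Y :: "'a bstr" and h :: "'a \<Rightarrow> 'b"
  assumes Y: "is_bstr Y" and d: "decomp Y n as" and h: "inj_on h (Univ Y)"
  shows "\<exists>(Zs :: 'b bstr list) g. length Zs = n \<and> (\<forall>i<n. is_bstr (Zs ! i) \<and> proj_onto Y (as i) (g i) (Zs ! i)) \<and>
    iso_map (\<lambda>y. map (\<lambda>i. g i y) [0..<n]) Y (direct_prod Zs)"
proof -
  define eqv where "eqv i x y \<longleftrightarrow> proj_le Y (as i) x y \<and> proj_le Y (as i) y x" for i x y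
  define rep where "rep i y = (SOME x. x \<in> Univ Y \<and> eqv i x y)" for i y
  define g where "g i y = h (rep i y)" for i y
  define Z where "Z i = \<lparr>Univ = g i ` Univ Y, Rel = {(g i x, g i y) | x y. x \<in> Univ Y \<and> y \<in> Univ Y \<and> proj_le Y (as i) x y}\<rparr>" for i
  define Zs where "Zs = map Z [0..<n]"
  have rep: "rep i y \<in> Univ Y" "eqv i (rep i y) y" if "y \<in> Univ Y" for i y
    
  proof -
    have "eqv i y y" by (simp add: eqv_def proj_le_refl)
    then show "rep i y \<in> Univ Y" "eqv i (rep i y) y"
      using someI[of "\<lambda>x. x \<in> Univ Y \<and> eqv i x y" y] that by (auto simp: rep_def)
  qed
  have eq: "g i x = g i y \<longleftrightarrow> eqv i x y" if "x \<in> Univ Y" "y \<in> Univ Y" for i x y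
  proof
    assume "g i x = g i y"
    then have "rep i x = rep i y" using h rep that by (auto simp: g_def inj_on_def)
    then show "eqv i x y" using rep(2)[OF that(1), of i] rep(2)[OF that(2), of i] proj_le_trans by (metis eqv_def)
  next
    assume "eqv i x y"
    then have "eqv i z x \<longleftrightarrow> eqv i z y" for z using proj_le_trans unfolding eqv_def by metis
    then show "g i x = g i y" by (simp add: g_def rep_def)
  qed
  have le: "(g i x, g i y) \<in> Rel (Z i) \<longleftrightarrow> proj_le Y (as i) x y" if "x \<in> Univ Y" "y \<in> Univ Y" for i x y
  proof
    assume "(g i x, g i y) \<in> Rel (Z i)"
    then obtain x' y' where *: "x' \<in> Univ Y" "y' \<in> Univ Y" "proj_le Y (as i) x' y'" "g i x = g i x'" "g i y = g i y'"
      by (auto simp: Z_def)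
    then have "eqv i x x'" "eqv i y y'" using eq that by auto
    then show "proj_le Y (as i) x y" using *(3) proj_le_trans unfolding eqv_def by metis
  qed (use that in \<open>auto simp: Z_def\<close>)
  have "antisym (Rel (Z i))" for i
  proof (rule antisymI)
    fix u v assume uv: "(u, v) \<in> Rel (Z i)" "(v, u) \<in> Rel (Z i)"
    then obtain x y where "x \<in> Univ Y" "y \<in> Univ Y" "u = g i x" "v = g i y" by (auto simp: Z_def)
    then show "u = v" using uv le eq by (auto simp: eqv_def)
  qed
  then have A: "proj_onto Y (as i) (g i) (Z i)" for i
    using le by (simp add: proj_onto_def) (simp add: Z_def)
  have B: "is_bstr (Z i)" for i using Y by (auto simp: is_bstr_def Z_def)
  have C: "iso_map (\<lambda>y. map (\<lambda>i. g i y) [0..<n]) Y (direct_prod Zs)" (is "iso_map ?f _ _")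
  proof -
    have f: "?f y \<in> Univ (direct_prod Zs)" if "y \<in> Univ Y" for y
      using that by (auto simp: in_prod Zs_def Z_def)
    have rel: "(x, y) \<in> Rel Y \<longleftrightarrow> (?f x, ?f y) \<in> Rel (direct_prod Zs)" if "x \<in> Univ Y" "y \<in> Univ Y" for x y
      using f[OF that(1)] f[OF that(2)] le[OF that] decompD(6)[OF d that] by (simp add: rel_prod Zs_def)
    have "inj_on ?f (Univ Y)"
    proof (rule inj_onI)
      fix x y assume xy: "x \<in> Univ Y" "y \<in> Univ Y" "?f x = ?f y"
      then have "\<forall>i<n. eqv i x y" using eq by auto
      then have "(x, y) \<in> Rel Y" "(y, x) \<in> Rel Y" using decompD(6)[OF d] xy by (auto simp: eqv_def)
      then show "x = y" using decompD(7)[OF d] xy by blast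
    qed
    moreover have "u \<in> ?f ` Univ Y" if u: "u \<in> Univ (direct_prod Zs)" for u
    proof -
      have "\<forall>i. \<exists>x. x \<in> Univ Y \<and> (i < n \<longrightarrow> u ! i = g i x)"
      proof
        fix i
        obtain x0 where "x0 \<in> Univ Y" using Y by (auto simp: is_bstr_def)
        moreover have "u ! i \<in> g i ` Univ Y" if "i < n" using u that by (auto simp: in_prod Zs_def Z_def)
        ultimately show "\<exists>x. x \<in> Univ Y \<and> (i < n \<longrightarrow> u ! i = g i x)" by blast
      qed
      then obtain xs where xs: "\<And>i. xs i \<in> Univ Y" "\<And>i. i < n \<Longrightarrow> u ! i = g i (xs i)" by metis
      then obtain y where y: "y \<in> Univ Y" "\<forall>i<n. proj_le Y (as i) (xs i) y \<and> proj_le Y (as i) y (xs i)"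
        using decompD(8)[OF d, of xs] by (auto simp: env_iff)
      then have "u ! i = g i y" if "i < n" for i using xs that eq[of "xs i" y i] by (simp add: eqv_def)
      then have "u = ?f y" using u by (auto simp: in_prod Zs_def intro: nth_equalityI)
      then show ?thesis using y(1) by blast
    qed
    ultimately have "bij_betw ?f (Univ Y) (Univ (direct_prod Zs))" using f by (auto simp: bij_betw_def)
    then show ?thesis using rel by (simp add: iso_map_def)
  qed
  have D: "length Zs = n" "\<And>i. i < n \<Longrightarrow> Zs ! i = Z i" by (simp_all add: Zs_def)
  have "\<forall>i<n. is_bstr (Zs ! i) \<and> proj_onto Y (as i) (g i) (Zs ! i)" using A B D(2) by simp
  then show ?thesis using C D(1) by blast
qed

section \<open>The decomposition of a product of rooted trees\<close>

definition root_of :: "'a bstr \<Rightarrow> 'a" where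
  "root_of M = (SOME r. r \<in> Univ M \<and> (\<forall>x\<in>Univ M. (r, x) \<in> Rel M))"

text \<open>For a product of rooted trees with more than one element each, the axes yield a decomposition
  whose quotients are the given factors.\<close>

locale tree_product =
  fixes Xs :: "'a bstr list"
  assumes trees: "i < length Xs \<Longrightarrow> Xs ! i \<in> rooted_trees_gt1"
begin

abbreviation "P \<equiv> direct_prod Xs"
abbreviation "n \<equiv> length Xs"

lemma factor:
  assumes "i < n"
  shows "is_bstr (Xs ! i)" "x \<in> Univ (Xs ! i) \<Longrightarrow> (x, x) \<in> Rel (Xs ! i)"
    "(x, y) \<in> Rel (Xs ! i) \<Longrightarrow> (y, x) \<in> Rel (Xs ! i) \<Longrightarrow> x = y"
    "(x, y) \<in> Rel (Xs ! i) \<Longrightarrow> (y, z) \<in> Rel (Xs ! i) \<Longrightarrow> (x, z) \<in> Rel (Xs ! i)"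
    "(y, x) \<in> Rel (Xs ! i) \<Longrightarrow> (z, x) \<in> Rel (Xs ! i) \<Longrightarrow> (y, z) \<in> Rel (Xs ! i) \<or> (z, y) \<in> Rel (Xs ! i)"
    "root_of (Xs ! i) \<in> Univ (Xs ! i)" "x \<in> Univ (Xs ! i) \<Longrightarrow> (root_of (Xs ! i), x) \<in> Rel (Xs ! i)"
    "\<exists>x\<in>Univ (Xs ! i). x \<noteq> root_of (Xs ! i)"
proof -
  note T = rooted_treesD[OF trees[OF assms]]
  show "is_bstr (Xs ! i)" by (rule T(1))
  show "x \<in> Univ (Xs ! i) \<Longrightarrow> (x, x) \<in> Rel (Xs ! i)" by (rule T(2))
  show "(x, y) \<in> Rel (Xs ! i) \<Longrightarrow> (y, x) \<in> Rel (Xs ! i) \<Longrightarrow> x = y" by (rule T(3))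
  show "(x, y) \<in> Rel (Xs ! i) \<Longrightarrow> (y, z) \<in> Rel (Xs ! i) \<Longrightarrow> (x, z) \<in> Rel (Xs ! i)" by (rule T(4))
  show "(y, x) \<in> Rel (Xs ! i) \<Longrightarrow> (z, x) \<in> Rel (Xs ! i) \<Longrightarrow> (y, z) \<in> Rel (Xs ! i) \<or> (z, y) \<in> Rel (Xs ! i)"
    by (rule T(5))
  have "\<exists>r. r \<in> Univ (Xs ! i) \<and> (\<forall>x\<in>Univ (Xs ! i). (r, x) \<in> Rel (Xs ! i))" using T(6) by blast
  from someI_ex[OF this] show "root_of (Xs ! i) \<in> Univ (Xs ! i)" "x \<in> Univ (Xs ! i) \<Longrightarrow> (root_of (Xs ! i), x) \<in> Rel (Xs ! i)"
    unfolding root_of_def by blast+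
  show "\<exists>x\<in>Univ (Xs ! i). x \<noteq> root_of (Xs ! i)" using T(7) by metis
qed

lemma factor_root_least: "i < n \<Longrightarrow> (x, root_of (Xs ! i)) \<in> Rel (Xs ! i) \<Longrightarrow> x = root_of (Xs ! i)"
  using factor[of i] by (metis is_bstr_def mem_Sigma_iff subsetD)

lemma bP: "is_bstr P" using factor(1) by (rule is_bstr_prod)

definition emb :: "nat \<Rightarrow> 'a \<Rightarrow> 'a list" where
  "emb i x = map (\<lambda>j. if j = i then x else root_of (Xs ! j)) [0..<n]"

lemma emb_nth [simp]: "j < n \<Longrightarrow> emb i x ! j = (if j = i then x else root_of (Xs ! j))"
  by (simp add: emb_def)

lemma emb_in: "i < n \<Longrightarrow> x \<in> Univ (Xs ! i) \<Longrightarrow> emb i x \<in> Univ P"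
  using factor(6) by (auto simp: in_prod emb_def)

definition on_axis :: "nat \<Rightarrow> 'a list \<Rightarrow> bool" where
  "on_axis i b \<longleftrightarrow> i < n \<and> b \<in> Univ P \<and> b ! i \<noteq> root_of (Xs ! i) \<and> (\<forall>j<n. j \<noteq> i \<longrightarrow> b ! j = root_of (Xs ! j))"

lemma in_PD: "x \<in> Univ P \<Longrightarrow> i < n \<Longrightarrow> x ! i \<in> Univ (Xs ! i)" by (simp add: in_prod)

lemma emb_le: "i < n \<Longrightarrow> b \<in> Univ P \<Longrightarrow> (emb i x, b) \<in> Rel P \<longleftrightarrow> (x, b ! i) \<in> Rel (Xs ! i)"
proof -
  assume i: "i < n" and b: "b \<in> Univ P"
  have "emb i x \<in> Univ P" if "(x, b ! i) \<in> Rel (Xs ! i)"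
    using factor(1)[OF i] that by (intro emb_in[OF i]) (auto simp: is_bstr_def)
  then show ?thesis using i b factor(7) in_PD by (auto simp: rel_prod)
qed

lemma is_root_iff: "b \<in> Univ P \<Longrightarrow> is_root P b \<longleftrightarrow> (\<forall>j<n. b ! j = root_of (Xs ! j))"
proof
  assume b: "b \<in> Univ P" and s: "is_root P b"
  show "\<forall>j<n. b ! j = root_of (Xs ! j)"
  proof (intro allI impI)
    fix j assume j: "j < n"
    then have "(b, emb j (root_of (Xs ! j))) \<in> Rel P" using s emb_in factor(6) by (simp add: is_root_def)
    then show "b ! j = root_of (Xs ! j)" using j factor_root_least by (fastforce simp: rel_prod)
  qed
next
  assume "b \<in> Univ P" "\<forall>j<n. b ! j = root_of (Xs ! j)"
  then show "is_root P b" using factor(7) in_PD by (simp add: is_root_def rel_prod)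
qed

lemma branch_iff: "b \<in> Univ P \<Longrightarrow> branch P b \<longleftrightarrow> (\<exists>i. on_axis i b)"
proof
  assume b: "b \<in> Univ P" and br: "branch P b"
  then obtain i where i: "i < n" "b ! i \<noteq> root_of (Xs ! i)" using is_root_iff by (auto simp: branch_def)
  have "b ! j = root_of (Xs ! j)" if j: "j < n" "j \<noteq> i" for j
  proof (rule ccontr)
    assume nj: "b ! j \<noteq> root_of (Xs ! j)"
    have in1: "emb i (b ! i) \<in> Univ P" "emb j (b ! j) \<in> Univ P" using i j in_PD[OF b] emb_in by auto
    moreover have "(emb i (b ! i), b) \<in> Rel P" "(emb j (b ! j), b) \<in> Rel P"
      using i j b in_PD[OF b] emb_le factor(2) by auto
    ultimately have "(emb i (b ! i), emb j (b ! j)) \<in> Rel P \<or> (emb j (b ! j), emb i (b ! i)) \<in> Rel P"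
      using br by (simp add: branch_def)
    then show False using i j nj factor_root_least emb_le[OF i(1) in1(2)] emb_le[OF j(1) in1(1)] by auto
  qed
  then show "\<exists>i. on_axis i b" using b i by (auto simp: on_axis_def)
next
  assume b: "b \<in> Univ P" and "\<exists>i. on_axis i b"
  then obtain i where i: "on_axis i b" by blast
  have "(y, z) \<in> Rel P \<or> (z, y) \<in> Rel P" if yz: "(y, b) \<in> Rel P" "(z, b) \<in> Rel P" for y z
  proof -
    have r: "y ! j = root_of (Xs ! j)" "z ! j = root_of (Xs ! j)" if "j < n" "j \<noteq> i" for j
      using yz i that factor_root_least[OF that(1)] by (auto simp: rel_prod on_axis_def)
    have U: "y \<in> Univ P" "z \<in> Univ P" using yz by (auto simp: rel_prod)
    have "(y ! i, z ! i) \<in> Rel (Xs ! i) \<or> (z ! i, y ! i) \<in> Rel (Xs ! i)"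
      using yz i factor(5)[of i "y ! i" "b ! i" "z ! i"] by (auto simp: rel_prod on_axis_def)
    moreover have "(y ! j, z ! j) \<in> Rel (Xs ! j)" "(z ! j, y ! j) \<in> Rel (Xs ! j)" if "j < n" "j \<noteq> i" for j
      using r[OF that] factor(2,6) that by auto
    ultimately show ?thesis using U unfolding rel_prod by metis
  qed
  moreover have "\<not> is_root P b" using is_root_iff[OF b] i by (auto simp: on_axis_def)
  ultimately show "branch P b" by (simp add: branch_def)
qed

text \<open>On different axes, combining the two nontrivial coordinates gives an upper bound.\<close>

lemma same_iff:
  assumes a: "on_axis i a" and b: "on_axis j b" shows "same P a b \<longleftrightarrow> i = j"
proof
  assume "i = j"
  have "(a, b) \<in> Rel P \<or> (b, a) \<in> Rel P" if "(a, w) \<in> Rel P" "(b, w) \<in> Rel P" for w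
  proof -
    have "(a ! i, b ! i) \<in> Rel (Xs ! i) \<or> (b ! i, a ! i) \<in> Rel (Xs ! i)"
      using that a factor(5)[of i "a ! i" "w ! i" "b ! i"] by (auto simp: rel_prod on_axis_def)
    moreover have "a ! l = b ! l" "(a ! l, b ! l) \<in> Rel (Xs ! l)" "(b ! l, a ! l) \<in> Rel (Xs ! l)" if "l < n" "l \<noteq> i" for l
      using a b \<open>i = j\<close> that factor(2,6)[OF that(1)] by (auto simp: on_axis_def)
    ultimately show ?thesis using a b unfolding rel_prod on_axis_def by metis
  qed
  then show "same P a b" by (auto simp: same_def)
next
  assume s: "same P a b"
  show "i = j"
  proof (rule ccontr)
    assume ij: "i \<noteq> j"
    let ?w = "map (\<lambda>l. if l = i then a ! i else b ! l) [0..<n]"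
    have w: "?w \<in> Univ P" using a b by (auto simp: in_prod on_axis_def)
    have "(a, ?w) \<in> Rel P" "(b, ?w) \<in> Rel P"
      using a b w factor(2,7) ij in_PD by (auto simp: rel_prod on_axis_def)
    then have "(a, b) \<in> Rel P \<or> (b, a) \<in> Rel P" using s w by (auto simp: same_def)
    then show False using a b ij factor_root_least by (auto simp: rel_prod on_axis_def)
  qed
qed

text \<open>The element of the axis whose \<open>i\<close>-th coordinate is that of \<open>x\<close> is the critical instance of
  the definition.\<close>

lemma proj_le_iff:
  assumes a: "on_axis i a" and x: "x \<in> Univ P" and y: "y \<in> Univ P"
  shows "proj_le P a x y \<longleftrightarrow> (x ! i, y ! i) \<in> Rel (Xs ! i)"
proof
  have i: "i < n" using a by (simp add: on_axis_def)
  assume pr: "proj_le P a x y"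
  show "(x ! i, y ! i) \<in> Rel (Xs ! i)"
  proof (cases "x ! i = root_of (Xs ! i)")
    case True
    then show ?thesis using factor(7)[OF i] in_PD[OF y i] by simp
  next
    case False
    let ?z = "emb i (x ! i)"
    have z: "on_axis i ?z" using i False emb_in in_PD[OF x] by (auto simp: on_axis_def)
    then have "branch P ?z" "same P a ?z" using branch_iff same_iff[OF a z] by (auto simp: on_axis_def)
    moreover have "(?z, x) \<in> Rel P" using emb_le[OF i x] factor(2)[OF i] in_PD[OF x i] by simp
    ultimately have "(?z, y) \<in> Rel P" using pr z by (auto simp: proj_le_def on_axis_def)
    then show ?thesis using emb_le[OF i y] by simp
  qed
next
  assume le: "(x ! i, y ! i) \<in> Rel (Xs ! i)"
  show "proj_le P a x y" unfolding proj_le_def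
  proof (intro ballI impI, elim conjE)
    fix z assume z: "z \<in> Univ P" "branch P z" "same P a z" "(z, x) \<in> Rel P"
    then obtain j where j: "on_axis j z" using branch_iff by blast
    have "on_axis i z" using j same_iff[OF a j] z(3) by simp
    have "(z ! l, y ! l) \<in> Rel (Xs ! l)" if l: "l < n" for l
    proof (cases "l = i")
      case True
      have "(z ! l, x ! l) \<in> Rel (Xs ! l)" using z(4) l by (simp add: rel_prod)
      then show ?thesis using factor(4)[OF l] le True by blast
    next
      case False
      then have "z ! l = root_of (Xs ! l)" using \<open>on_axis i z\<close> l by (simp add: on_axis_def)
      then show ?thesis using factor(7)[OF l] in_PD[OF y l] by simp
    qed
    then show "(z, y) \<in> Rel P" using z(1) y by (simp add: rel_prod)
  qed
qed

definition axis :: "nat \<Rightarrow> 'a list" where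
  "axis i = (if i < n then emb i (SOME x. x \<in> Univ (Xs ! i) \<and> x \<noteq> root_of (Xs ! i)) else (SOME x. x \<in> Univ P))"

lemma on_axis_axis: "i < n \<Longrightarrow> on_axis i (axis i)"
proof -
  assume i: "i < n"
  from factor(8)[OF i] have "\<exists>x. x \<in> Univ (Xs ! i) \<and> x \<noteq> root_of (Xs ! i)" by blast
  from someI_ex[OF this] show ?thesis using i by (simp add: axis_def on_axis_def emb_in)
qed

lemma env_axis: "env P axis"
proof -
  have "(SOME x. x \<in> Univ P) \<in> Univ P" using bP by (auto simp: is_bstr_def intro: someI)
  then have "axis i \<in> Univ P" for i using on_axis_axis by (cases "i < n") (auto simp: on_axis_def axis_def)
  then show ?thesis by (simp add: env_iff)
qed

lemma proj_onto_axis: "on_axis i a \<Longrightarrow> proj_onto P a (\<lambda>x. x ! i) (Xs ! i)"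
proof -
  assume a: "on_axis i a"
  then have i: "i < n" by (simp add: on_axis_def)
  have "(\<lambda>x. x ! i) ` Univ P = Univ (Xs ! i)"
  proof
    show "Univ (Xs ! i) \<subseteq> (\<lambda>x. x ! i) ` Univ P"
    proof
      fix x assume "x \<in> Univ (Xs ! i)"
      then have "emb i x \<in> Univ P" "x = emb i x ! i" using emb_in i by auto
      then show "x \<in> (\<lambda>x. x ! i) ` Univ P" by blast
    qed
  qed (use i in_PD in auto)
  moreover have "antisym (Rel (Xs ! i))" using factor(3)[OF i] by (rule antisymI)
  ultimately show ?thesis using proj_le_iff[OF a] by (simp add: proj_onto_def)
qed

lemma decomp_axis: "decomp P n axis"
  unfolding decomp_def
proof (intro conjI allI ballI impI; (elim conjE)?)
  show "branch P (axis i)" if "i < n" for i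
    using on_axis_axis[OF that] branch_iff by (auto simp: on_axis_def)
  show "i = j" if "i < n" "j < n" "same P (axis i) (axis j)" for i j
    using same_iff[OF on_axis_axis on_axis_axis] that by blast
  show "\<exists>i<n. same P (axis i) b" if "b \<in> Univ P" "branch P b" for b
    using that branch_iff same_iff on_axis_axis by (metis on_axis_def)
  show "same P b c" if "i < n" "b \<in> Univ P" "c \<in> Univ P" "branch P b" "branch P c" "same P (axis i) b" "same P (axis i) c" for i b c
    using that branch_iff same_iff on_axis_axis by metis
  show "proj_le P (axis i) x y \<longleftrightarrow> proj_le P b x y"
    if "i < n" "b \<in> Univ P" "x \<in> Univ P" "y \<in> Univ P" "branch P b" "same P (axis i) b" for i b x y
  proof -
    obtain j where "on_axis j b" using branch_iff[OF \<open>b \<in> Univ P\<close>] \<open>branch P b\<close> by blast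
    then have "on_axis i b" using same_iff[OF on_axis_axis] that by blast
    then show ?thesis using proj_le_iff on_axis_axis that by metis
  qed
  show "(x, y) \<in> Rel P \<longleftrightarrow> (\<forall>i<n. proj_le P (axis i) x y)" if "x \<in> Univ P" "y \<in> Univ P" for x y
    using that proj_le_iff[OF on_axis_axis] by (auto simp: rel_prod)
  show "x = y" if "x \<in> Univ P" "y \<in> Univ P" "(x, y) \<in> Rel P" "(y, x) \<in> Rel P" for x y
    using that factor(3) by (intro prod_ext[of x Xs y]) (auto simp: rel_prod)
  show "\<exists>y\<in>Univ P. \<forall>i<n. proj_le P (axis i) (xs i) y \<and> proj_le P (axis i) y (xs i)" if "env P xs" for xs
  proof
    let ?y = "map (\<lambda>i. xs i ! i) [0..<n]"
    show y: "?y \<in> Univ P" using that in_PD by (intro map_in_prod) (auto simp: env_iff)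
    show "\<forall>i<n. proj_le P (axis i) (xs i) ?y \<and> proj_le P (axis i) ?y (xs i)"
      using that y factor(2) in_PD by (auto simp: proj_le_iff[OF on_axis_axis] env_iff)
  qed
qed

text \<open>Some tuple decomposes \<open>Y\<close>, as this is an existential sentence. Suppose that for no
  permutation \<open>\<pi>\<close> the quotients, taken in the order \<open>\<pi>\<close>, have the theories of the factors, and let
  \<open>\<sigma> \<pi>\<close> be a sentence that holds in the factor \<open>I \<pi>\<close> and fails in the corresponding quotient. The
  product satisfies the sentence that some decomposition makes all the \<open>\<sigma> \<pi>\<close> true in the
  respective quotients. A decomposition of \<open>Y\<close> that witnesses this
  is the first one up to a permutation, which refutes the choice of \<open>\<sigma>\<close> for this permutation.\<close>

theorem prod_decompose:
  fixes Y :: "'y bstr" and h :: "'y \<Rightarrow> 'b"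
  assumes Y: "is_bstr Y" "Th Y = Th P" and h: "inj_on h (Univ Y)"
  shows "\<exists>Zs :: 'b bstr list. length Zs = n \<and> (\<forall>i<n. is_bstr (Zs ! i) \<and> Th (Zs ! i) = Th (Xs ! i)) \<and>
    Y \<simeq> direct_prod Zs"
proof -
  have "\<exists>e. env P e \<and> bsat P e (fDec n)" using bsat_fDec[OF env_axis] decomp_axis env_axis by blast
  then obtain as where as: "env Y as" "bsat Y as (fDec n)"
    using Th_eq_ex[OF bP Y(1) Y(2)[symmetric] fDec_formulas[of n]] by blast
  then have as: "env Y as" "decomp Y n as" using bsat_fDec by blast+
  from decomp_product[OF Y(1) as(2) h] obtain Zs :: "'b bstr list" and g where *: "length Zs = n"
    "\<forall>i<n. is_bstr (Zs ! i) \<and> proj_onto Y (as i) (g i) (Zs ! i)"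
    "iso_map (\<lambda>y. map (\<lambda>i. g i y) [0..<n]) Y (direct_prod Zs)" by (elim exE conjE) (rule that)
  have Zs: "length Zs = n" "\<And>i. i < n \<Longrightarrow> is_bstr (Zs ! i)"
    "\<And>i. i < n \<Longrightarrow> proj_onto Y (as i) (g i) (Zs ! i)" and iso: "Y \<simeq> direct_prod Zs"
    using * by (auto simp: iso_iff)
  have "\<exists>\<pi>. \<pi> permutes {..<n} \<and> (\<forall>i<n. Th (Zs ! \<pi> i) = Th (Xs ! i))"
  proof (rule ccontr)
    assume no: "\<not> ?thesis"
    have "\<exists>i \<sigma>. \<pi> permutes {..<n} \<longrightarrow> i < n \<and> \<sigma> \<in> Th (Xs ! i) \<and> \<sigma> \<notin> Th (Zs ! \<pi> i)" for \<pi>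
    proof (cases "\<pi> permutes {..<n}")
      case True
      then obtain i where i: "i < n" "Th (Zs ! \<pi> i) \<noteq> Th (Xs ! i)" using no by blast
      have "\<pi> i < n" using permutes_in_image[OF True] i by simp
      then have "\<exists>\<sigma>. \<sigma> \<in> Th (Xs ! i) \<and> \<sigma> \<notin> Th (Zs ! \<pi> i)"
        using is_model_Th[OF factor(1)[OF i(1)], of "Zs ! \<pi> i"] Zs(2) i(2) by (auto simp: is_model_def)
      then show ?thesis using i(1) by blast
    qed simp
    then obtain I \<sigma> where I: "\<And>\<pi>. \<pi> permutes {..<n} \<Longrightarrow> I \<pi> < n \<and> \<sigma> \<pi> \<in> Th (Xs ! I \<pi>) \<and> \<sigma> \<pi> \<notin> Th (Zs ! \<pi> (I \<pi>))"
      by metis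
    obtain Ps where Ps: "set Ps = {\<pi>. \<pi> permutes {..<n}}"
      using finite_list[OF finite_permutations[of "{..<n}"]] by auto
    have \<sigma>: "\<sigma> \<pi> \<in> formulas {} 0" if "\<pi> permutes {..<n}" for \<pi> using I[OF that] by (auto simp: Th_def)
    define \<theta> where "\<theta> = And (fDec n) (Conj (map (\<lambda>\<pi>. factor_fm n (I \<pi>) (\<sigma> \<pi>)) Ps))"
    have \<theta>: "\<theta> \<in> formulas {} n"
      using fDec_formulas factor_fm_formulas[OF \<sigma>, of _ _ n] I Ps by (auto simp: \<theta>_def)
    have "bsat P axis \<theta>"
    proof -
      have "bsat P axis (factor_fm n (I \<pi>) (\<sigma> \<pi>))" if "\<pi> permutes {..<n}" for \<pi>
      proof -
        have i: "I \<pi> < n" "\<sigma> \<pi> \<in> Th (Xs ! I \<pi>)" using I[OF that] by auto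
        have "env (Xs ! I \<pi>) (\<lambda>x. axis (n + x) ! I \<pi>)" by (rule env_prod[OF _ i(1)]) (use env_axis in \<open>simp add: env_iff\<close>)
        then show ?thesis
          using bsat_factor_fm[of P axis "I \<pi>" "\<lambda>x. x ! I \<pi>" "Xs ! I \<pi>" n "\<sigma> \<pi>"] proj_onto_axis[OF on_axis_axis[OF i(1)]]
            i \<sigma>[OF that] env_axis Th_iff[OF factor(1)[OF i(1)] \<sigma>[OF that]] by (auto simp: formulas_def)
      qed
      then show ?thesis using bsat_fDec[OF env_axis] decomp_axis Ps by (simp add: \<theta>_def)
    qed
    then obtain bs where bs: "env Y bs" "bsat Y bs \<theta>"
      using Th_eq_ex[OF bP Y(1) Y(2)[symmetric] \<theta>] env_axis by blast
    then have dbs: "decomp Y n bs" using bsat_fDec[OF bs(1), of n] by (simp add: \<theta>_def)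
    obtain \<pi> where \<pi>: "\<pi> permutes {..<n}"
      "\<And>i x y. i < n \<Longrightarrow> x \<in> Univ Y \<Longrightarrow> y \<in> Univ Y \<Longrightarrow> proj_le Y (bs i) x y \<longleftrightarrow> proj_le Y (as (\<pi> i)) x y"
      using decomp_unique[OF as(2) _ dbs] as(1) bs(1) by (auto simp: env_iff)
    let ?i = "I \<pi>"
    have i: "?i < n" "\<sigma> \<pi> \<notin> Th (Zs ! \<pi> ?i)" using I[OF \<pi>(1)] by auto
    have pi: "\<pi> ?i < n" using permutes_in_image[OF \<pi>(1)] i by simp
    have pr: "proj_onto Y (bs ?i) (g (\<pi> ?i)) (Zs ! \<pi> ?i)"
      by (rule proj_onto_cong[OF _ Zs(3)[OF pi]]) (rule \<pi>(2)[OF i(1)])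
    have "env (Zs ! \<pi> ?i) (\<lambda>x. g (\<pi> ?i) (bs (n + x)))" using pr bs(1) by (auto simp: proj_onto_def env_iff)
    moreover have "bsat Y bs (factor_fm n ?i (\<sigma> \<pi>))" using bs(2) Ps \<pi>(1) by (simp add: \<theta>_def)
    ultimately have "\<sigma> \<pi> \<in> Th (Zs ! \<pi> ?i)"
      using bsat_factor_fm[OF pr i(1) bs(1), of "\<sigma> \<pi>"] \<sigma>[OF \<pi>(1)] Th_iff[OF Zs(2)[OF pi] \<sigma>[OF \<pi>(1)]] by (auto simp: formulas_def)
    then show False using i(2) by simp
  qed
  then obtain \<pi> where \<pi>: "\<pi> permutes {..<n}" "\<And>i. i < n \<Longrightarrow> Th (Zs ! \<pi> i) = Th (Xs ! i)" by blast
  let ?Zs = "map (\<lambda>i. Zs ! \<pi> i) [0..<n]"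
  have "direct_prod Zs \<simeq> direct_prod ?Zs"
    by (rule iso_prod_perm[OF \<pi>(1)]) (auto simp: Zs iso_refl)
  then have "Y \<simeq> direct_prod ?Zs" by (rule iso_trans[OF iso])
  moreover have "\<pi> i < n" if "i < n" for i using permutes_in_image[OF \<pi>(1)] that by simp
  ultimately have "length ?Zs = n \<and> (\<forall>i<n. is_bstr (?Zs ! i) \<and> Th (?Zs ! i) = Th (Xs ! i)) \<and> Y \<simeq> direct_prod ?Zs"
    using Zs(2) \<pi>(2) by simp
  then show ?thesis by (rule exI[of _ ?Zs])
qed

end

section \<open>Cardinality of finite products\<close>

lemma listset_ordLeq:
  assumes r: "Card_order r" "infinite (Field r)" and A: "\<forall>A\<in>set As. |A| \<le>o r"
  shows "|listset As| \<le>o r"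
  using A
proof (induction As)
  case Nil
  have "Field r \<noteq> {}" using r(2) by auto
  then have "|{[]}| \<le>o |Field r|" by (rule card_of_singl_ordLeq)
  then show ?case using card_of_Field_ordIso[OF r(1)] ordLeq_ordIso_trans by auto
next
  case (Cons A As)
  then have "|A \<times> listset As| \<le>o r"
    by (intro card_of_Times_ordLeq_infinite_Field[OF r(2) _ _ r(1)]) auto
  moreover have "listset (A # As) = (\<lambda>(x, xs). x # xs) ` (A \<times> listset As)"
    by (auto simp: set_Cons_def)
  ultimately show ?case using card_of_image ordLeq_transitive by metis
qed

text \<open>Needed to bring the factors of a structure on lists back to the type of the elements of the lists.\<close>

lemma inj_lists:
  assumes "infinite (UNIV :: 'a set)" shows "\<exists>h :: 'a list \<Rightarrow> 'a. inj h"
proof -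
  have "|\<Union>k. listset (replicate k (UNIV :: 'a set))| \<le>o |UNIV :: 'a set|"
  proof (rule card_of_UNION_ordLeq_infinite[OF assms])
    show "|UNIV :: nat set| \<le>o |UNIV :: 'a set|" using assms infinite_iff_card_of_nat by blast
    show "\<forall>k\<in>UNIV. |listset (replicate k (UNIV :: 'a set))| \<le>o |UNIV :: 'a set|"
      using assms by (intro ballI listset_ordLeq) (auto simp: card_of_card_order_on Field_card_of split: if_splits intro: card_of_mono1)
  qed
  moreover have "(\<Union>k. listset (replicate k (UNIV :: 'a set))) = UNIV"
    by (auto simp: listset_iff)
  ultimately show ?thesis by (auto simp: card_of_ordLeq[symmetric])
qed

section \<open>The direct product and the rooted trees form a perfect pair\<close>

lemma nth_forall: "set Xs \<subseteq> C \<Longrightarrow> i < length Xs \<Longrightarrow> Xs ! i \<in> C"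
  by auto

lemma card_bounds_prod: "card_bounds (direct_prod :: 'a bstr list \<Rightarrow> 'a list bstr)"
  unfolding card_bounds_def
proof (intro allI impI, elim conjE)
  fix Xs :: "'a bstr list" assume X: "\<forall>X\<in>set Xs. is_bstr X"
  then have "is_bstr (direct_prod Xs)" by (intro is_bstr_prod) simp
  moreover have "|listset (map Univ Xs)| =o |Univ (direct_prod Xs)|"
    by (simp add: direct_prod_def card_of_refl)
  ultimately show "is_bstr (direct_prod Xs) \<and>
     ( |SIGMA i:{..<length Xs}. Univ (Xs ! i)| \<le>o |Univ (direct_prod Xs)| \<or>
       |listset (map Univ Xs)| \<le>o |Univ (direct_prod Xs)| ) \<and>
     ( |Univ (direct_prod Xs)| \<le>o |SIGMA i:{..<length Xs}. Univ (Xs ! i)| \<or>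
       |Univ (direct_prod Xs)| \<le>o |listset (map Univ Xs)| )"
    using ordIso_iff_ordLeq by blast
qed

text \<open>The isomorphism carries the decomposition of one product to a decomposition of the other, and
  isomorphic factors are the quotients for corresponding parameters.\<close>

theorem prod_iso_iff:
  fixes Xs :: "'a bstr list" and Ys :: "'b bstr list"
  assumes X: "set Xs \<subseteq> rooted_trees_gt1" and Y: "set Ys \<subseteq> rooted_trees_gt1"
  shows "direct_prod Xs \<simeq> direct_prod Ys \<longleftrightarrow> length Xs = length Ys \<and>
    (\<exists>\<pi>. \<pi> permutes {..<length Xs} \<and> (\<forall>i<length Xs. Xs ! i \<simeq> Ys ! \<pi> i))"
proof
  assume "length Xs = length Ys \<and> (\<exists>\<pi>. \<pi> permutes {..<length Xs} \<and> (\<forall>i<length Xs. Xs ! i \<simeq> Ys ! \<pi> i))"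
  then obtain \<pi> where \<pi>: "length Xs = length Ys" "\<pi> permutes {..<length Xs}" "\<forall>i<length Xs. Xs ! i \<simeq> Ys ! \<pi> i"
    by blast
  have "direct_prod Ys \<simeq> direct_prod Xs"
    by (rule iso_prod_perm[OF \<pi>(2)]) (use \<pi> iso_sym in auto)
  then show "direct_prod Xs \<simeq> direct_prod Ys" by (rule iso_sym)
next
  assume "direct_prod Xs \<simeq> direct_prod Ys"
  then obtain f where f: "iso_map f (direct_prod Xs) (direct_prod Ys)" using iso_iff by blast
  interpret X: tree_product Xs using X by unfold_locales auto
  interpret Y: tree_product Ys using Y by unfold_locales auto
  have ax: "X.axis i \<in> Univ X.P" "Y.axis i \<in> Univ Y.P" "f (X.axis i) \<in> Univ Y.P" for i
    using X.env_axis Y.env_axis iso_map_in[OF f] by (auto simp: env_iff)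
  have d: "decomp Y.P X.n (\<lambda>i. f (X.axis i))" by (rule iso_decomp[OF f X.env_axis X.decomp_axis])
  from decomp_unique[OF Y.decomp_axis ax(2) d ax(3)] obtain \<pi> where n: "Y.n = X.n" and
    \<pi>: "\<pi> permutes {..<Y.n}" "\<forall>i<Y.n. \<forall>x\<in>Univ Y.P. \<forall>y\<in>Univ Y.P.
      proj_le Y.P (f (X.axis i)) x y \<longleftrightarrow> proj_le Y.P (Y.axis (\<pi> i)) x y"
    by (elim conjE exE) (rule that)
  have "Xs ! i \<simeq> Ys ! \<pi> i" if i: "i < X.n" for i
  proof -
    have "\<pi> i < Y.n" using permutes_in_image[OF \<pi>(1)] i n by simp
    then have "proj_onto Y.P (Y.axis (\<pi> i)) (\<lambda>x. x ! \<pi> i) (Ys ! \<pi> i)"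
      by (intro Y.proj_onto_axis Y.on_axis_axis)
    then have "proj_onto Y.P (f (X.axis i)) (\<lambda>x. x ! \<pi> i) (Ys ! \<pi> i)"
      by (rule proj_onto_cong[rotated]) (use \<pi>(2) i n in auto)
    from proj_onto_unique[OF X.proj_onto_axis[OF X.on_axis_axis[OF i]] iso_proj_onto[OF f ax(1) this]]
    show ?thesis .
  qed
  then show "length Xs = length Ys \<and> (\<exists>\<pi>. \<pi> permutes {..<length Xs} \<and> (\<forall>i<length Xs. Xs ! i \<simeq> Ys ! \<pi> i))"
    using n \<pi>(1) by auto
qed

theorem prod_equiv_iff:
  fixes Xs :: "'a bstr list" and Y :: "'a list bstr"
  assumes X: "set Xs \<subseteq> rooted_trees_gt1" and Y: "is_bstr Y"
  shows "elem_equiv Y (direct_prod Xs) \<longleftrightarrow> (\<exists>Zs :: 'a bstr list. length Zs = length Xs \<and>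
    (\<forall>i<length Xs. is_bstr (Zs ! i) \<and> elem_equiv (Zs ! i) (Xs ! i)) \<and> Y \<simeq> direct_prod Zs)"
  unfolding elem_equiv_iff
proof
  interpret tree_product Xs using X by unfold_locales auto
  assume T: "Th Y = Th P"
  show "\<exists>Zs :: 'a bstr list. length Zs = n \<and> (\<forall>i<n. is_bstr (Zs ! i) \<and> Th (Zs ! i) = Th (Xs ! i)) \<and> Y \<simeq> direct_prod Zs"
  proof (cases "infinite (UNIV :: 'a set)")
    case True
    then obtain h :: "'a list \<Rightarrow> 'a" where "inj h" using inj_lists by blast
    then have "inj_on h (Univ Y)" by (rule inj_on_subset) simp
    from prod_decompose[OF Y T this] show ?thesis .
  next
    \<comment> \<open>Over a finite type the factors are finite, hence determined up to isomorphism.\<close>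
    case False
    obtain Zs :: "'a list bstr list" where Zs: "length Zs = n"
      "\<forall>i<n. is_bstr (Zs ! i) \<and> Th (Zs ! i) = Th (Xs ! i)" "Y \<simeq> direct_prod Zs"
      using prod_decompose[OF Y T inj_on_id] by (elim exE conjE) (rule that)
    have "Zs ! i \<simeq> Xs ! i" if "i < n" for i
    proof -
      have "finite (Univ (Xs ! i))" using False by (metis finite_subset subset_UNIV)
      then have "Xs ! i \<simeq> Zs ! i" using finite_Th_iso[OF factor(1)[OF that], of "Zs ! i"] Zs(2) that by simp
      then show ?thesis by (rule iso_sym)
    qed
    then have "direct_prod Zs \<simeq> direct_prod Xs" using Zs(1) by (intro iso_prod) auto
    then have "Y \<simeq> direct_prod Xs" using Zs(3) iso_trans by blast
    then show ?thesis using factor(1) by (intro exI[of _ Xs]) auto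
  qed
next
  interpret tree_product Xs using X by unfold_locales auto
  assume "\<exists>Zs :: 'a bstr list. length Zs = n \<and> (\<forall>i<n. is_bstr (Zs ! i) \<and> Th (Zs ! i) = Th (Xs ! i)) \<and> Y \<simeq> direct_prod Zs"
  then obtain Zs :: "'a bstr list" where Zs: "length Zs = n"
    "\<And>i. i < n \<Longrightarrow> is_bstr (Zs ! i)" "\<And>i. i < n \<Longrightarrow> Th (Zs ! i) = Th (Xs ! i)" "Y \<simeq> direct_prod Zs" by auto
  have "is_bstr (direct_prod Zs)" using Zs by (intro is_bstr_prod) auto
  then have "Th Y = Th (direct_prod Zs)" using iso_Th[OF Zs(4) Y] by blast
  also have "\<dots> = Th P" by (rule prod_Th[OF Zs(1) refl Zs(2) factor(1) Zs(3)])
  finally show "Th Y = Th P" .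
qed

context tree_product
begin

text \<open>Being decomposed is a first-order property, so \<open>E\<close> contains parameters of a decomposition of
  the whole product. For them \<open>proj_le\<close> means the same in \<open>E\<close> and in the product. So the
  projections of \<open>E\<close> are quotients of \<open>E\<close>, interpreted by the same formulas as the factors are
  in the product, hence elementary submodels of the factors; and \<open>E\<close> contains every
  combination of coordinates of its elements.\<close>

lemma elem_sub_decompose:
  assumes E: "elem_sub E P"
  shows "\<exists>Es. length Es = n \<and> (\<forall>i<n. elem_sub (Es ! i) (Xs ! i)) \<and> E = direct_prod Es"
proof -
  have bE: "is_bstr E" using elem_sub_bstr[OF E] .
  have TE: "Th P = Th E" using elem_sub_Th[OF E bP] by simp
  have "\<exists>e. env P e \<and> bsat P e (fDec n)" using bsat_fDec[OF env_axis] decomp_axis env_axis by blast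
  then obtain as where as: "env E as" "bsat E as (fDec n)"
    using Th_eq_ex[OF bP bE TE fDec_formulas[of n]] by blast
  have dE: "decomp E n as" using as bsat_fDec by blast
  have asP: "env P as" by (rule elem_sub_env[OF E as(1)])
  have "bsat P as (fDec n)"
    using elem_sub_bsat[OF E as(1), of "fDec n"] as(2) fDec_formulas[of n] by (auto simp: formulas_def)
  then have dP: "decomp P n as" using bsat_fDec[OF asP] by blast
  have U: "axis i \<in> Univ P" "as i \<in> Univ P" for i using env_axis asP by (auto simp: env_iff)
  obtain \<pi> where \<pi>: "\<pi> permutes {..<n}" "\<forall>i<n. \<forall>x\<in>Univ P. \<forall>y\<in>Univ P.
      proj_le P (axis i) x y \<longleftrightarrow> proj_le P (as (\<pi> i)) x y"
    using decomp_unique[OF dP U(2) decomp_axis U(1)] by (elim conjE exE) (rule that)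
  define bs where "bs i = as (\<pi> i)" for i
  have bs: "bs i \<in> Univ E" for i using as(1) by (simp add: bs_def env_iff)
  have sub: "Univ E \<subseteq> Univ P" "Rel E = Rel P \<inter> (Univ E \<times> Univ E)" using E by (auto simp: elem_sub_def)
  have le: "proj_le E (bs i) x y \<longleftrightarrow> (x ! i, y ! i) \<in> Rel (Xs ! i)" if i: "i < n" "x \<in> Univ E" "y \<in> Univ E" for i x y
  proof -
    let ?e = "\<lambda>j :: nat. if j = 0 then bs i else if j = 1 then x else y"
    have "env E ?e" using bs that by (simp add: env_iff)
    from elem_sub_bsat[OF E this, of "fProj_le 0 1 2"] have "proj_le E (bs i) x y \<longleftrightarrow> proj_le P (bs i) x y" by simp
    also have "\<dots> \<longleftrightarrow> proj_le P (axis i) x y" using \<pi>(2) that sub(1) by (auto simp: bs_def)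
    also have "\<dots> \<longleftrightarrow> (x ! i, y ! i) \<in> Rel (Xs ! i)" using proj_le_iff[OF on_axis_axis[OF i(1)]] that sub(1) by auto
    finally show ?thesis .
  qed
  define F where "F i = sub (Xs ! i) ((\<lambda>x. x ! i) ` Univ E)" for i
  have FX: "Univ (F i) \<subseteq> Univ (Xs ! i)" if "i < n" for i using sub(1) in_PD that by (auto simp: F_def)
  have pr: "proj_onto E (bs i) (\<lambda>x. x ! i) (F i)" if i: "i < n" for i
  proof -
    have "antisym (Rel (F i))" using factor(3)[OF i] by (auto simp: F_def sub_def intro!: antisymI)
    moreover have "(x ! i, y ! i) \<in> Rel (F i) \<longleftrightarrow> (x ! i, y ! i) \<in> Rel (Xs ! i)" if "x \<in> Univ E" "y \<in> Univ E" for x y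
      using that by (auto simp: F_def sub_def)
    ultimately show ?thesis using le[OF i] by (simp add: proj_onto_def) (simp add: F_def)
  qed
  have el: "elem_sub (F i) (Xs ! i)" if i: "i < n" for i
    unfolding elem_sub_def
  proof (intro conjI allI impI; (elim conjE)?)
    show "is_bstr (F i)" using bE by (auto simp: is_bstr_def F_def sub_def)
    show "Univ (F i) \<subseteq> Univ (Xs ! i)" by (rule FX[OF i])
    show "Rel (F i) = Rel (Xs ! i) \<inter> (Univ (F i) \<times> Univ (F i))" by (simp add: F_def sub_def)
    fix \<phi> :: "unit fm" and e :: "nat \<Rightarrow> 'a" assume \<phi>: "csts \<phi> = {}" and e: "range e \<subseteq> Univ (F i)"
    have "\<forall>x. \<exists>u. u \<in> Univ E \<and> e x = u ! i"
    proof
      fix x have "e x \<in> (\<lambda>x. x ! i) ` Univ E" using e by (auto simp: F_def)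
      then show "\<exists>u. u \<in> Univ E \<and> e x = u ! i" by blast
    qed
    then obtain u where u: "\<And>x. u x \<in> Univ E" "\<And>x. e x = u x ! i" by metis
    have e_eq: "e = (\<lambda>x. u x ! i)" using u(2) by auto
    let ?e = "\<lambda>x. if x = 0 then bs i else u (x - 1)"
    have eE: "env E ?e" using u bs by (simp add: env_iff)
    have "bsat E ?e (factor_fm 1 0 \<phi>) \<longleftrightarrow> bsat (F i) e \<phi>"
      using bsat_factor_fm[of E ?e 0 "\<lambda>x. x ! i" "F i" 1 \<phi>] pr[OF i] eE \<phi> by (simp add: e_eq)
    moreover have "bsat P ?e (factor_fm 1 0 \<phi>) \<longleftrightarrow> bsat (Xs ! i) e \<phi>"
    proof -
      have "proj_onto P (bs i) (\<lambda>x. x ! i) (Xs ! i)"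
        by (rule proj_onto_cong[OF _ proj_onto_axis[OF on_axis_axis[OF i]]]) (use \<pi>(2) i in \<open>auto simp: bs_def\<close>)
      then show ?thesis
        using bsat_factor_fm[of P ?e 0 "\<lambda>x. x ! i" "Xs ! i" 1 \<phi>] elem_sub_env[OF E eE] \<phi> by (simp add: e_eq)
    qed
    moreover have "bsat E ?e (factor_fm 1 0 \<phi>) \<longleftrightarrow> bsat P ?e (factor_fm 1 0 \<phi>)"
    proof (rule elem_sub_bsat[OF E eE])
      obtain m where "\<phi> \<in> formulas {} m" using formulas_exists[of \<phi> "{}"] \<phi> by auto
      then show "csts (factor_fm 1 0 \<phi>) = {}" using factor_fm_formulas[of \<phi> m 0 1] by (auto simp: formulas_def)
    qed
    ultimately show "bsat (F i) e \<phi> \<longleftrightarrow> bsat (Xs ! i) e \<phi>" by simp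
  qed
  let ?Es = "map F [0..<n]"
  have UE: "Univ E = Univ (direct_prod ?Es)"
  proof
    show "Univ E \<subseteq> Univ (direct_prod ?Es)" using sub(1) by (auto simp: in_prod F_def)
    show "Univ (direct_prod ?Es) \<subseteq> Univ E"
    proof
      fix y assume y: "y \<in> Univ (direct_prod ?Es)"
      have "\<forall>i. \<exists>u. u \<in> Univ E \<and> (i < n \<longrightarrow> y ! i = u ! i)"
      proof
        fix i
        have "y ! i \<in> (\<lambda>x. x ! i) ` Univ E" if "i < n" using y that by (auto simp: in_prod F_def)
        then show "\<exists>u. u \<in> Univ E \<and> (i < n \<longrightarrow> y ! i = u ! i)" using bE by (auto simp: is_bstr_def)
      qed
      then obtain u where u: "\<And>i. u i \<in> Univ E" "\<And>i. i < n \<Longrightarrow> y ! i = u i ! i" by metis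
      have "env E (\<lambda>j. u (inv \<pi> j))" using u by (simp add: env_iff)
      from decompD(8)[OF dE this] obtain v where v: "v \<in> Univ E"
        "\<forall>j<n. proj_le E (as j) (u (inv \<pi> j)) v \<and> proj_le E (as j) v (u (inv \<pi> j))" by blast
      have "v ! i = y ! i" if i: "i < n" for i
      proof -
        have "\<pi> i < n" using permutes_in_image[OF \<pi>(1)] i by simp
        then have "proj_le E (bs i) (u i) v \<and> proj_le E (bs i) v (u i)"
          using v(2) permutes_inverses[OF \<pi>(1)] by (auto simp: bs_def)
        then show ?thesis using le[OF i] u v(1) factor(3)[OF i] i by auto
      qed
      moreover have "length v = n" "length y = n" using v(1) sub(1) y by (auto simp: in_prod)
      ultimately have "v = y" by (intro nth_equalityI) auto
      then show "y \<in> Univ E" using v(1) by simp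
    qed
  qed
  have "Rel E = Rel (direct_prod ?Es)"
  proof -
    have "elem_sub (direct_prod ?Es) P" by (rule elem_sub_prod[of _ n]) (auto simp: el)
    then show ?thesis using sub(2) UE by (simp add: elem_sub_def)
  qed
  then have "E = direct_prod ?Es" using UE by (cases E, cases "direct_prod ?Es") simp
  then show ?thesis using el by (intro exI[of _ ?Es]) auto
qed

end

theorem perfect_pair:
  "Perf (direct_prod :: 'a bstr list \<Rightarrow> 'a list bstr) rooted_trees_gt1"
  unfolding Perf_def
proof (intro conjI allI impI ballI card_bounds_prod; (elim conjE)?)
  show "is_bstr X" if "X \<in> rooted_trees_gt1" for X :: "'a bstr" using rooted_treesD(1)[OF that] .
  show "closed_under_equiv (rooted_trees_gt1 :: 'a bstr set)"
    unfolding closed_under_equiv_def elem_equiv_iff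
    using rooted_trees_Th rooted_treesD(1) by metis
  show "direct_prod Xs \<simeq> direct_prod Ys \<longleftrightarrow> length Xs = length Ys \<and>
      (\<exists>\<pi>. \<pi> permutes {..<length Xs} \<and> (\<forall>i<length Xs. Xs ! i \<simeq> Ys ! \<pi> i))"
    if "set Xs \<subseteq> rooted_trees_gt1" "set Ys \<subseteq> rooted_trees_gt1" for Xs Ys :: "'a bstr list"
    using prod_iso_iff[OF that] .
  show "elem_equiv Y (direct_prod Xs) \<longleftrightarrow> (\<exists>Zs :: 'a bstr list. length Zs = length Xs \<and>
      (\<forall>i<length Xs. is_bstr (Zs ! i) \<and> elem_equiv (Zs ! i) (Xs ! i)) \<and> Y \<simeq> direct_prod Zs)"
    if "set Xs \<subseteq> rooted_trees_gt1" "is_bstr Y" for Xs :: "'a bstr list" and Y :: "'a list bstr"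
    using prod_equiv_iff[OF that] .
  show "elem_sub E (direct_prod Xs) \<longleftrightarrow> (\<exists>Es. length Es = length Xs \<and>
      (\<forall>i<length Xs. elem_sub (Es ! i) (Xs ! i)) \<and> E = direct_prod Es)"
    if "set Xs \<subseteq> rooted_trees_gt1" for Xs :: "'a bstr list" and E :: "'a list bstr"
  proof
    interpret tree_product Xs using that by unfold_locales auto
    show "elem_sub E P \<Longrightarrow> \<exists>Es. length Es = n \<and> (\<forall>i<n. elem_sub (Es ! i) (Xs ! i)) \<and> E = direct_prod Es"
      by (rule elem_sub_decompose)
  qed (use elem_sub_prod in blast)
qed

theorem perfect_pair_s:
  "Perf_s TYPE('k) (direct_prod :: 'a bstr list \<Rightarrow> 'a list bstr) rooted_trees_gt1"
  unfolding Perf_s_def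
proof (intro conjI perfect_pair allI impI, elim conjE)
  fix Xs :: "'a bstr list" and \<kappa> :: "'k rel"
  assume X: "set Xs \<subseteq> rooted_trees_gt1" and s: "\<forall>X\<in>set Xs. saturated \<kappa> X"
  show "saturated \<kappa> (direct_prod Xs)"
  proof (rule saturated_prod)
    show "is_bstr (Xs ! i)" if "i < length Xs" for i using rooted_treesD(1)[OF nth_forall[OF X that]] .
    show "saturated \<kappa> (Xs ! i)" if "i < length Xs" for i using s that by simp
  qed
qed

section \<open>Isomorphism types of countable models\<close>

definition has_finite :: "unit fm set \<Rightarrow> bool" where
  "has_finite T \<longleftrightarrow> (\<exists>M :: nat bstr. is_model M T \<and> finite (Univ M))"

definition niso :: "unit fm set \<Rightarrow> (nat bstr \<times> nat bstr) set" where
  "niso T = {(M, N). M \<in> omega_models T \<and> N \<in> omega_models T \<and> M \<simeq> N}"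

text \<open>If there is a finite model, the set \<open>{}\<close> stands for the only isomorphism type, in accordance with
  the definition of the number of models. In both cases the isomorphism types are the values of
  \<open>iso_type\<close> on the models, and two models have the same value iff they are isomorphic.\<close>

definition iso_types :: "unit fm set \<Rightarrow> nat bstr set set" where
  "iso_types T = (if has_finite T then {{}} else omega_models T // niso T)"

definition iso_type :: "unit fm set \<Rightarrow> nat bstr \<Rightarrow> nat bstr set" where
  "iso_type T M = (if has_finite T then {} else niso T `` {M})"

lemma num_models_eq: "num_models T = |iso_types T|"
  unfolding num_models_def iso_types_def has_finite_def niso_def by (simp only: if_distrib[of card_of])

lemma equiv_niso: "equiv (omega_models T) (niso T)"
proof (rule equivI)
  show "niso T \<subseteq> omega_models T \<times> omega_models T" by (auto simp: niso_def)
  show "refl_on (omega_models T) (niso T)" by (auto simp: refl_on_def niso_def iso_refl)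
  show "sym (niso T)" by (auto simp: sym_def niso_def iso_sym)
  show "trans (niso T)" by (auto simp: trans_def niso_def intro: iso_trans)
qed

context
  fixes K :: "'k bstr" and T :: "unit fm set"
  assumes K: "is_bstr K" and T: "T = Th K"
begin

lemma iso_type_eq:
  assumes "is_bstr M" "Th M = T" "is_bstr N" "Th N = T"
  shows "iso_type T M = iso_type T N \<longleftrightarrow> M \<simeq> N"
proof (cases "has_finite T")
  case True
  then obtain F :: "nat bstr" where F: "is_bstr F" "Th F = T" "finite (Univ F)"
    using is_model_Th[OF K] T by (auto simp: has_finite_def)
  have "F \<simeq> M" "F \<simeq> N" using finite_Th_iso[OF F(1) _ _ F(3)] F(2) assms by auto
  then have "M \<simeq> N" using iso_trans iso_sym by blast
  then show ?thesis using True by (simp add: iso_type_def)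
next
  case False
  have "M \<in> omega_models T" "N \<in> omega_models T"
    using False assms is_model_Th[OF K] T by (auto simp: omega_models_def has_finite_def)
  then show ?thesis using False eq_equiv_class_iff[OF equiv_niso] by (auto simp: iso_type_def niso_def)
qed

lemma iso_type_in:
  assumes "is_bstr M" "Th M = T" shows "iso_type T M \<in> iso_types T"
proof (cases "has_finite T")
  case False
  have "M \<in> omega_models T"
    using False assms is_model_Th[OF K] T by (auto simp: omega_models_def has_finite_def)
  then show ?thesis using False by (auto simp: iso_type_def iso_types_def intro: quotientI)
qed (simp add: iso_type_def iso_types_def)

lemma iso_typesE:
  assumes "k \<in> iso_types T" obtains M where "is_bstr M" "Th M = T" "k = iso_type T M"
proof (cases "has_finite T")
  case True
  then obtain F :: "nat bstr" where "is_bstr F" "Th F = T"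
    using is_model_Th[OF K] T by (auto simp: has_finite_def)
  then show ?thesis using that True assms by (auto simp: iso_type_def iso_types_def)
next
  case False
  then obtain M where "M \<in> omega_models T" "k = niso T `` {M}"
    using assms by (auto simp: iso_types_def elim: quotientE)
  then show ?thesis using that False is_model_Th[OF K] T by (auto simp: omega_models_def iso_type_def)
qed

lemma iso_types_nonempty: "iso_types T \<noteq> {}"
  using countable_nat_model[OF K] iso_type_in T by blast

end

text \<open>A type is realised in the ultrapower, and then in a countable elementary submodel of it.\<close>

lemma nat_realize:
  assumes M: "is_bstr M" and p: "p \<in> types {} (Th M) n"
  shows "\<exists>(N :: nat bstr) e. is_bstr N \<and> Th N = Th M \<and> env N e \<and> p = tp n N e"
proof -
  let ?W = "upower M"
  have W: "is_bstr ?W" "Th ?W = Th M" "compact_str ?W" using M is_bstr_upower Th_upower compact_upower by auto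
  obtain e where e: "env ?W e" "p = tp n ?W e" using compact_realizes[OF W(3)] p W(2) by auto
  obtain N where N: "range e \<subseteq> N" "countable N" "elem_sub (sub ?W N) ?W"
    using lowenheim_skolem[OF W(1), of "range e"] e(1) by (auto simp: env_def)
  have eN: "env (sub ?W N) e" using N(1) by (simp add: env_def)
  obtain K :: "nat bstr" where K: "is_bstr K" "sub ?W N \<simeq> K"
    using countable_copy[OF elem_sub_bstr[OF N(3)]] N(2) by auto
  obtain f where f: "iso_map f (sub ?W N) K" using K(2) iso_iff by blast
  have "p = tp n K (\<lambda>x. f (e x))"
    using e(2) elem_sub_tp[OF N(3) eN, of n] tp_iso[OF f eN, of n] by simp
  moreover have "Th K = Th M"
    using iso_Th[OF K(2) elem_sub_bstr[OF N(3)] K(1)] elem_sub_Th[OF N(3) W(1)] W(2) by simp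
  ultimately show ?thesis using K(1) iso_map_env[OF f eN] by blast
qed

text \<open>Each type is realised in a countable model by a finite list of natural numbers.\<close>

lemma small_if_countable_iso_types:
  assumes K: "is_bstr K" and c: "countable (iso_types (Th K))"
  shows "small_theory (Th K)"
proof -
  define rep where "rep k = (SOME M. is_bstr M \<and> Th M = Th K \<and> k = iso_type (Th K) M)" for k
  have rep: "is_bstr (rep k)" "Th (rep k) = Th K" "k = iso_type (Th K) (rep k)" if "k \<in> iso_types (Th K)" for k
  proof -
    have "\<exists>M. is_bstr M \<and> Th M = Th K \<and> k = iso_type (Th K) M"
      using iso_typesE[OF K refl that] by metis
    from someI_ex[OF this] show "is_bstr (rep k)" "Th (rep k) = Th K" "k = iso_type (Th K) (rep k)"
      by (auto simp: rep_def)
  qed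
  let ?F = "\<lambda>(n, k, l). tp n (rep k) (\<lambda>i. l ! i)"
  have "(\<Union>n. types {} (Th K) n) \<subseteq> ?F ` (UNIV \<times> iso_types (Th K) \<times> UNIV)"
  proof
    fix p assume "p \<in> (\<Union>n. types {} (Th K) n)"
    then obtain n where "p \<in> types {} (Th K) n" by blast
    then obtain N :: "nat bstr" and e where N: "is_bstr N" "Th N = Th K" "env N e" "p = tp n N e"
      using nat_realize[OF K] by blast
    let ?k = "iso_type (Th K) N"
    have k: "?k \<in> iso_types (Th K)" by (rule iso_type_in[OF K refl N(1,2)])
    have "N \<simeq> rep ?k" using iso_type_eq[OF K refl N(1,2) rep(1,2)[OF k]] rep(3)[OF k] by simp
    then obtain f where f: "iso_map f N (rep ?k)" using iso_iff by blast
    have "p = tp n (rep ?k) (\<lambda>x. f (e x))" using N(4) tp_iso[OF f N(3)] by simp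
    also have "\<dots> = tp n (rep ?k) (\<lambda>i. map (\<lambda>x. f (e x)) [0..<n] ! i)" by (rule tp_cong) simp
    finally have "p = ?F (n, ?k, map (\<lambda>x. f (e x)) [0..<n])" by simp
    then show "p \<in> ?F ` (UNIV \<times> iso_types (Th K) \<times> UNIV)" using k by blast
  qed
  moreover have "countable ((UNIV :: nat set) \<times> iso_types (Th K) \<times> (UNIV :: nat list set))"
    using c by (intro countable_SIGMA) auto
  ultimately show ?thesis unfolding small_theory_def by (rule countable_subset[OF _ countable_image])
qed

lemma card_one_iff: "|X| =o cone \<longleftrightarrow> (\<exists>x. X = {x})"
proof
  assume "|X| =o cone"
  then have "|X| =o |{()}|" by (simp add: cone_def)
  then obtain f where "bij_betw f X {()}" using card_of_ordIso by blast
  then show "\<exists>x. X = {x}" using bij_betw_same_card[of f X] by (auto simp: card_1_singleton_iff[symmetric] bij_betw_finite)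
next
  assume "\<exists>x. X = {x}"
  then obtain x where "X = {x}" by blast
  then have "bij_betw (\<lambda>_. ()) X {()}" by (simp add: bij_betw_def)
  then show "|X| =o cone" unfolding cone_def using card_of_ordIso by blast
qed

lemma countable_natLeq: "countable A \<longleftrightarrow> |A| \<le>o natLeq"
proof -
  have "countable A \<longleftrightarrow> |A| \<le>o |UNIV :: nat set|"
    unfolding countable_def card_of_ordLeq[symmetric] by simp
  also have "\<dots> \<longleftrightarrow> |A| \<le>o natLeq"
    using card_of_nat ordLeq_ordIso_trans ordIso_symmetric by blast
  finally show ?thesis .
qed

lemma three_ordLeq: 
  assumes "{a, b, c} \<subseteq> X" "a \<noteq> b" "a \<noteq> c" "b \<noteq> c" shows "|{..<3 :: nat}| \<le>o |X|"
proof -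
  have "card {a, b, c} = card {..<3 :: nat}" using assms by simp
  then obtain f where "bij_betw f {..<3 :: nat} {a, b, c}"
    using finite_same_card_bij[of "{..<3 :: nat}" "{a, b, c}"] by auto
  then have "inj_on f {..<3} \<and> f ` {..<3} \<subseteq> X" using assms(1) by (auto simp: bij_betw_def)
  then show ?thesis using card_of_ordLeq by blast
qed

text \<open>The ultrapower supplies a compact model for the trichotomy; its three pairwise nonisomorphic
  submodels are countable and can be copied to the natural numbers.\<close>

theorem never_two:
  assumes K: "is_bstr K" and c: "countable (iso_types (Th K))"
  shows "|iso_types (Th K)| =o cone \<or> |{..<3 :: nat}| \<le>o |iso_types (Th K)|"
proof -
  let ?W = "upower K" and ?T = "Th K"
  have W: "is_bstr ?W" "Th ?W = ?T" "compact_str ?W" using K is_bstr_upower Th_upower compact_upower by auto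
  have sm: "small_theory (Th ?W)" using small_if_countable_iso_types[OF K c] W(2) by simp
  from three_models[OF W(3) sm] show ?thesis
  proof
    assume uniq: "\<forall>(M :: nat bstr) (N :: nat bstr). is_bstr M \<and> is_bstr N \<and> Th M = Th ?W \<and> Th N = Th ?W \<longrightarrow> M \<simeq> N"
    obtain M :: "nat bstr" where M: "is_bstr M" "Th M = ?T" using countable_nat_model[OF K] by blast
    have "k = iso_type ?T M" if k: "k \<in> iso_types ?T" for k
    proof -
      obtain N where N: "is_bstr N" "Th N = ?T" "k = iso_type ?T N" using iso_typesE[OF K refl k] by metis
      then show ?thesis using iso_type_eq[OF K refl N(1,2) M] uniq M W(2) by simp
    qed
    then have "iso_types ?T = {iso_type ?T M}" using iso_type_in[OF K refl M] by blast
    then show ?thesis using card_one_iff by blast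
  next
    assume "\<exists>A B C. (\<forall>N\<in>{A, B, C}. countable N \<and> elem_sub (sub ?W N) ?W) \<and>
       \<not> sub ?W A \<simeq> sub ?W B \<and> \<not> sub ?W A \<simeq> sub ?W C \<and> \<not> sub ?W B \<simeq> sub ?W C"
    then obtain A B C where ABC: "\<forall>N\<in>{A, B, C}. countable N \<and> elem_sub (sub ?W N) ?W"
      "\<not> sub ?W A \<simeq> sub ?W B" "\<not> sub ?W A \<simeq> sub ?W C" "\<not> sub ?W B \<simeq> sub ?W C" by blast
    have "\<exists>M :: nat bstr. is_bstr M \<and> Th M = ?T \<and> sub ?W N \<simeq> M" if "N \<in> {A, B, C}" for N
    proof -
      have N: "countable N" "elem_sub (sub ?W N) ?W" using ABC(1) that by blast+
      obtain M :: "nat bstr" where M: "is_bstr M" "sub ?W N \<simeq> M"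
        using countable_copy[OF elem_sub_bstr[OF N(2)]] N(1) by auto
      then show ?thesis using iso_Th[OF M(2) elem_sub_bstr[OF N(2)] M(1)] elem_sub_Th[OF N(2) W(1)] W(2) by auto
    qed
    then obtain q :: "_ \<Rightarrow> nat bstr" where q: "\<And>N. N \<in> {A, B, C} \<Longrightarrow> is_bstr (q N) \<and> Th (q N) = ?T \<and> sub ?W N \<simeq> q N" by metis
    have ne: "iso_type ?T (q N) \<noteq> iso_type ?T (q N')"
      if "N \<in> {A, B, C}" "N' \<in> {A, B, C}" "\<not> sub ?W N \<simeq> sub ?W N'" for N N'
    proof
      assume "iso_type ?T (q N) = iso_type ?T (q N')"
      then have "q N \<simeq> q N'"
        using iso_type_eq[OF K refl, of "q N" "q N'"] q[OF that(1)] q[OF that(2)] by simp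
      then have "sub ?W N \<simeq> q N'" using q[OF that(1)] iso_trans by blast
      then have "sub ?W N \<simeq> sub ?W N'" using q[OF that(2)] iso_trans[OF _ iso_sym] by blast
      then show False using that(3) by simp
    qed
    have "{iso_type ?T (q A), iso_type ?T (q B), iso_type ?T (q C)} \<subseteq> iso_types ?T"
      using iso_type_in[OF K refl] q by simp
    then show ?thesis using three_ordLeq ne ABC(2-4) by (metis insertI1 insertI2)
  qed
qed

context tree_product
begin

lemma product_of_equivalents: "length Zs = n \<Longrightarrow> (\<And>i. i < n \<Longrightarrow> is_bstr (Zs ! i) \<and> Th (Zs ! i) = Th (Xs ! i)) \<Longrightarrow>
  is_bstr (direct_prod Zs) \<and> Th (direct_prod Zs) = Th P \<and> tree_product Zs"
proof (intro conjI)
  assume len: "length Zs = n" and Z: "\<And>i. i < n \<Longrightarrow> is_bstr (Zs ! i) \<and> Th (Zs ! i) = Th (Xs ! i)"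
  show "is_bstr (direct_prod Zs)" using len Z by (intro is_bstr_prod) auto
  show "Th (direct_prod Zs) = Th P" by (rule prod_Th[OF len refl]) (use Z factor(1) in auto)
  show "tree_product Zs"
  proof
    fix i assume "i < length Zs"
    then show "Zs ! i \<in> rooted_trees_gt1" using rooted_trees_Th[OF factor(1)] Z len trees by metis
  qed
qed

section \<open>Counting the models of a product\<close>

text \<open>A countable model of the theory of the product is isomorphic to a product of countable models of the
  theories of the factors; the isomorphism types of the latter determine its own.\<close>

lemma iso_types_upper: "|iso_types (Th P)| \<le>o |listset (map (\<lambda>i. iso_types (Th (Xs ! i))) [0..<n])|"
proof -
  have "\<exists>Zs :: nat bstr list. length Zs = n \<and> (\<forall>i<n. is_bstr (Zs ! i) \<and> Th (Zs ! i) = Th (Xs ! i)) \<and>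
    (\<forall>M. is_bstr M \<and> M \<simeq> direct_prod Zs \<longrightarrow> k = iso_type (Th P) M)"
    if k: "k \<in> iso_types (Th P)" for k
  proof -
    obtain M where M: "is_bstr M" "Th M = Th P" "k = iso_type (Th P) M" using iso_typesE[OF bP refl k] by metis
    obtain Zs :: "nat bstr list" where Zs: "length Zs = n" "\<forall>i<n. is_bstr (Zs ! i) \<and> Th (Zs ! i) = Th (Xs ! i)"
      "M \<simeq> direct_prod Zs" using prod_decompose[OF M(1,2) inj_on_id] by (elim exE conjE) (rule that)
    have "k = iso_type (Th P) M'" if "is_bstr M'" "M' \<simeq> direct_prod Zs" for M'
    proof -
      have MM: "M' \<simeq> M" using that(2) Zs(3) iso_trans iso_sym by blast
      then have "Th M' = Th P" using iso_Th[OF MM that(1) M(1)] M(2) by simp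
      then show ?thesis using iso_type_eq[OF bP refl that(1) _ M(1,2)] MM M(3) by simp
    qed
    then show ?thesis using Zs by blast
  qed
  then have "\<forall>k\<in>iso_types (Th P). \<exists>Zs :: nat bstr list. length Zs = n \<and>
    (\<forall>i<n. is_bstr (Zs ! i) \<and> Th (Zs ! i) = Th (Xs ! i)) \<and>
    (\<forall>M. is_bstr M \<and> M \<simeq> direct_prod Zs \<longrightarrow> k = iso_type (Th P) M)" by blast
  from bchoice[OF this] obtain Zs :: "_ \<Rightarrow> nat bstr list" where
    Zs0: "\<forall>k\<in>iso_types (Th P). length (Zs k) = n \<and>
    (\<forall>i<n. is_bstr (Zs k ! i) \<and> Th (Zs k ! i) = Th (Xs ! i)) \<and>
    (\<forall>M. is_bstr M \<and> M \<simeq> direct_prod (Zs k) \<longrightarrow> k = iso_type (Th P) M)" ..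
  then have Zs: "\<And>k. k \<in> iso_types (Th P) \<Longrightarrow> length (Zs k) = n"
    "\<And>k i. k \<in> iso_types (Th P) \<Longrightarrow> i < n \<Longrightarrow> is_bstr (Zs k ! i) \<and> Th (Zs k ! i) = Th (Xs ! i)"
    "\<And>k M. k \<in> iso_types (Th P) \<Longrightarrow> is_bstr M \<Longrightarrow> M \<simeq> direct_prod (Zs k) \<Longrightarrow> k = iso_type (Th P) M"
    by simp_all
  define F where "F k = map (\<lambda>i. iso_type (Th (Xs ! i)) (Zs k ! i)) [0..<n]" for k
  have "inj_on F (iso_types (Th P))"
  proof (rule inj_onI)
    fix k l assume kl: "k \<in> iso_types (Th P)" "l \<in> iso_types (Th P)" "F k = F l"
    have "Zs k ! i \<simeq> Zs l ! i" if i: "i < n" for i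
    proof -
      have "iso_type (Th (Xs ! i)) (Zs k ! i) = iso_type (Th (Xs ! i)) (Zs l ! i)"
        using kl(3) i by (auto simp: F_def)
      then show ?thesis using iso_type_eq[OF factor(1)[OF i] refl] Zs(2)[OF kl(1) i] Zs(2)[OF kl(2) i] by blast
    qed
    then have kl': "direct_prod (Zs k) \<simeq> direct_prod (Zs l)" using Zs(1) kl by (intro iso_prod) auto
    have b: "is_bstr (direct_prod (Zs k))" "countable (Univ (direct_prod (Zs k)))"
      using Zs(1,2) kl(1) by (auto intro!: is_bstr_prod countable_prod)
    obtain M :: "nat bstr" where M: "is_bstr M" "direct_prod (Zs k) \<simeq> M" using countable_copy[OF b] by blast
    have "M \<simeq> direct_prod (Zs k)" "M \<simeq> direct_prod (Zs l)" using M(2) kl' iso_sym iso_trans by blast+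
    then show "k = l" using Zs(3)[OF kl(1) M(1)] Zs(3)[OF kl(2) M(1)] by simp
  qed
  moreover have "F ` iso_types (Th P) \<subseteq> listset (map (\<lambda>i. iso_types (Th (Xs ! i))) [0..<n])"
    using Zs(2) iso_type_in[OF factor(1) refl] by (auto simp: F_def listset_iff)
  ultimately show ?thesis using card_of_ordLeq by blast
qed

text \<open>Replacing the \<open>i\<close>-th factor in a fixed product of countable models by nonisomorphic models leads to
  nonisomorphic products.\<close>

lemma iso_types_lower:
  assumes i: "i < n" shows "|iso_types (Th (Xs ! i))| \<le>o |iso_types (Th P)|"
proof -
  have "\<forall>j. \<exists>C :: nat bstr. j < n \<longrightarrow> is_bstr C \<and> Th C = Th (Xs ! j)"
    using countable_nat_model factor(1) by blast
  then obtain C :: "_ \<Rightarrow> nat bstr" where C: "\<And>j. j < n \<Longrightarrow> is_bstr (C j) \<and> Th (C j) = Th (Xs ! j)" by metis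
  let ?Cs = "map C [0..<n]" and ?T = "Th (Xs ! i)"
  have up: "is_bstr (direct_prod (?Cs[i := Z])) \<and> Th (direct_prod (?Cs[i := Z])) = Th P \<and> tree_product (?Cs[i := Z])"
    if "is_bstr Z" "Th Z = ?T" for Z
    by (rule product_of_equivalents) (use that C i in \<open>auto simp: nth_list_update\<close>)
  have "\<exists>M :: nat bstr. is_bstr M \<and> direct_prod (?Cs[i := Z]) \<simeq> M" if "is_bstr Z" "Th Z = ?T" for Z
    by (rule countable_copy) (use up[OF that] in \<open>auto intro!: countable_prod\<close>)
  then obtain q :: "nat bstr \<Rightarrow> nat bstr" where q: "\<And>Z. is_bstr Z \<Longrightarrow> Th Z = ?T \<Longrightarrow>
      is_bstr (q Z) \<and> direct_prod (?Cs[i := Z]) \<simeq> q Z" by metis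
  have qT: "Th (q Z) = Th P" if "is_bstr Z" "Th Z = ?T" for Z
    using up[OF that] q[OF that] iso_Th by metis
  define rep where "rep k = (SOME M. is_bstr M \<and> Th M = ?T \<and> k = iso_type ?T M)" for k
  have rep: "is_bstr (rep k)" "Th (rep k) = ?T" "k = iso_type ?T (rep k)" if "k \<in> iso_types ?T" for k
  proof -
    have "\<exists>M. is_bstr M \<and> Th M = ?T \<and> k = iso_type ?T M"
      using iso_typesE[OF factor(1)[OF i] refl that] by metis
    from someI_ex[OF this] show "is_bstr (rep k)" "Th (rep k) = ?T" "k = iso_type ?T (rep k)"
      by (auto simp: rep_def)
  qed
  define F where "F k = iso_type (Th P) (q (rep k))" for k
  have "inj_on F (iso_types ?T)"
  proof (rule inj_onI)
    fix k l assume kl: "k \<in> iso_types ?T" "l \<in> iso_types ?T" "F k = F l"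
    let ?Z = "rep k" and ?Z' = "rep l"
    have Z: "is_bstr ?Z" "Th ?Z = ?T" "is_bstr ?Z'" "Th ?Z' = ?T" using rep kl by auto
    have "q ?Z \<simeq> q ?Z'"
      using kl(3) iso_type_eq[OF bP refl, of "q ?Z" "q ?Z'"] q Z qT by (simp add: F_def)
    then have "direct_prod (?Cs[i := ?Z]) \<simeq> direct_prod (?Cs[i := ?Z'])"
      using q[OF Z(1,2)] q[OF Z(3,4)] iso_trans iso_sym by metis
    note PP = this
    have "set (?Cs[i := ?Z]) \<subseteq> rooted_trees_gt1" "set (?Cs[i := ?Z']) \<subseteq> rooted_trees_gt1"
      using up[OF Z(1,2)] up[OF Z(3,4)] by (auto simp: tree_product_def in_set_conv_nth)
    from prod_iso_iff[OF this, THEN iffD1, OF PP, THEN conjunct2]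
    obtain \<pi> where \<pi>: "\<pi> permutes {..<n}" "\<forall>j<n. ?Cs[i := ?Z] ! j \<simeq> ?Cs[i := ?Z'] ! \<pi> j"
      by (elim exE conjE) (rule that, simp_all)
    \<comment> \<open>The other factors cancel: compare the multisets of isomorphism classes.\<close>
    define c where "c M = {N :: nat bstr. N \<simeq> M}" for M :: "nat bstr"
    have c: "c M = c N \<longleftrightarrow> M \<simeq> N" for M N
      using iso_refl iso_sym iso_trans unfolding c_def by blast
    let ?xs = "map c (?Cs[i := ?Z])" and ?ys = "map c (?Cs[i := ?Z'])"
    have "\<pi> j < n" if "j < n" for j using permutes_in_image[OF \<pi>(1)] that by simp
    moreover have "c (?Cs[i := ?Z] ! j) = c (?Cs[i := ?Z'] ! \<pi> j)" if "j < n" for j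
      unfolding c using \<pi>(2) that by blast
    ultimately have "?xs = permute_list \<pi> ?ys"
      by (intro nth_equalityI) (simp_all add: permute_list_def)
    then have "mset ?xs = mset ?ys" using \<pi>(1) by (simp add: mset_permute_list)
    then have "add_mset (c ?Z) (mset (map c ?Cs) - {#map c ?Cs ! i#}) = add_mset (c ?Z') (mset (map c ?Cs) - {#map c ?Cs ! i#})"
      using i by (simp add: map_update mset_update del: map_map)
    then have "?Z \<simeq> ?Z'" using c by simp
    then show "k = l" using iso_type_eq[OF factor(1)[OF i] refl Z] rep(3) kl by metis
  qed
  moreover have "F ` iso_types ?T \<subseteq> iso_types (Th P)"
    using iso_type_in[OF bP refl] q qT rep by (auto simp: F_def)
  ultimately show ?thesis using card_of_ordLeq by blast
qed

section \<open>Atomic models and small theories of a product\<close>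

text \<open>Let \<open>\<chi> i\<close> be complete formulas for the coordinates of a tuple \<open>d\<close>. The formula for \<open>d\<close> says that there is a
  decomposition in whose \<open>i\<close>-th quotient \<open>\<chi> i\<close> holds. For another tuple this decomposition
  may list the factors in another order. The sentences \<open>\<sigma> i j\<close>, which hold in
  factor \<open>i\<close> and in factor \<open>j\<close> only if these are elementarily equivalent, ensure that only elementarily
  equivalent factors are exchanged. So the two tuples correspond in two products of factors with equal types, and
  the Feferman--Vaught theorem applies.\<close>

lemma atomic_prod:
  assumes at: "\<And>i. i < n \<Longrightarrow> atomic_model (Xs ! i)"
  shows "atomic_model P"
  unfolding atomic_model_env
proof (intro allI impI)
  fix m d assume d: "env P d"
  have "\<forall>i. \<exists>\<chi>. i < n \<longrightarrow> complete_formula (Th (Xs ! i)) m \<chi> \<and> bsat (Xs ! i) (\<lambda>x. d x ! i) \<chi>"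
    using at env_prod[OF d] unfolding atomic_model_env by blast
  then obtain \<chi> where \<chi>: "\<And>i. i < n \<Longrightarrow> complete_formula (Th (Xs ! i)) m (\<chi> i)"
    "\<And>i. i < n \<Longrightarrow> bsat (Xs ! i) (\<lambda>x. d x ! i) (\<chi> i)" by metis
  have \<chi>f: "\<chi> i \<in> formulas {} m" if "i < n" for i using \<chi>(1)[OF that] by (simp add: complete_formula_def)
  have "\<forall>i j. \<exists>\<sigma>. i < n \<and> j < n \<longrightarrow> \<sigma> \<in> Th (Xs ! i) \<and> (\<sigma> \<in> Th (Xs ! j) \<longrightarrow> Th (Xs ! i) = Th (Xs ! j))"
  proof (intro allI)
    fix i j
    have "Tru \<in> Th (Xs ! i)" by (simp add: Th_def)
    moreover have "\<exists>\<sigma>. \<sigma> \<in> Th (Xs ! i) \<and> \<sigma> \<notin> Th (Xs ! j)" if "i < n" "j < n" "Th (Xs ! i) \<noteq> Th (Xs ! j)"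
      using is_model_Th[OF factor(1)[OF that(1)], of "Xs ! j"] factor(1)[OF that(2)] that(3) by (auto simp: is_model_def)
    ultimately show "\<exists>\<sigma>. i < n \<and> j < n \<longrightarrow> \<sigma> \<in> Th (Xs ! i) \<and> (\<sigma> \<in> Th (Xs ! j) \<longrightarrow> Th (Xs ! i) = Th (Xs ! j))"
      by blast
  qed
  then obtain \<sigma> where \<sigma>: "\<And>i j. i < n \<Longrightarrow> j < n \<Longrightarrow> \<sigma> i j \<in> Th (Xs ! i)"
    "\<And>i j. i < n \<Longrightarrow> j < n \<Longrightarrow> \<sigma> i j \<in> Th (Xs ! j) \<Longrightarrow> Th (Xs ! i) = Th (Xs ! j)" by metis
  have \<sigma>f: "\<sigma> i j \<in> formulas {} 0" if "i < n" "j < n" for i j using \<sigma>(1)[OF that] by (simp add: Th_def)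
  \<comment> \<open>Variables \<open>0, \<dots>, n-1\<close> of \<open>\<theta>\<close> hold the parameters and variable \<open>n + x\<close> the \<open>x\<close>-th entry; \<open>?f\<close> below exchanges the two blocks.\<close>
  define \<theta> where "\<theta> = And (fDec n) (Conj (map (\<lambda>i. And (factor_fm n i (\<chi> i)) (Conj (map (\<lambda>j. factor_fm n i (\<sigma> i j)) [0..<n]))) [0..<n]))"
  have \<theta>: "\<theta> \<in> formulas {} (n + m)"
  proof -
    have "factor_fm n i (\<sigma> i j) \<in> formulas {} (n + m)" if "i < n" "j < n" for i j
      using factor_fm_formulas[OF \<sigma>f[OF that] that(1)] formulas_mono[of "n + 0" "n + m" "{}"] by auto
    moreover have "factor_fm n i (\<chi> i) \<in> formulas {} (n + m)" if "i < n" for i by (rule factor_fm_formulas[OF \<chi>f[OF that] that])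
    moreover have "fDec n \<in> formulas {} (n + m)" using fDec_formulas formulas_mono[of n "n + m" "{}"] by auto
    ultimately show ?thesis by (auto simp: \<theta>_def)
  qed
  let ?f = "\<lambda>v. if v < n then m + v else v - n"
  define \<Phi> where "\<Phi> = Exs [m..<m + n] (ren ?f \<theta>)"
  have "ren ?f \<theta> \<in> formulas {} (m + n)" by (rule ren_formulas[OF \<theta>]) auto
  then have \<Phi>: "\<Phi> \<in> formulas {} m" by (fastforce simp: \<Phi>_def formulas_def)
  have trs: "bsat P w (factor_fm n i (\<chi> i)) \<longleftrightarrow> bsat (Xs ! j) (\<lambda>x. w (n + x) ! j) (\<chi> i)"
    "i' < n \<Longrightarrow> bsat P w (factor_fm n i (\<sigma> i i')) \<longleftrightarrow> \<sigma> i i' \<in> Th (Xs ! j)"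
    if "env P w" "i < n" "j < n" "proj_onto P (w i) (\<lambda>x. x ! j) (Xs ! j)" for w i j i'
  proof -
    show "bsat P w (factor_fm n i (\<chi> i)) \<longleftrightarrow> bsat (Xs ! j) (\<lambda>x. w (n + x) ! j) (\<chi> i)"
      by (rule bsat_factor_fm[OF that(4,2,1)]) (use \<chi>f[OF that(2)] in \<open>auto simp: formulas_def\<close>)
    assume i': "i' < n"
    have "bsat P w (factor_fm n i (\<sigma> i i')) \<longleftrightarrow> bsat (Xs ! j) (\<lambda>x. w (n + x) ! j) (\<sigma> i i')"
      by (rule bsat_factor_fm[OF that(4,2,1)]) (use \<sigma>f[OF that(2) i'] in \<open>auto simp: formulas_def\<close>)
    also have "\<dots> \<longleftrightarrow> \<sigma> i i' \<in> Th (Xs ! j)"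
      using Th_iff[OF factor(1)[OF that(3)] \<sigma>f[OF that(2) i']] env_prod[OF _ that(3), of "\<lambda>x. w (n + x)"] that(1)
      by (simp add: env_iff)
    finally show "bsat P w (factor_fm n i (\<sigma> i i')) \<longleftrightarrow> \<sigma> i i' \<in> Th (Xs ! j)" .
  qed
  have sat: "bsat P d \<Phi>"
  proof -
    let ?e = "\<lambda>x. if m \<le> x \<and> x < m + n then axis (x - m) else d x"
    let ?w = "\<lambda>v. ?e (?f v)"
    have e: "env P ?e" "agree (set [m..<m + n]) d ?e" using d env_axis by (auto simp: env_iff agree_def)
    then have w: "env P ?w" by (simp add: env_iff)
    have wi: "?w i = axis i" if "i < n" for i using that by simp
    have "bsat P ?w (fDec n)"
      using bsat_formulas_cong[OF fDec_formulas, of n ?w axis P] wi bsat_fDec[OF env_axis] decomp_axis by simp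
    moreover have "bsat P ?w (factor_fm n i (\<chi> i)) \<and> (\<forall>j<n. bsat P ?w (factor_fm n i (\<sigma> i j)))" if i: "i < n" for i
    proof -
      have pr: "proj_onto P (?w i) (\<lambda>x. x ! i) (Xs ! i)" using wi[OF i] proj_onto_axis[OF on_axis_axis[OF i]] by simp
      have "bsat (Xs ! i) (\<lambda>x. ?w (n + x) ! i) (\<chi> i)"
        using bsat_formulas_cong[OF \<chi>f[OF i], of "\<lambda>x. ?w (n + x) ! i" "\<lambda>x. d x ! i" "Xs ! i"] \<chi>(2)[OF i] by simp
      then show ?thesis using trs[OF w i i pr] \<sigma>(1)[OF i] by blast
    qed
    ultimately have "bsat P ?w \<theta>" by (simp add: \<theta>_def ball_upt[unfolded set_upt])
    then have "bsat P ?e (ren ?f \<theta>)" by simp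
    then show ?thesis unfolding \<Phi>_def bsat_Exs[OF d] using e by blast
  qed
  have uniq: "tp m P e = tp m P d" if e: "env P e" "bsat P e \<Phi>" for e
  proof -
    obtain e' where e': "env P e'" "agree (set [m..<m + n]) e e'" "bsat P e' (ren ?f \<theta>)"
      using e(2) unfolding \<Phi>_def bsat_Exs[OF e(1)] by blast
    let ?w = "\<lambda>v. e' (?f v)"
    have w: "env P ?w" using e'(1) by (simp add: env_iff)
    have \<theta>w: "bsat P ?w \<theta>" using e'(3) by simp
    then have dw: "decomp P n ?w" using bsat_fDec[OF w, of n] by (simp add: \<theta>_def)
    have U: "?w i \<in> Univ P" "axis i \<in> Univ P" for i using w env_axis by (auto simp: env_iff)
    obtain \<pi> where \<pi>: "\<pi> permutes {..<n}" "\<forall>i<n. \<forall>x\<in>Univ P. \<forall>y\<in>Univ P.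
        proj_le P (?w i) x y \<longleftrightarrow> proj_le P (axis (\<pi> i)) x y"
      using decomp_unique[OF decomp_axis U(2) dw U(1)] by (elim conjE exE) (rule that)
    have \<pi>n: "\<pi> i < n" if "i < n" for i using permutes_in_image[OF \<pi>(1)] that by simp
    let ?Ns = "map (\<lambda>i. Xs ! \<pi> i) [0..<n]" and ?h = "\<lambda>x. map (\<lambda>i. id (x ! \<pi> i)) [0..<n]"
    have h: "iso_map ?h P (direct_prod ?Ns)"
      by (rule iso_map_prod_perm[OF \<pi>(1)]) (auto simp: iso_map_refl[unfolded id_def])
    have ti: "tp m (Xs ! i) (\<lambda>x. d x ! i) = tp m (?Ns ! i) (\<lambda>x. ?h (e x) ! i)" if i: "i < n" for i
    proof -
      let ?j = "\<pi> i"
      have pr: "proj_onto P (?w i) (\<lambda>x. x ! ?j) (Xs ! ?j)"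
        by (rule proj_onto_cong[OF _ proj_onto_axis[OF on_axis_axis[OF \<pi>n[OF i]]]]) (use \<pi>(2) i in blast)
      note t = trs[OF w i \<pi>n[OF i] pr]
      have 1: "bsat P ?w (factor_fm n i (\<chi> i))" "bsat P ?w (factor_fm n i (\<sigma> i ?j))"
        using \<theta>w i \<pi>n[OF i] by (auto simp: \<theta>_def)
      have T: "Th (Xs ! i) = Th (Xs ! ?j)" using \<sigma>(2)[OF i \<pi>n[OF i]] t(2)[OF \<pi>n[OF i]] 1(2) by blast
      have "bsat (Xs ! ?j) (\<lambda>x. ?w (n + x) ! ?j) (\<chi> i)" using t(1) 1(1) by blast
      moreover have "?w (n + x) = e x" if "x < m" for x using e'(2) that by (simp add: agree_def)
      ultimately have "bsat (Xs ! ?j) (\<lambda>x. e x ! ?j) (\<chi> i)"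
        using bsat_formulas_cong[OF \<chi>f[OF i], of "\<lambda>x. ?w (n + x) ! ?j" "\<lambda>x. e x ! ?j" "Xs ! ?j"] by simp
      from complete_formula_tp[OF factor(1)[OF i] factor(1)[OF \<pi>n[OF i]] T \<chi>(1)[OF i] env_prod[OF d i] env_prod[OF e(1) \<pi>n[OF i]] \<chi>(2)[OF i] this]
      show ?thesis using i by simp
    qed
    have "tp m P d = tp m (direct_prod ?Ns) (\<lambda>x. ?h (e x))"
      by (rule prod_tp[of _ n]) (use d ti iso_map_env[OF h e(1)] in auto)
    then show ?thesis using tp_iso[OF h e(1), of m] by simp
  qed
  have "complete_formula (Th P) m \<Phi>"
    unfolding complete_formula_Th[OF bP] using \<Phi> d sat uniq by metis
  then show "\<exists>\<phi>. complete_formula (Th P) m \<phi> \<and> bsat P d \<phi>" using sat by blast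
qed

text \<open>Put the entries of a tuple of the factor on its axis and add a parameter for the axis. Of a complete
  formula for the extended tuple, take a rectangle that contains it and its \<open>i\<close>-th side \<open>\<psi>\<close>. Changing the
  \<open>i\<close>-th coordinates within \<open>\<psi>\<close> preserves the type in the product, in particular the first
  entry remains on the axis, and therefore the type in the factor. It remains to quantify
  the additional coordinate, variable 0 of \<open>\<psi>\<close>.\<close>

lemma atomic_factor:
  assumes at: "atomic_model P" and i: "i < n" shows "atomic_model (Xs ! i)"
  unfolding atomic_model_env
proof (intro allI impI)
  fix m d assume d: "env (Xs ! i) d"
  let ?u = "\<lambda>x. if x = 0 then axis i else emb i (d (x - 1))"
  have embd: "emb i (d x) \<in> Univ P" for x using emb_in[OF i] d by (simp add: env_iff)
  have u: "env P ?u" using embd env_axis by (simp add: env_iff)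
  obtain \<theta> where \<theta>: "complete_formula (Th P) (Suc m) \<theta>" "bsat P ?u \<theta>"
    using at u unfolding atomic_model_env by blast
  have \<theta>f: "\<theta> \<in> formulas {} (Suc m)" "csts \<theta> = {}" using \<theta>(1) by (auto simp: complete_formula_def formulas_def)
  obtain r where r: "r \<in> set (rects n \<theta>)" "\<forall>j<n. bsat (Xs ! j) (\<lambda>x. ?u x ! j) (r ! j)"
    using \<theta>(2) unfolding feferman_vaught_bsat[OF u \<theta>f(2)] by blast
  define \<psi> where "\<psi> = r ! i"
  have \<psi>: "\<psi> \<in> formulas {} (Suc m)" unfolding \<psi>_def by (rule rects_formulas[OF \<theta>f(1) r(1) i])
  let ?f = "\<lambda>v. if v = 0 then m else v - 1"
  define \<Phi> where "\<Phi> = Ex m (ren ?f \<psi>)"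
  have \<Phi>: "\<Phi> \<in> formulas {} m"
    unfolding \<Phi>_def by (rule formulas_Ex, rule ren_formulas[OF \<psi>]) auto
  have \<Phi>_iff: "bsat (Xs ! i) e \<Phi> \<longleftrightarrow> (\<exists>c\<in>Univ (Xs ! i). bsat (Xs ! i) (\<lambda>v. if v = 0 then c else e (v - 1)) \<psi>)" for e
  proof -
    have "bsat (Xs ! i) (\<lambda>v. (e(m := c)) (?f v)) \<psi> \<longleftrightarrow> bsat (Xs ! i) (\<lambda>v. if v = 0 then c else e (v - 1)) \<psi>" for c
      by (rule bsat_formulas_cong[OF \<psi>]) auto
    then show ?thesis by (simp add: \<Phi>_def)
  qed
  have "bsat (Xs ! i) (\<lambda>x. ?u x ! i) \<psi>" using r(2) i by (simp add: \<psi>_def)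
  moreover have "(\<lambda>x. ?u x ! i) = (\<lambda>v. if v = 0 then axis i ! i else d (v - 1))" using i by auto
  ultimately have sat: "bsat (Xs ! i) d \<Phi>"
    unfolding \<Phi>_iff using in_PD[OF _ i] env_axis by (metis env_iff)
  have uniq: "tp m (Xs ! i) e = tp m (Xs ! i) d" if e: "env (Xs ! i) e" "bsat (Xs ! i) e \<Phi>" for e
  proof -
    obtain c where c: "c \<in> Univ (Xs ! i)" "bsat (Xs ! i) (\<lambda>v. if v = 0 then c else e (v - 1)) \<psi>"
      using e(2) \<Phi>_iff by blast
    let ?v = "\<lambda>x. if x = 0 then emb i c else emb i (e (x - 1))"
    have "emb i (e x) \<in> Univ P" for x using emb_in[OF i] e(1) by (simp add: env_iff)
    then have v: "env P ?v" using emb_in[OF i c(1)] by (simp add: env_iff)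
    have "bsat (Xs ! j) (\<lambda>x. ?v x ! j) (r ! j)" if j: "j < n" for j
    proof (cases "j = i")
      case True
      have "(\<lambda>x. ?v x ! j) = (\<lambda>v. if v = 0 then c else e (v - 1))" using True i by auto
      then show ?thesis using c(2) True by (simp add: \<psi>_def)
    next
      case False
      have "(\<lambda>x. ?v x ! j) = (\<lambda>x. ?u x ! j)"
        using False j on_axis_axis[OF i] by (auto simp: on_axis_def)
      then show ?thesis using r(2) j by simp
    qed
    then have "bsat P ?v \<theta>" unfolding feferman_vaught_bsat[OF v \<theta>f(2)] using r(1) by blast
    then have t: "tp (Suc m) P ?v = tp (Suc m) P ?u"
      using \<theta> u v unfolding complete_formula_Th[OF bP] by blast
    have "fBranch 0 \<in> formulas {} (Suc m)" by (simp add: formulas_def)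
    then have "branch P (?v 0)"
      using tp_eqD[OF t, of "fBranch 0"] on_axis_axis[OF i] branch_iff[of "axis i"] by (auto simp: on_axis_def)
    then obtain j where j: "on_axis j (emb i c)" using branch_iff[OF emb_in[OF i c(1)]] by auto
    then have "j = i" using i by (auto simp: on_axis_def split: if_splits)
    then have pv: "proj_onto P (?v 0) (\<lambda>x. x ! i) (Xs ! i)" using proj_onto_axis[OF j] by simp
    have pu: "proj_onto P (?u 0) (\<lambda>x. x ! i) (Xs ! i)" using proj_onto_axis[OF on_axis_axis[OF i]] by simp
    show ?thesis
    proof (rule tp_eqI)
      fix \<phi> :: "unit fm" assume \<phi>: "\<phi> \<in> formulas {} m" "bsat (Xs ! i) e \<phi>"
      have cs: "csts \<phi> = {}" using \<phi>(1) by (auto simp: formulas_def)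
      have "bsat P ?v (factor_fm 1 0 \<phi>) \<longleftrightarrow> bsat (Xs ! i) e \<phi>"
        using bsat_factor_fm[OF pv _ v cs, of 1] i by simp
      moreover have "bsat P ?u (factor_fm 1 0 \<phi>) \<longleftrightarrow> bsat (Xs ! i) d \<phi>"
        using bsat_factor_fm[OF pu _ u cs, of 1] i by simp
      moreover have "factor_fm 1 0 \<phi> \<in> formulas {} (Suc m)" using factor_fm_formulas[OF \<phi>(1), of 0 1] by simp
      ultimately show "bsat (Xs ! i) d \<phi>" using tp_eqD[OF t] \<phi>(2) by blast
    qed
  qed
  have "complete_formula (Th (Xs ! i)) m \<Phi>"
    unfolding complete_formula_Th[OF factor(1)[OF i]] using \<Phi> d sat uniq by metis
  then show "\<exists>\<phi>. complete_formula (Th (Xs ! i)) m \<phi> \<and> bsat (Xs ! i) d \<phi>" using sat by blast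
qed

lemma atomic_theory_factor:
  assumes at: "atomic_theory (Th P)" and i: "i < n" shows "atomic_theory (Th (Xs ! i))"
proof -
  obtain N where N: "elem_sub (sub P N) P" "atomic_model (sub P N)" using atomic_model_exists[OF bP at] by blast
  obtain Es where Es: "length Es = n" "\<forall>i<n. elem_sub (Es ! i) (Xs ! i)" "sub P N = direct_prod Es"
    using elem_sub_decompose[OF N(1)] by blast
  have E: "is_bstr (Es ! i) \<and> Th (Es ! i) = Th (Xs ! i)" if "i < n" for i
    using Es(2) that elem_sub_bstr elem_sub_Th factor(1) by metis
  interpret E: tree_product Es using product_of_equivalents[OF Es(1) E] by blast
  have "atomic_model (Es ! i)" using E.atomic_factor N(2) Es i by simp
  then show ?thesis using atomic_model_imp_theory[of "Es ! i"] E[OF i] by simp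
qed

text \<open>With a parameter for the \<open>i\<close>-th axis, a type of the factor can be read off from a type of the
  product in one more variable.\<close>

lemma small_factor:
  assumes sm: "small_theory (Th P)" and i: "i < n" shows "small_theory (Th (Xs ! i))"
proof -
  let ?F = "\<lambda>(m, p). {\<phi> \<in> formulas {} m. factor_fm 1 0 \<phi> \<in> p}"
  have "(\<Union>m. types {} (Th (Xs ! i)) m) \<subseteq> ?F ` (UNIV \<times> (\<Union>m. types {} (Th P) m))"
  proof
    fix q assume "q \<in> (\<Union>m. types {} (Th (Xs ! i)) m)"
    then obtain m where "q \<in> types {} (Th (Xs ! i)) m" by blast
    then obtain N :: "nat bstr" and e where N: "is_bstr N" "Th N = Th (Xs ! i)" "env N e" "q = tp m N e"
      using nat_realize[OF factor(1)[OF i]] by blast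
    have "\<forall>j. \<exists>C :: nat bstr. j < n \<longrightarrow> is_bstr C \<and> Th C = Th (Xs ! j)"
      using countable_nat_model factor(1) by blast
    then obtain C :: "_ \<Rightarrow> nat bstr" where C: "\<And>j. j < n \<Longrightarrow> is_bstr (C j) \<and> Th (C j) = Th (Xs ! j)" by metis
    let ?Zs = "(map C [0..<n])[i := N]"
    have Z: "is_bstr (direct_prod ?Zs) \<and> Th (direct_prod ?Zs) = Th P \<and> tree_product ?Zs"
      by (rule product_of_equivalents) (use N(1,2) C i in \<open>auto simp: nth_list_update\<close>)
    interpret Z: tree_product ?Zs using Z by blast
    have iZ: "i < Z.n" "?Zs ! i = N" using i by simp_all
    let ?u = "\<lambda>x. if x = 0 then Z.axis i else Z.emb i (e (x - 1))"
    have "Z.emb i (e x) \<in> Univ Z.P" for x using Z.emb_in[OF iZ(1), of "e x"] N(3) iZ(2) by (simp add: env_iff)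
    then have u: "env Z.P ?u" using Z.env_axis by (simp add: env_iff)
    have pr: "proj_onto Z.P (?u 0) (\<lambda>x. x ! i) N"
      using Z.proj_onto_axis[OF Z.on_axis_axis[OF iZ(1)]] iZ(2) by simp
    have eq: "bsat Z.P ?u (factor_fm 1 0 \<phi>) \<longleftrightarrow> bsat N e \<phi>" if "csts \<phi> = {}" for \<phi>
      using bsat_factor_fm[OF pr _ u that, of 1] Z.emb_nth[OF iZ(1)] by simp
    have "q = {\<phi> \<in> formulas {} m. factor_fm 1 0 \<phi> \<in> tp (Suc m) Z.P ?u}"
    proof -
      have "factor_fm 1 0 \<phi> \<in> formulas {} (Suc m)" "csts \<phi> = {}" if "\<phi> \<in> formulas {} m" for \<phi>
        using factor_fm_formulas[OF that, of 0 1] that by (auto simp: formulas_def)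
      then show ?thesis unfolding N(4) using eq by (auto simp: tp_def)
    qed
    moreover have "tp (Suc m) Z.P ?u \<in> types {} (Th P) (Suc m)"
      by (rule tp_in_types[OF bP _ _ u]) (use Z in auto)
    ultimately show "q \<in> ?F ` (UNIV \<times> (\<Union>m. types {} (Th P) m))"
      by (intro image_eqI[of _ _ "(m, tp (Suc m) Z.P ?u)"]) auto
  qed
  moreover have "countable (UNIV \<times> (\<Union>m. types {} (Th P) m) :: (nat \<times> _) set)"
    using sm by (intro countable_SIGMA) (auto simp: small_theory_def)
  ultimately show ?thesis unfolding small_theory_def by (meson countable_image countable_subset)
qed

text \<open>By the Feferman--Vaught theorem a type of the product is determined by the list of types of
  the coordinates, in some decomposition of a countable model that realises it.\<close>

lemma small_prod:
  assumes sm: "\<And>i. i < n \<Longrightarrow> small_theory (Th (Xs ! i))" shows "small_theory (Th P)"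
  unfolding small_theory_def
proof (rule countable_UN)
  fix m :: nat
  define S where "S = (\<Union>i<n. \<Union>m. types {} (Th (Xs ! i)) m)"
  have cS: "countable (lists S)" using sm by (auto simp: S_def small_theory_def intro!: countable_lists)
  define R where "R p l \<longleftrightarrow> (\<exists>(Zs :: nat bstr list) d. length Zs = n \<and> env (direct_prod Zs) d \<and>
    p = tp m (direct_prod Zs) d \<and> l = map (\<lambda>i. tp m (Zs ! i) (\<lambda>x. d x ! i)) [0..<n])" for p l
  have R: "p = p'" if R: "R p l" "R p' l" for p p' l
  proof -
    obtain Zs :: "nat bstr list" and d where Z: "length Zs = n" "env (direct_prod Zs) d"
      "p = tp m (direct_prod Zs) d" "l = map (\<lambda>i. tp m (Zs ! i) (\<lambda>x. d x ! i)) [0..<n]"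
      using R(1) unfolding R_def by blast
    obtain Zs' :: "nat bstr list" and d' where Z': "length Zs' = n" "env (direct_prod Zs') d'"
      "p' = tp m (direct_prod Zs') d'" "l = map (\<lambda>i. tp m (Zs' ! i) (\<lambda>x. d' x ! i)) [0..<n]"
      using R(2) unfolding R_def by blast
    have "tp m (Zs ! i) (\<lambda>x. d x ! i) = tp m (Zs' ! i) (\<lambda>x. d' x ! i)" if "i < n" for i
      using Z(4) Z'(4) that by auto
    from prod_tp[OF Z(1) Z'(1) Z(2) Z'(2) this] show ?thesis using Z(3) Z'(3) by simp
  qed
  have "types {} (Th P) m \<subseteq> (\<lambda>l. THE p. R p l) ` lists S"
  proof
    fix p assume p: "p \<in> types {} (Th P) m"
    obtain N :: "nat bstr" and e where N: "is_bstr N" "Th N = Th P" "env N e" "p = tp m N e"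
      using nat_realize[OF bP p] by blast
    obtain Zs :: "nat bstr list" where Zs: "length Zs = n" "\<forall>i<n. is_bstr (Zs ! i) \<and> Th (Zs ! i) = Th (Xs ! i)"
      "N \<simeq> direct_prod Zs" using prod_decompose[OF N(1,2) inj_on_id] by (elim exE conjE) (rule that)
    obtain f where f: "iso_map f N (direct_prod Zs)" using Zs(3) iso_iff by blast
    let ?d = "\<lambda>x. f (e x)" let ?l = "map (\<lambda>i. tp m (Zs ! i) (\<lambda>x. ?d x ! i)) [0..<n]"
    have d: "env (direct_prod Zs) ?d" by (rule iso_map_env[OF f N(3)])
    have "R p ?l" unfolding R_def using Zs(1) d N(4) tp_iso[OF f N(3), of m] by (intro exI[of _ Zs] exI[of _ ?d]) simp
    then have "p = (THE p. R p ?l)" using R by (intro the_equality[symmetric]) blast+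
    moreover have "tp m (Zs ! i) (\<lambda>x. ?d x ! i) \<in> S" if i: "i < n" for i
    proof -
      have "tp m (Zs ! i) (\<lambda>x. ?d x ! i) \<in> types {} (Th (Xs ! i)) m"
        by (rule tp_in_types[OF factor(1)[OF i]]) (use Zs i env_prod[OF d] in auto)
      then show ?thesis using i by (auto simp: S_def)
    qed
    then have "?l \<in> lists S" by auto
    ultimately show "p \<in> (\<lambda>l. THE p. R p l) ` lists S" by blast
  qed
  then show "countable (types {} (Th P) m)" using cS by (meson countable_image countable_subset)
qed simp

end

lemma nat_atomic_model:
  assumes K: "is_bstr K" and at: "atomic_theory (Th K)"
  shows "\<exists>Z :: nat bstr. countable_atomic_model Z (Th K)"
proof -
  obtain N where N: "countable N" "elem_sub (sub K N) K" "atomic_model (sub K N)"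
    using atomic_model_exists[OF K at] by blast
  obtain Z :: "nat bstr" where Z: "is_bstr Z" "sub K N \<simeq> Z"
    using countable_copy[OF elem_sub_bstr[OF N(2)]] N(1) by auto
  have "Th Z = Th K" using iso_Th[OF Z(2) elem_sub_bstr[OF N(2)] Z(1)] elem_sub_Th[OF N(2) K] by simp
  then have "countable_atomic_model Z (Th K)"
    using is_model_Th[OF K, of Z] Z(1) atomic_model_iso[OF Z(2) elem_sub_bstr[OF N(2)] Z(1) N(3)]
    by (simp add: countable_atomic_model_def)
  then show ?thesis ..
qed

lemma nat_saturated_model:
  assumes K: "is_bstr K" and sm: "small_theory (Th K)"
  shows "\<exists>Z :: nat bstr. countably_saturated_model Z (Th K)"
proof -
  let ?W = "upower K"
  have W: "is_bstr ?W" "Th ?W = Th K" "compact_str ?W" using K is_bstr_upower Th_upower compact_upower by auto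
  obtain N where N: "countable N" "elem_sub (sub ?W N) ?W" "omega_sat (sub ?W N)"
    using saturated_submodel[OF W(3), of "{}"] sm W(2) by auto
  obtain Z :: "nat bstr" where Z: "is_bstr Z" "sub ?W N \<simeq> Z"
    using countable_copy[OF elem_sub_bstr[OF N(2)]] N(1) by auto
  have "Th Z = Th K" using iso_Th[OF Z(2) elem_sub_bstr[OF N(2)] Z(1)] elem_sub_Th[OF N(2) W(1)] W(2) by simp
  then have "countably_saturated_model Z (Th K)"
    using is_model_Th[OF K, of Z] Z(1) omega_sat_saturated[OF omega_sat_iso[OF Z(2,1) N(3)]]
    by (simp add: countably_saturated_model_def)
  then show ?thesis ..
qed

section \<open>Cardinal arithmetic for the number of models\<close>

text \<open>If some \<open>S i\<close> has the cardinality of the continuum, so does the product. Otherwise the product is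
  countable: it is infinite iff some \<open>S i\<close> is, and if it is finite and not a singleton, some \<open>S i\<close>
  has at least three elements.\<close>

lemma vaught_product:
  fixes S :: "nat \<Rightarrow> 'x set" and A :: "'y set"
  assumes n: "n \<ge> 1" and ne: "\<And>i. i < n \<Longrightarrow> S i \<noteq> {}"
    and lower: "\<And>i. i < n \<Longrightarrow> |S i| \<le>o |A|" and B: "B = listset (map S [0..<n])" and upper: "|A| \<le>o |B|"
    and v: "\<And>i. i < n \<Longrightarrow> |S i| \<le>o natLeq \<or> |S i| =o continuum"
    and three: "\<And>i. i < n \<Longrightarrow> |S i| \<le>o natLeq \<Longrightarrow> |S i| =o cone \<or> |{..<3 :: nat}| \<le>o |S i|"
  shows "( |A| \<le>o natLeq \<or> |A| =o continuum) \<and>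
    (if |B| =o cone \<or> |B| =o natLeq \<or> |B| =o continuum then |A| =o |B|
     else |{..<3 :: nat}| \<le>o |A| \<and> |A| <o natLeq)"
proof -
  have cont: "Card_order continuum" "natLeq \<le>o continuum"
    using Card_order_cexp ordLess_ctwo_cexp[OF natLeq_Card_order] ordLess_imp_ordLeq by auto
  have contf: "infinite (Field continuum)"
  proof -
    have "natLeq \<le>o |Field continuum|"
      using cont card_of_Field_ordIso[OF cont(1)] ordIso_symmetric ordLeq_ordIso_trans by blast
    then show ?thesis using finite_iff_ordLess_natLeq not_ordLess_ordLeq by blast
  qed
  show ?thesis
  proof (cases "\<exists>i<n. |S i| =o continuum")
    case True
    then obtain i where i: "i < n" "|S i| =o continuum" by blast
    have "|S j| \<le>o continuum" if "j < n" for j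
      using v[OF that] cont(2) ordLeq_transitive ordIso_imp_ordLeq by blast
    then have L: "|B| \<le>o continuum" unfolding B by (intro listset_ordLeq[OF cont(1) contf]) auto
    have cA: "continuum \<le>o |A|" using i lower[OF i(1)] ordIso_symmetric ordIso_ordLeq_trans by blast
    have A: "|A| =o continuum" using cA L upper ordLeq_transitive ordIso_iff_ordLeq by blast
    have "|B| =o continuum" using cA L upper ordLeq_transitive ordIso_iff_ordLeq by blast
    moreover have "|A| =o |B|" using A calculation ordIso_symmetric ordIso_transitive by blast
    ultimately show ?thesis using A by simp
  next
    case False
    then have c: "|S i| \<le>o natLeq" if "i < n" for i using v that by blast
    have "|B| \<le>o natLeq"
      unfolding B by (rule listset_ordLeq[OF natLeq_Card_order]) (use c in \<open>auto simp: Field_natLeq\<close>)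
    then have A: "|A| \<le>o natLeq" using upper ordLeq_transitive by blast
    show ?thesis
    proof (cases "\<exists>i<n. infinite (S i)")
      case True
      then obtain i where i: "i < n" "infinite (S i)" by blast
      then have "natLeq \<le>o |S i|" using infinite_iff_natLeq_ordLeq by blast
      then have nA: "natLeq \<le>o |A|" using lower[OF i(1)] ordLeq_transitive by blast
      have "|A| =o natLeq" using nA A ordIso_iff_ordLeq by blast
      moreover have "|B| =o natLeq"
        using nA upper \<open>|B| \<le>o natLeq\<close> ordLeq_transitive ordIso_iff_ordLeq by blast
      moreover have "|A| =o |B|" using calculation ordIso_symmetric ordIso_transitive by blast
      ultimately show ?thesis using A by simp
    next
      case False
      have "finite (listset (map S xs))" if "\<forall>i\<in>set xs. finite (S i)" for xs
        using that by (induction xs) (auto simp: set_Cons_def intro!: finite_image_set2)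
      then have finL: "finite B" using False by (simp add: B)
      then have nL: "\<not> |B| =o natLeq" "\<not> |B| =o continuum"
        using finite_iff_ordLess_natLeq[of B] cont(2) not_ordLess_ordIso ordLess_ordLeq_trans not_ordLess_ordIso by blast+
      have finA: "|A| <o natLeq" using upper finL finite_iff_ordLess_natLeq ordLeq_ordLess_trans by blast
      show ?thesis
      proof (cases "|B| =o cone")
        case True
        then have "|A| \<le>o cone" using upper ordLeq_ordIso_trans by blast
        moreover have "A \<noteq> {}" using lower[of 0] ne[of 0] n card_of_empty3 by fastforce
        then have "cone \<le>o |A|" unfolding cone_def by (rule card_of_singl_ordLeq)
        ultimately have "|A| =o cone" using ordIso_iff_ordLeq by blast
        then have "|A| =o |B|" using True ordIso_symmetric ordIso_transitive by blast
        then show ?thesis using True A by simp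
      next
        case notone: False
        have "\<exists>i<n. \<not> |S i| =o cone"
        proof (rule ccontr)
          assume one: "\<not> (\<exists>i<n. \<not> |S i| =o cone)"
          have "\<exists>s. i < n \<longrightarrow> S i = {s}" for i using one card_one_iff[of "S i"] by blast
          then obtain s where s: "\<And>i. i < n \<Longrightarrow> S i = {s i}" by metis
          have "B = {map s [0..<n]}" using s by (auto simp: B listset_iff intro!: nth_equalityI)
          then show False using notone card_one_iff by blast
        qed
        then obtain i where i: "i < n" "\<not> |S i| =o cone" by blast
        then have "|{..<3 :: nat}| \<le>o |A|" using three[OF i(1) c[OF i(1)]] lower[OF i(1)] ordLeq_transitive by blast
        then show ?thesis using notone nL finA A by simp
      qed
    qed
  qed
qed

theorem theorem4p11:
  shows "Perf_s TYPE('k) (direct_prod :: 'a bstr list \<Rightarrow> 'a list bstr) rooted_trees_gt1 \<and>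
    (\<forall>(n::nat) (Xs :: 'a bstr list) T \<T> \<kappa>.
       n \<ge> 1 \<and> length Xs = n \<and> (\<forall>i<n. Xs ! i \<in> rooted_trees_gt1) \<and>
       T = Th (direct_prod Xs) \<and> \<T> = (\<lambda>i. Th (Xs ! i)) \<and>
       \<kappa> = card_prod (map (\<lambda>i. num_models (\<T> i)) [0..<n]) \<longrightarrow>
       \<comment> \<open>(a)\<close>
       (\<forall>i<n. num_models (\<T> i) \<le>o num_models T) \<and>
       num_models T \<le>o \<kappa> \<and>
       (num_models T =o cone \<longleftrightarrow> (\<forall>i<n. num_models (\<T> i) =o cone)) \<and>
       \<comment> \<open>(b)\<close>
       ((\<forall>i<n. vaught (\<T> i)) \<longrightarrow>
          vaught T \<and>
          (if \<kappa> =o cone \<or> \<kappa> =o natLeq \<or> \<kappa> =o continuum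
           then num_models T =o \<kappa>
           else |{..<3::nat}| \<le>o num_models T \<and> num_models T <o natLeq)) \<and>
       \<comment> \<open>(c)\<close>
       (atomic_theory T \<longleftrightarrow> (\<forall>i<n. atomic_theory (\<T> i))) \<and>
       (atomic_theory T \<longrightarrow>
          (\<forall>i<n. \<exists>Z :: nat bstr. countable_atomic_model Z (\<T> i)) \<and>
          (\<forall>Zs :: 'b bstr list. length Zs = n \<and>
             (\<forall>i<n. countable_atomic_model (Zs ! i) (\<T> i)) \<longrightarrow>
             countable_atomic_model (direct_prod Zs) T)) \<and>
       \<comment> \<open>(d)\<close>
       (small_theory T \<longleftrightarrow> (\<forall>i<n. small_theory (\<T> i))) \<and>
       (small_theory T \<longrightarrow>
          (\<forall>i<n. \<exists>Z :: nat bstr. countably_saturated_model Z (\<T> i)) \<and>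
          (\<forall>Zs :: 'b bstr list. length Zs = n \<and>
             (\<forall>i<n. countably_saturated_model (Zs ! i) (\<T> i)) \<longrightarrow>
             countably_saturated_model (direct_prod Zs) T)))"
proof (intro conjI[OF perfect_pair_s] allI impI, goal_cases)
  case (1 n Xs T \<T> \<kappa>)
  then have n: "n \<ge> 1" and len: "length Xs = n" and trees: "\<forall>i<n. Xs ! i \<in> rooted_trees_gt1"
    and T: "T = Th (direct_prod Xs)" and Ti: "\<T> = (\<lambda>i. Th (Xs ! i))"
    and \<kappa>: "\<kappa> = card_prod (map (\<lambda>i. num_models (\<T> i)) [0..<n])" by blast+
  interpret tree_product Xs using len trees by unfold_locales simp
  let ?S = "\<lambda>i. iso_types (\<T> i)"
  have \<kappa>': "\<kappa> = |listset (map ?S [0..<n])|"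
    by (simp add: \<kappa> card_prod_def num_models_eq comp_def Field_card_of)
  have ne: "?S i \<noteq> {}" if "i < n" for i
    using iso_types_nonempty[OF factor(1) refl] that len by (simp add: Ti)
  have lower: "|?S i| \<le>o |iso_types T|" if "i < n" for i
    using iso_types_lower that len by (simp add: T Ti)
  have upper: "|iso_types T| \<le>o |listset (map ?S [0..<n])|"
    using iso_types_upper len by (simp add: T Ti)
  have a3: "num_models T =o cone \<longleftrightarrow> (\<forall>i<n. num_models (\<T> i) =o cone)"
    unfolding num_models_eq
  proof
    assume one: "|iso_types T| =o cone"
    show "\<forall>i<n. |?S i| =o cone"
    proof (intro allI impI)
      fix i assume i: "i < n"
      have "|?S i| \<le>o cone" using lower[OF i] one ordLeq_ordIso_trans by blast
      moreover have "cone \<le>o |?S i|" unfolding cone_def by (rule card_of_singl_ordLeq[OF ne[OF i]])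
      ultimately show "|?S i| =o cone" using ordIso_iff_ordLeq by blast
    qed
  next
    assume one: "\<forall>i<n. |?S i| =o cone"
    have "\<exists>s. i < n \<longrightarrow> ?S i = {s}" for i using one card_one_iff[of "?S i"] by blast
    then obtain s where s: "\<And>i. i < n \<Longrightarrow> ?S i = {s i}" by metis
    have "listset (map ?S [0..<n]) = {map s [0..<n]}" using s by (auto simp: listset_iff intro!: nth_equalityI)
    then have "|listset (map ?S [0..<n])| =o cone" using card_one_iff by blast
    then have "|iso_types T| \<le>o cone" using upper ordLeq_ordIso_trans by blast
    moreover have "cone \<le>o |iso_types T|"
      unfolding cone_def T by (rule card_of_singl_ordLeq[OF iso_types_nonempty[OF bP refl]])
    ultimately show "|iso_types T| =o cone" using ordIso_iff_ordLeq by blast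
  qed
  have b: "vaught T \<and>
          (if \<kappa> =o cone \<or> \<kappa> =o natLeq \<or> \<kappa> =o continuum
           then num_models T =o \<kappa>
           else |{..<3::nat}| \<le>o num_models T \<and> num_models T <o natLeq)" if v: "\<forall>i<n. vaught (\<T> i)"
    unfolding vaught_def num_models_eq \<kappa>'
  proof (rule vaught_product[OF n ne lower refl upper])
    show "|?S i| \<le>o natLeq \<or> |?S i| =o continuum" if "i < n" for i
      using v that by (simp add: vaught_def num_models_eq)
    show "|?S i| =o cone \<or> |{..<3 :: nat}| \<le>o |?S i|" if "i < n" "|?S i| \<le>o natLeq" for i
      using never_two[OF factor(1), of i] that len by (simp add: Ti countable_natLeq)
  qed
  have model: "is_bstr (direct_prod Zs) \<and> is_model (direct_prod Zs) T \<and> tree_product Zs"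
    if Z: "length Zs = n" "\<forall>i<n. is_model (Zs ! i) (\<T> i)" for Zs :: "'z bstr list"
  proof -
    have "is_bstr (Zs ! i) \<and> Th (Zs ! i) = Th (Xs ! i)" if "i < length Xs" for i
      using Z that is_model_Th[OF factor(1)[OF that], of "Zs ! i"] len by (simp add: Ti)
    from product_of_equivalents[OF _ this] show ?thesis using Z(1) len is_model_Th[OF bP, of "direct_prod Zs"] by (simp add: T)
  qed
  have c2: "countable_atomic_model (direct_prod Zs) T"
    if Z: "length Zs = n" "\<forall>i<n. countable_atomic_model (Zs ! i) (\<T> i)" for Zs :: "'z bstr list"
  proof -
    have m: "is_model (direct_prod Zs) T" "tree_product Zs"
      using model[of Zs] Z by (auto simp: countable_atomic_model_def)
    interpret Z: tree_product Zs by (rule m(2))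
    have "atomic_model Z.P" by (rule Z.atomic_prod) (use Z in \<open>auto simp: countable_atomic_model_def\<close>)
    moreover have "countable (Univ Z.P)" by (rule countable_prod) (use Z in \<open>auto simp: countable_atomic_model_def\<close>)
    ultimately show ?thesis using m by (simp add: countable_atomic_model_def)
  qed
  have c1: "\<exists>Z :: nat bstr. countable_atomic_model Z (\<T> i)" if "i < n" "atomic_theory (\<T> i)" for i
    using nat_atomic_model[OF factor(1)] that len by (simp add: Ti)
  have c: "atomic_theory T \<longleftrightarrow> (\<forall>i<n. atomic_theory (\<T> i))"
  proof
    show "atomic_theory T \<Longrightarrow> \<forall>i<n. atomic_theory (\<T> i)" using atomic_theory_factor len by (simp add: T Ti)
    assume "\<forall>i<n. atomic_theory (\<T> i)"
    then have "\<forall>i. \<exists>Z :: nat bstr. i < n \<longrightarrow> countable_atomic_model Z (\<T> i)" using c1 by blast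
    then obtain Z :: "_ \<Rightarrow> nat bstr" where Z: "\<And>i. i < n \<Longrightarrow> countable_atomic_model (Z i) (\<T> i)" by metis
    let ?Z = "map Z [0..<n]"
    have "countable_atomic_model (direct_prod ?Z) T" by (rule c2) (use Z in auto)
    then have "is_bstr (direct_prod ?Z)" "Th (direct_prod ?Z) = T" "atomic_model (direct_prod ?Z)"
      using is_model_Th[OF bP] by (auto simp: countable_atomic_model_def T)
    then show "atomic_theory T" using atomic_model_imp_theory by metis
  qed
  have d: "small_theory T \<longleftrightarrow> (\<forall>i<n. small_theory (\<T> i))"
    using small_factor small_prod len by (auto simp: T Ti)
  have d1: "\<exists>Z :: nat bstr. countably_saturated_model Z (\<T> i)" if "i < n" "small_theory (\<T> i)" for i
    using nat_saturated_model[OF factor(1)] that len by (simp add: Ti)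
  have d2: "countably_saturated_model (direct_prod Zs) T"
    if Z: "length Zs = n" "\<forall>i<n. countably_saturated_model (Zs ! i) (\<T> i)" for Zs :: "'b bstr list"
  proof -
    have "is_model (direct_prod Zs) T" using model[of Zs] Z by (auto simp: countably_saturated_model_def)
    moreover have "saturated natLeq (direct_prod Zs)"
      by (rule saturated_prod) (use Z in \<open>auto simp: countably_saturated_model_def is_model_def\<close>)
    moreover have "countable (Univ (direct_prod Zs))"
      by (rule countable_prod) (use Z in \<open>auto simp: countably_saturated_model_def\<close>)
    ultimately show ?thesis by (simp add: countably_saturated_model_def)
  qed
  have c2': "\<forall>Zs :: 'b bstr list. length Zs = n \<and> (\<forall>i<n. countable_atomic_model (Zs ! i) (\<T> i)) \<longrightarrow>
      countable_atomic_model (direct_prod Zs) T"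
    by (intro allI impI, elim conjE) (rule c2)
  have d2': "\<forall>Zs :: 'b bstr list. length Zs = n \<and> (\<forall>i<n. countably_saturated_model (Zs ! i) (\<T> i)) \<longrightarrow>
      countably_saturated_model (direct_prod Zs) T"
    by (intro allI impI, elim conjE) (rule d2)
  have a1: "\<forall>i<n. num_models (\<T> i) \<le>o num_models T" using lower by (simp add: num_models_eq)
  have a2: "num_models T \<le>o \<kappa>" using upper by (simp add: num_models_eq \<kappa>')
  have c3: "\<forall>i<n. \<exists>Z :: nat bstr. countable_atomic_model Z (\<T> i)" if "atomic_theory T"
    using that c c1 by blast
  have d3: "\<forall>i<n. \<exists>Z :: nat bstr. countably_saturated_model Z (\<T> i)" if "small_theory T"
    using that d d1 by blast
  show ?case
    by (intro conjI impI a1 a2 a3 b[THEN conjunct1] b[THEN conjunct2] c d c3 d3 c2' d2')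
qed

end
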